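(* Let $F$ be a (possibly non-orientable) complete hyperbolic surface of finite type with at least one cusp, and let $\Delta_{tab}$ be an ideal hyperbolic triangle with ideal vertices $t,a,b$. Let $\nu:\Delta_{tab}\to F$ be a local isometry such that $\nu|_{l_{ta}}$ and $\nu|_{l_{tb}}$ are embeddings and $\nu$ maps $t,a,b$ to cusps of $F$ (not necessarily distinct). Then every slit of $\nu$ is an embedding; that is, for every $n\in\Delta_{tab}$, the map $\nu|_{l_{nt}}:l_{nt}\to F$ is an embedding.
   Context: For points $x,y$ of an ideal triangle (ideal vertices allowed), $l_{xy}$ denotes the geodesic (segment, ray or line) joining $x$ and $y$; ideal endpoints are not part of the domain. "$\nu$ maps an ideal vertex to a cusp" means that the corresponding end of $\Delta_{tab}$ is sent into a cusp of $F$. For a local isometry $\nu:\Delta_{tab}\to F$ and a point $n\in\Delta_{tab}$, the restriction $\nu|_{l_{nt}}:l_{nt}\to F$ to the geodesic ray from $n$ to $t$ is called a slit of $\nu$. *)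

theory Defs
  imports "HOL-Analysis.Analysis"
begin

text \<open>
  The hyperbolic plane is the Klein (projective) disc model: its points are those of the open unit
  disc, its ideal points are those of the unit circle, and its geodesics are Euclidean chords.
  The metric \<open>hdist\<close> (curvature -1) is that of the hyperboloid model, transported along
  \<open>x \<mapsto> (x, 1) / sqrt (1 - |x|^2)\<close>, where
  \<open>cosh d\<close> is minus the Lorentz product. It induces the Euclidean topology on the disc.
\<close>

abbreviation hplane :: "complex set" where
  "hplane \<equiv> ball 0 1"

abbreviation ideal_boundary :: "complex set" where
  "ideal_boundary \<equiv> sphere 0 1"

definition hdist :: "complex \<Rightarrow> complex \<Rightarrow> real" where
  "hdist x y = arcosh ((1 - x \<bullet> y) / sqrt ((1 - (norm x)\<^sup>2) * (1 - (norm y)\<^sup>2)))"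

text \<open>
  Endpoints may be ideal; ideal points are removed from the geodesic and from the triangle.
\<close>

definition geodesic :: "complex \<Rightarrow> complex \<Rightarrow> complex set" where
  "geodesic x y = closed_segment x y \<inter> hplane"

definition ideal_triangle :: "complex \<Rightarrow> complex \<Rightarrow> complex \<Rightarrow> complex set" where
  "ideal_triangle t a b = convex hull {t, a, b} \<inter> hplane"

text \<open>
  The horoball of size \<open>s\<close> centred at the ideal point \<open>u\<close>: in the hyperboloid model, the points
  whose Lorentz product with the null vector \<open>(u, 1)\<close> is greater than \<open>- s\<close>.
\<close>

definition horoball :: "complex \<Rightarrow> real \<Rightarrow> complex set" where
  "horoball u s = {x \<in> hplane. 1 - x \<bullet> u < s * sqrt (1 - (norm x)\<^sup>2)}"

definition hyp_isometry :: "(complex \<Rightarrow> complex) \<Rightarrow> bool" where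
  "hyp_isometry g \<longleftrightarrow>
     bij_betw g hplane hplane \<and> (\<forall>x\<in>hplane. \<forall>y\<in>hplane. hdist (g x) (g y) = hdist x y)"

text \<open>
  Parabolic isometries fixing the ideal point \<open>u\<close>. Preserving the horoballs excludes hyperbolic
  isometries and glide reflections; freeness excludes the identity and reflections.
\<close>

definition parabolic_at :: "complex \<Rightarrow> (complex \<Rightarrow> complex) \<Rightarrow> bool" where
  "parabolic_at u g \<longleftrightarrow>
     hyp_isometry g \<and> (\<forall>s>0. g ` horoball u s = horoball u s) \<and> (\<forall>x\<in>hplane. g x \<noteq> x)"

text \<open>
  A surface is a set \<open>F\<close> in a metric space, considered with the restricted metric, which has to be
  the length metric of \<open>F\<close>. The length of a path is the supremum of the lengths of the
  inscribed polygons.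
\<close>

definition curve_length :: "(real \<Rightarrow> 'f::metric_space) \<Rightarrow> ereal" where
  "curve_length c =
     (SUP ts \<in> {ts. sorted ts \<and> set ts \<subseteq> {0..1}}.
        \<Sum>i<length ts - 1. ereal (dist (c (ts ! i)) (c (ts ! Suc i))))"

text \<open>An infimum over no paths is infinite, so this includes path connectedness.\<close>

definition length_space :: "'f::metric_space set \<Rightarrow> bool" where
  "length_space F \<longleftrightarrow>
     (\<forall>x\<in>F. \<forall>y\<in>F. ereal (dist x y) =
        (INF c \<in> {c. path c \<and> path_image c \<subseteq> F \<and> pathstart c = x \<and> pathfinish c = y}.
           curve_length c))"

definition complete_hyperbolic_surface :: "'f::metric_space set \<Rightarrow> bool" where
  "complete_hyperbolic_surface F \<longleftrightarrow>
     F \<noteq> {} \<and> connected F \<and> complete F \<and> length_space F \<and>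
     (\<forall>x\<in>F. \<exists>r>0. \<exists>\<phi>. \<phi> x \<in> hplane \<and>
        \<phi> ` (F \<inter> ball x r) = {y \<in> hplane. hdist (\<phi> x) y < r} \<and>
        (\<forall>y\<in>F \<inter> ball x r. \<forall>z\<in>F \<inter> ball x r. hdist (\<phi> y) (\<phi> z) = dist y z))"

text \<open>
  Finite type: homeomorphic to a closed surface minus finitely many points. A space obtained from
  \<open>F\<close> by adding finitely many points can be carried by the type \<open>'f + nat\<close>, so fixing this type
  loses nothing.
\<close>

definition closed_surface :: "'x topology \<Rightarrow> bool" where
  "closed_surface X \<longleftrightarrow>
     compact_space X \<and> connected_space X \<and> Hausdorff_space X \<and>
     (\<forall>x\<in>topspace X. \<exists>U. openin X U \<and> x \<in> U \<and>
        subtopology X U homeomorphic_space (euclidean :: complex topology))"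

definition finite_type :: "'f::metric_space set \<Rightarrow> bool" where
  "finite_type F \<longleftrightarrow>
     (\<exists>(X :: ('f + nat) topology) P. closed_surface X \<and> finite P \<and> P \<subseteq> topspace X \<and>
        top_of_set F homeomorphic_space subtopology X (topspace X - P))"

text \<open>
  Local isometries on a subset \<open>A\<close> of the hyperbolic plane. For \<open>A\<close> convex the restriction of
  \<open>hdist\<close> is the length metric of \<open>A\<close>, also at boundary points.
\<close>

definition local_isometry :: "complex set \<Rightarrow> 'f::metric_space set \<Rightarrow> (complex \<Rightarrow> 'f) \<Rightarrow> bool" where
  "local_isometry A F f \<longleftrightarrow>
     f ` A \<subseteq> F \<and>
     (\<forall>x\<in>A. \<exists>e>0. \<forall>y\<in>A. \<forall>z\<in>A. hdist x y < e \<longrightarrow> hdist x z < e \<longrightarrow> dist (f y) (f z) = hdist y z)"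

text \<open>
  A cusp of \<open>F\<close>: a region \<open>C\<close> that is locally isometrically identified with the quotient of a
  horoball by the infinite cyclic group generated by a parabolic isometry.
\<close>

definition cusp :: "'f::metric_space set \<Rightarrow> 'f set \<Rightarrow> bool" where
  "cusp F C \<longleftrightarrow>
     (\<exists>u\<in>ideal_boundary. \<exists>s>0. \<exists>g p. parabolic_at u g \<and> local_isometry (horoball u s) F p \<and>
        (\<forall>x\<in>horoball u s. \<forall>y\<in>horoball u s.
           p x = p y \<longleftrightarrow> (\<exists>n. y = (g ^^ n) x \<or> x = (g ^^ n) y)) \<and>
        C = p ` horoball u s)"

text \<open>
  The end of \<open>D\<close> at its ideal vertex \<open>v\<close> is represented by the intersections of \<open>D\<close> with
  horoballs centred at \<open>v\<close>.
\<close>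

definition maps_to_cusp ::
  "complex set \<Rightarrow> 'f::metric_space set \<Rightarrow> (complex \<Rightarrow> 'f) \<Rightarrow> complex \<Rightarrow> bool" where
  "maps_to_cusp D F f v \<longleftrightarrow> (\<exists>C. cusp F C \<and> (\<exists>s>0. f ` (D \<inter> horoball v s) \<subseteq> C))"

end

(* Place t at infinity and a, b at 0, 1 of the upper half-plane. Since F is complete, nu extends to a
   local isometry N of the whole half-plane, and N x = N y forces an isometry m with m x = y and
   N o m = N; a nontrivial such m has no fixed point. A self-crossing of the slit over n in (0,1) gives
   m with x and y both over n. As N is invariant under a translation (t is sent to a cusp), m does not
   fix infinity, so m z = s - r / (z - s') or m z = s + r / (cnj z - s') with real s, s' and r > 0.
   The sides over 0 and 1 are embedded, so m and m o m carry neither of them to a line crossing it;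
   together with freeness and with x, y lying above the side from 0 to 1, the resulting inequalities
   in s, s', r contradict each other. An injective slit is an embedding because it escapes from every
   compact set into the cusp. *)
theory Submission
  imports Defs
begin

text \<open>The universal covering of F is never built. Continuation of local isometries over
  growing discs, and the principle that two of them agree on a connected open set once they agree
  near one point, take its place: the isometries m with N \<circ> m = N act as deck transformations.
  In the normal forms s is the image of infinity and s' its preimage. The line over v goes to the
  half-circle from s to m v, and the two cross when v lies strictly between these ends; this is a
  comparison of \<rho> with (v - s)(v - s'), and so an embedded side becomes an inequality. The side
  from 0 to 1 enters through y^2 \<ge> n(1 - n), which says that n + \<i> y lies on or above it. The
  obstacle is a possibly non-orientable F. For an orientation-reversing m the sides over 0 and 1
  give bounds that are too weak; m \<circ> m supplies the missing one, and the borderline case,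
  where m fixes the vertex 1, falls to the cusp there. That cusps give translations is itself an
  argument: a ray running into a cusp stays in one lift of it, so the isometry matching the two
  pictures fixes infinity.\<close>

definition uhp :: "complex set" where
  "uhp = {z. Im z > 0}"

definition udist :: "complex \<Rightarrow> complex \<Rightarrow> real" where
  "udist z w = arcosh (1 + (cmod (z - w))\<^sup>2 / (2 * Im z * Im w))"

definition lft :: "real \<Rightarrow> real \<Rightarrow> real \<Rightarrow> real \<Rightarrow> complex \<Rightarrow> complex" where
  "lft a b c d z = (of_real a * z + of_real b) / (of_real c * z + of_real d)"

text \<open>A negative determinant makes \<open>lft\<close> exchange the two half-planes;
  conjugating the argument first undoes this. Thus one coefficient matrix describes
  orientation-preserving and orientation-reversing isometries alike.\<close>

definition mob :: "real \<Rightarrow> real \<Rightarrow> real \<Rightarrow> real \<Rightarrow> complex \<Rightarrow> complex" where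
  "mob a b c d z = lft a b c d (if a * d - b * c > 0 then z else cnj z)"

definition isom :: "(complex \<Rightarrow> complex) \<Rightarrow> bool" where
  "isom m \<longleftrightarrow> (\<exists>a b c d. a * d - b * c \<noteq> 0 \<and> (\<forall>z\<in>uhp. m z = mob a b c d z))"

section \<open>Comparison of the hyperbolic and the Euclidean distance\<close>

lemma open_uhp: "open uhp"
  unfolding uhp_def by (intro open_Collect_less continuous_intros)

lemma convex_uhp: "convex uhp"
  unfolding uhp_def by (rule convex_halfspace_Im_gt)

lemma cmod_diff_sq: "(cmod (z - w))\<^sup>2 = (Re z - Re w)\<^sup>2 + (Im z - Im w)\<^sup>2"
  by (simp add: cmod_power2)

lemma cosh_udist: "z \<in> uhp \<Longrightarrow> w \<in> uhp \<Longrightarrow> cosh (udist z w) = 1 + (cmod (z - w))\<^sup>2 / (2 * Im z * Im w)"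
  unfolding udist_def uhp_def by (subst cosh_arcosh_real) auto

lemma udist_nonneg: "z \<in> uhp \<Longrightarrow> w \<in> uhp \<Longrightarrow> udist z w \<ge> 0"
  unfolding udist_def uhp_def by (rule arcosh_nonneg_real) auto

lemma udist_commute: "udist z w = udist w z"
  unfolding udist_def by (simp add: norm_minus_commute mult.commute mult.left_commute)

lemma udist_eq_iff:
  assumes "z \<in> uhp" "w \<in> uhp" "z' \<in> uhp" "w' \<in> uhp"
  shows "udist z w = udist z' w' \<longleftrightarrow>
    (cmod (z - w))\<^sup>2 * (Im z' * Im w') = (cmod (z' - w'))\<^sup>2 * (Im z * Im w)"
proof -
  have "udist z w = udist z' w' \<longleftrightarrow> cosh (udist z w) = cosh (udist z' w')"
    using udist_nonneg[OF assms(1,2)] udist_nonneg[OF assms(3,4)] by simp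
  also have "\<dots> \<longleftrightarrow> (cmod (z - w))\<^sup>2 / (2 * Im z * Im w) = (cmod (z' - w'))\<^sup>2 / (2 * Im z' * Im w')"
    by (simp add: cosh_udist assms)
  also have "\<dots> \<longleftrightarrow> (cmod (z - w))\<^sup>2 * (Im z' * Im w') = (cmod (z' - w'))\<^sup>2 * (Im z * Im w)"
    using assms by (simp add: uhp_def frac_eq_eq mult_ac)
  finally show ?thesis .
qed

lemma udist_eq_0_iff: "z \<in> uhp \<Longrightarrow> w \<in> uhp \<Longrightarrow> udist z w = 0 \<longleftrightarrow> z = w"
  unfolding udist_def uhp_def by (subst arcosh_eq_0_iff_real) auto

lemma udist_less_iff:
  assumes "z \<in> uhp" "w \<in> uhp" "e > 0"
  shows "udist z w < e \<longleftrightarrow> (cmod (z - w))\<^sup>2 < (cosh e - 1) * (2 * Im z * Im w)"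
proof -
  have "udist z w < e \<longleftrightarrow> cosh (udist z w) < cosh e"
    using cosh_real_nonneg_less_iff[of "udist z w" e] udist_nonneg[OF assms(1,2)] assms(3) by simp
  also have "\<dots> \<longleftrightarrow> (cmod (z - w))\<^sup>2 / (2 * Im z * Im w) < cosh e - 1"
    by (simp add: cosh_udist assms algebra_simps)
  also have "\<dots> \<longleftrightarrow> (cmod (z - w))\<^sup>2 < (cosh e - 1) * (2 * Im z * Im w)"
    using assms by (subst pos_divide_less_eq) (auto simp: uhp_def)
  finally show ?thesis .
qed

lemma cosh_minus_1_pos: "e > 0 \<Longrightarrow> cosh (e::real) - 1 > 0"
  using cosh_real_ge_1[of e] cosh_real_one_iff[of e] by linarith

text \<open>The estimate x^2 / 2 \<le> cosh x - 1 turns the formula for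
  \<open>cosh (udist z w)\<close> into a bound linear in the Euclidean distance.\<close>

lemma udist_le:
  assumes "z \<in> uhp" "w \<in> uhp" "m > 0" "m \<le> Im z" "m \<le> Im w"
  shows "udist z w \<le> cmod (z - w) / m"
proof -
  have "(x::real)\<^sup>2 / 2 \<le> cosh x - 1" if "x \<ge> 0" for x
  proof -
    have "x / 2 \<le> sinh (x / 2)"
    proof -
      have "(\<lambda>y::real. sinh y - y) 0 \<le> (\<lambda>y::real. sinh y - y) (x/2)"
        by (rule DERIV_nonneg_imp_nondecreasing[of 0 "x/2"])
           (use that in \<open>auto intro!: exI derivative_eq_intros cosh_real_ge_1 simp: cosh_real_ge_1\<close>)
      then show ?thesis by simp
    qed
    then have "(x/2)\<^sup>2 \<le> (sinh (x/2))\<^sup>2"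
      using that by (intro power_mono) auto
    moreover have "cosh x = 1 + 2 * (sinh (x/2))\<^sup>2"
      using cosh_double[of "x/2"] by (simp add: cosh_square_eq)
    ultimately show ?thesis by (simp add: power2_eq_square)
  qed
  from this[of "cmod (z - w) / m"] have *: "(cmod (z - w))\<^sup>2 / (2 * m\<^sup>2) \<le> cosh (cmod (z - w) / m) - 1"
    using assms by (simp add: power_divide)
  have "(cmod (z - w))\<^sup>2 / (2 * Im z * Im w) \<le> (cmod (z - w))\<^sup>2 / (2 * m\<^sup>2)"
    using assms by (intro divide_left_mono) (auto simp: power2_eq_square intro!: mult_mono mult_pos_pos)
  then have "cosh (udist z w) \<le> cosh (cmod (z - w) / m)"
    using * by (simp add: cosh_udist assms)
  then show ?thesis
    using cosh_real_nonneg_le_iff[of "udist z w" "cmod (z - w) / m"] udist_nonneg[OF assms(1,2)] assms(3) by simp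
qed

lemma udist_small_nhd:
  assumes "x \<in> uhp" "e > 0"
  obtains d where "d > 0" "ball x d \<subseteq> uhp" "\<And>z w. z \<in> ball x d \<Longrightarrow> w \<in> ball x d \<Longrightarrow> udist z w < e"
proof -
  define m where "m = Im x / 2"
  have m: "m > 0" using assms by (simp add: m_def uhp_def)
  define d where "d = min m (m * e / 2)"
  have d: "d > 0" using m assms by (simp add: d_def)
  have I: "Im z > m" if "z \<in> ball x d" for z
    using that abs_Im_le_cmod[of "x - z"] by (auto simp: dist_norm d_def m_def)
  have sub: "ball x d \<subseteq> uhp" using I m by (force simp: uhp_def)
  have "udist z w < e" if "z \<in> ball x d" "w \<in> ball x d" for z w
  proof -
    have "udist z w \<le> cmod (z - w) / m"
      by (rule udist_le) (use I[OF that(1)] I[OF that(2)] sub that m in auto)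
    also have "cmod (z - w) < 2 * d"
      using that dist_triangle_half_r[of x z "2*d" w] by (simp add: dist_norm)
    then have "cmod (z - w) / m < 2 * d / m" using m by (simp add: divide_strict_right_mono)
    also have "2 * d / m \<le> e" using m by (simp add: d_def field_simps min_def)
    finally show ?thesis .
  qed
  with d sub that show ?thesis by blast
qed

text \<open>The Euclidean size of a hyperbolic disc of fixed radius grows with the height of its
  centre; hence the height of x is bounded, while z is free.\<close>

lemma udist_ball_subset:
  fixes y :: real
  assumes y: "y > 0" and "e > 0"
  shows "\<exists>d>0. \<forall>x\<in>uhp. \<forall>z\<in>uhp. Im x \<le> y \<longrightarrow> udist x z < d \<longrightarrow> cmod (x - z) < e"
proof -
  \<comment> \<open>\<open>t\<close> is cosh d - 1 for the radius d to be found. The bound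
    \<open>4 * t \<le> 1\<close> first forces \<open>?D < y\<close>, so that \<open>Im z\<close> is
    below 2 y; then t y^2 small against e^2 finishes.\<close>
  define t where "t = min 1 (e\<^sup>2 / (8 * y\<^sup>2)) / 4"
  have "t \<le> e\<^sup>2 / (8 * y\<^sup>2) / 4" by (simp add: t_def)
  then have "32 * t * y\<^sup>2 \<le> e\<^sup>2" using y by (simp add: field_simps)
  then have t: "t > 0" "4 * t \<le> 1" "32 * t * y\<^sup>2 \<le> e\<^sup>2" using assms y by (auto simp: t_def)
  define d where "d = arcosh (1 + t)"
  have d: "d > 0" "cosh d = 1 + t" using t by (auto simp: d_def)
  have "cmod (x - z) < e" if x: "x \<in> uhp" and z: "z \<in> uhp" and xy: "Im x \<le> y" and xz: "udist x z < d" for x z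
  proof -
    let ?D = "cmod (x - z)"
    have "?D\<^sup>2 < (2 * t * Im z) * Im x"
      using xz udist_less_iff[OF x z d(1)] d by (simp add: mult_ac)
    also have "\<dots> \<le> (2 * t * Im z) * y" using xy t z by (intro mult_left_mono) (auto simp: uhp_def)
    finally have 1: "?D\<^sup>2 < 2 * t * y * Im z" by (simp add: mult_ac)
    have 2: "Im z \<le> y + ?D" using abs_Im_le_cmod[of "x - z"] xy by simp
    have ty: "2 * t * y > 0" using t y by simp
    have 3: "?D\<^sup>2 < 2 * t * y * (y + ?D)" using 1 mult_left_mono[OF 2, of "2*t*y"] ty by linarith
    have "?D < y"
    proof (rule ccontr)
      assume "\<not> ?D < y"
      then have "2 * t * y * (y + ?D) \<le> 2 * t * ?D * (?D + ?D)"
        using t y by (intro mult_mono) auto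
      also have "\<dots> = (4 * t) * ?D\<^sup>2" by (simp add: power2_eq_square)
      also have "\<dots> \<le> 1 * ?D\<^sup>2" using t by (intro mult_right_mono) auto
      finally show False using 3 by simp
    qed
    then have "2 * t * y * (y + ?D) \<le> 2 * t * y * (y + y)" using ty by (intro mult_left_mono) auto
    then have "?D\<^sup>2 < 4 * t * y\<^sup>2" using 3 by (simp add: power2_eq_square)
    also have "\<dots> \<le> 32 * t * y\<^sup>2" using t y by simp
    finally have "?D\<^sup>2 < e\<^sup>2" using t by linarith
    then show ?thesis using assms power2_less_imp_less by fastforce
  qed
  with d show ?thesis by blast
qed

subsection \<open>Isometries of the half-plane\<close>

lemma lft_denom_nz:
  assumes "a * d - b * c \<noteq> 0" "Im z \<noteq> 0"
  shows "of_real c * z + of_real d \<noteq> (0::complex)"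
proof
  assume 0: "of_real c * z + of_real d = (0::complex)"
  then have "c * Im z = 0" "c * Re z + d = 0" by (auto simp: complex_eq_iff)
  then have "c = 0" "d = 0" using assms by auto
  then show False using assms by simp
qed

lemma Im_lft:
  assumes "a * d - b * c \<noteq> 0" "Im z \<noteq> 0"
  shows "Im (lft a b c d z) = (a * d - b * c) * Im z / (cmod (of_real c * z + of_real d))\<^sup>2"
proof -
  have "Im (lft a b c d z) = (Im (of_real a * z + of_real b) * Re (of_real c * z + of_real d) -
      Re (of_real a * z + of_real b) * Im (of_real c * z + of_real d)) /
      (cmod (of_real c * z + of_real d))\<^sup>2"
    unfolding lft_def by (simp add: Im_divide cmod_power2)
  also have "Im (of_real a * z + of_real b) * Re (of_real c * z + of_real d) -
      Re (of_real a * z + of_real b) * Im (of_real c * z + of_real d) = (a * d - b * c) * Im z"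
    by (simp add: algebra_simps)
  finally show ?thesis .
qed

lemma lft_diff:
  assumes "a * d - b * c \<noteq> 0" "Im z \<noteq> 0" "Im w \<noteq> 0"
  shows "lft a b c d z - lft a b c d w =
    of_real (a * d - b * c) * (z - w) / ((of_real c * z + of_real d) * (of_real c * w + of_real d))"
  unfolding lft_def using lft_denom_nz[OF assms(1,2)] lft_denom_nz[OF assms(1,3)]
  by (simp add: divide_simps) (simp add: algebra_simps)

lemma cnj_lft: "cnj (lft a b c d z) = lft a b c d (cnj z)"
  by (simp add: lft_def)

lemma Im_mob:
  assumes "a * d - b * c \<noteq> 0" "z \<in> uhp"
  shows "Im (mob a b c d z) = \<bar>a * d - b * c\<bar> * Im z / (cmod (of_real c * z + of_real d))\<^sup>2"
proof -
  have e: "cmod (of_real c * cnj z + of_real d) = cmod (of_real c * z + of_real d)"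
    by (metis complex_cnj_add complex_cnj_complex_of_real complex_cnj_mult complex_mod_cnj)
  show ?thesis
    using assms Im_lft[of a d b c z] Im_lft[of a d b c "cnj z"]
    by (auto simp: mob_def uhp_def abs_if e left_diff_distrib diff_divide_distrib)
qed

lemma mob_in_uhp:
  assumes "a * d - b * c \<noteq> 0" "z \<in> uhp"
  shows "mob a b c d z \<in> uhp"
  using assms lft_denom_nz[OF assms(1), of z] by (simp add: uhp_def Im_mob)

lemma cmod_mob_diff:
  assumes "a * d - b * c \<noteq> 0" "z \<in> uhp" "w \<in> uhp"
  shows "cmod (mob a b c d z - mob a b c d w) =
    \<bar>a * d - b * c\<bar> * cmod (z - w) / (cmod (of_real c * z + of_real d) * cmod (of_real c * w + of_real d))"
proof (cases "a * d - b * c > 0")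
  case True
  then have "cmod (lft a b c d z - lft a b c d w) = 
    \<bar>a * d - b * c\<bar> * cmod (z - w) / (cmod (of_real c * z + of_real d) * cmod (of_real c * w + of_real d))"
    using assms by (subst lft_diff) (auto simp: uhp_def norm_mult norm_divide simp del: of_real_diff of_real_mult)
  then show ?thesis using True by (simp add: mob_def)
next
  case False
  have "cmod (mob a b c d z - mob a b c d w) = cmod (cnj (lft a b c d z - lft a b c d w))"
    using False by (simp add: mob_def cnj_lft)
  also have "\<dots> = \<bar>a * d - b * c\<bar> * cmod (z - w) / (cmod (of_real c * z + of_real d) * cmod (of_real c * w + of_real d))"
    unfolding complex_mod_cnj using assms 
    by (subst lft_diff) (auto simp: uhp_def norm_mult norm_divide simp del: of_real_diff of_real_mult)
  finally show ?thesis .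
qed

lemma isom_in_uhp: "isom m \<Longrightarrow> z \<in> uhp \<Longrightarrow> m z \<in> uhp"
  unfolding isom_def using mob_in_uhp by force

lemma isom_udist:
  assumes "isom m" "z \<in> uhp" "w \<in> uhp"
  shows "udist (m z) (m w) = udist z w"
proof -
  obtain a b c d where D: "a * d - b * c \<noteq> 0" "\<And>z. z \<in> uhp \<Longrightarrow> m z = mob a b c d z"
    using assms(1) unfolding isom_def by blast
  have n: "cmod (of_real c * z + of_real d) \<noteq> 0" "cmod (of_real c * w + of_real d) \<noteq> 0"
    using lft_denom_nz[OF D(1)] assms by (auto simp: uhp_def)
  show ?thesis
    using D assms n
    apply (subst udist_eq_iff)
        apply (simp_all add: mob_in_uhp Im_mob cmod_mob_diff)
    apply (simp add: field_simps power2_eq_square)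
    done
qed

lemma lft_comp:
  assumes "a' * d' - b' * c' \<noteq> 0" "Im z \<noteq> 0"
  shows "lft a b c d (lft a' b' c' d' z) =
    lft (a*a'+b*c') (a*b'+b*d') (c*a'+d*c') (c*b'+d*d') z"
proof -
  define q where "q = of_real c' * z + (of_real d' :: complex)"
  define p where "p = of_real a' * z + (of_real b' :: complex)"
  have q: "q \<noteq> 0" using lft_denom_nz[OF assms] by (simp add: q_def)
  have "lft a b c d (p / q) = (of_real a * p + of_real b * q) / (of_real c * p + of_real d * q)"
    unfolding lft_def using q by (simp add: add_divide_eq_iff divide_add_eq_iff)
  then show ?thesis unfolding lft_def p_def q_def by (simp add: algebra_simps)
qed

lemma isom_comp:
  assumes "isom m" "isom m'"
  shows "isom (m \<circ> m')"
proof -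
  obtain a b c d where D: "a * d - b * c \<noteq> 0" "\<And>z. z \<in> uhp \<Longrightarrow> m z = mob a b c d z"
    using assms(1) unfolding isom_def by blast
  obtain a' b' c' d' where D': "a' * d' - b' * c' \<noteq> 0" "\<And>z. z \<in> uhp \<Longrightarrow> m' z = mob a' b' c' d' z"
    using assms(2) unfolding isom_def by blast
  have det: "(a*a'+b*c') * (c*b'+d*d') - (a*b'+b*d') * (c*a'+d*c') = (a * d - b * c) * (a' * d' - b' * c')"
    by (simp add: algebra_simps)
  have "m (m' z) = mob (a*a'+b*c') (a*b'+b*d') (c*a'+d*c') (c*b'+d*d') z" if z: "z \<in> uhp" for z
  proof -
    have "m (m' z) = mob a b c d (mob a' b' c' d' z)"
      using D D' z mob_in_uhp[OF D'(1) z] by simp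
    also have "\<dots> = mob (a*a'+b*c') (a*b'+b*d') (c*a'+d*c') (c*b'+d*d') z"
      unfolding mob_def det using D(1) D'(1) z lft_comp[OF D'(1), of z a b c d] lft_comp[OF D'(1), of "cnj z" a b c d]
      by (auto simp: cnj_lft zero_less_mult_iff uhp_def)
    finally show ?thesis .
  qed
  then show ?thesis unfolding isom_def using det D D'
    by (intro exI[of _ "a*a'+b*c'"] exI[of _ "a*b'+b*d'"] exI[of _ "c*a'+d*c'"] exI[of _ "c*b'+d*d'"]) auto
qed

lemma isom_id: "isom (\<lambda>z. z)"
  unfolding isom_def by (intro exI[of _ 1] exI[of _ 0]) (auto simp: mob_def lft_def)

lemma isom_inverse:
  assumes "isom m"
  shows "\<exists>m'. isom m' \<and> (\<forall>z\<in>uhp. m' (m z) = z \<and> m (m' z) = z)"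
proof -
  obtain a b c d where D: "a * d - b * c \<noteq> 0" "\<And>z. z \<in> uhp \<Longrightarrow> m z = mob a b c d z"
    using assms(1) unfolding isom_def by blast
  have D': "d * a - (-b) * (-c) \<noteq> 0" using D(1) by (simp add: algebra_simps)
  have s: "(d * a - (-b) * (-c) > 0) = (a * d - b * c > 0)" by (simp add: algebra_simps)
  have key: "lft d (-b) (-c) a (lft a b c d z) = z" "lft a b c d (lft d (-b) (-c) a z) = z" if "Im z \<noteq> 0" for z
  proof -
    have 1: "lft t 0 0 t z = z" if "t \<noteq> 0" for t using that by (simp add: lft_def)
    show "lft d (-b) (-c) a (lft a b c d z) = z"
      using lft_comp[OF D(1) that, of d "-b" "-c" a] 1[of "a*d-b*c"] D(1) by (simp add: algebra_simps)
    show "lft a b c d (lft d (-b) (-c) a z) = z"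
      using lft_comp[OF D' that, of a b c d] 1[of "a*d-b*c"] D(1) by (simp add: algebra_simps)
  qed
  have k1: "mob d (-b) (-c) a (mob a b c d z) = z" "mob a b c d (mob d (-b) (-c) a z) = z" if "z \<in> uhp" for z
    unfolding mob_def s using key[of z] that by (auto simp: cnj_lft uhp_def)
  have "isom (mob d (-b) (-c) a)" unfolding isom_def using D' by blast
  then show ?thesis
    using k1 D mob_in_uhp[OF D'] by (intro exI[of _ "mob d (-b) (-c) a"]) simp
qed

lemma isom_affine: "k > 0 \<Longrightarrow> isom (\<lambda>z. of_real k * z + of_real r)"
  unfolding isom_def
  by (intro exI[of _ k] exI[of _ r] exI[of _ 0] exI[of _ 1]) (auto simp: mob_def lft_def)

lemma isom_reflect: "isom (\<lambda>z. of_real r - cnj z)"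
  unfolding isom_def
  by (intro exI[of _ "-1"] exI[of _ r] exI[of _ 0] exI[of _ 1]) (auto simp: mob_def lft_def)

lemma continuous_on_isom:
  assumes "isom m"
  shows "continuous_on uhp m"
proof -
  obtain a b c d where D: "a * d - b * c \<noteq> 0" "\<And>z. z \<in> uhp \<Longrightarrow> m z = mob a b c d z"
    using assms(1) unfolding isom_def by blast
  have "continuous_on uhp (\<lambda>z. mob a b c d z)"
    unfolding mob_def lft_def
    using lft_denom_nz[OF D(1)] by (cases "a * d - b * c > 0") (auto intro!: continuous_intros simp: uhp_def)
  then show ?thesis using D(2) by (simp cong: continuous_on_cong)
qed

lemma isom_inj: "isom m \<Longrightarrow> z \<in> uhp \<Longrightarrow> w \<in> uhp \<Longrightarrow> m z = m w \<Longrightarrow> z = w"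
  by (metis isom_inverse)

lemma isom_of_mob: "a * d - b * c \<noteq> 0 \<Longrightarrow> isom (mob a b c d)"
  unfolding isom_def by blast

lemma isom_inversion: "isom (\<lambda>z. - 1 / z)"
  unfolding isom_def
  by (intro exI[of _ 0] exI[of _ "-1"] exI[of _ 1] exI[of _ 0]) (auto simp: mob_def lft_def)

text \<open>Two hyperbolic circles centred on the imaginary axis meet only in a point and its mirror
  image: subtracting their equations gives equal heights, and then the moduli agree.\<close>

lemma udist_sphere_fixed_points:
  assumes z: "z \<in> uhp" and w: "w \<in> uhp" and h: "h > 0" "h \<noteq> 1"
    and 1: "udist w \<i> = udist z \<i>" and 2: "udist w (of_real h * \<i>) = udist z (of_real h * \<i>)"
  shows "w = z \<or> w = - cnj z"
proof -
  have i: "\<i> \<in> uhp" "of_real h * \<i> \<in> uhp" using h by (auto simp: uhp_def)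
  have p: "Im z > 0" "Im w > 0" using z w by (auto simp: uhp_def)
  define Z W where "Z = (Re z)\<^sup>2 + (Im z)\<^sup>2" and "W = (Re w)\<^sup>2 + (Im w)\<^sup>2"
  have e1: "(W + 1) * Im z = (Z + 1) * Im w"
    using 1 w z i by (simp add: udist_eq_iff cmod_diff_sq) (simp add: Z_def W_def power2_eq_square algebra_simps)
  have "h * ((W + h\<^sup>2) * Im z) = h * ((Z + h\<^sup>2) * Im w)"
    using 2 w z i by (simp add: udist_eq_iff cmod_diff_sq) (simp add: Z_def W_def power2_eq_square algebra_simps)
  then have e2: "(W + h\<^sup>2) * Im z = (Z + h\<^sup>2) * Im w" using h by simp
  have "(h\<^sup>2 - 1) * (Im z - Im w) = 0" using e1 e2 by (simp add: algebra_simps)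
  moreover have "h\<^sup>2 - 1 \<noteq> 0" using h by (simp add: power2_eq_1_iff)
  ultimately have I: "Im z = Im w" by simp
  then have "W = Z" using e1 p by simp
  then have "(Re z)\<^sup>2 = (Re w)\<^sup>2" using I by (simp add: W_def Z_def)
  then have "Re w = Re z \<or> Re w = - Re z" by (auto simp: power2_eq_iff)
  then show ?thesis using I by (auto simp: complex_eq_iff)
qed

text \<open>A rotation about \<i> brings q onto the imaginary axis. There the only points at the
  given distance from \<i> are h \<i> and \<i> / h, which the inversion - 1 / z exchanges.\<close>

lemma isom_moving_to_axis:
  assumes q: "q \<in> uhp" and h: "h > 0" and d: "udist \<i> q = udist \<i> (of_real h * \<i>)"
  obtains m where "isom m" "m \<i> = \<i>" "m q = of_real h * \<i>"
proof -
  have i: "\<i> \<in> uhp" "of_real h * \<i> \<in> uhp" using h by (auto simp: uhp_def)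
  have axis: "\<exists>m. isom m \<and> m \<i> = \<i> \<and> m q = of_real h * \<i>" 
    if q: "q \<in> uhp" and d: "udist \<i> q = udist \<i> (of_real h * \<i>)" and R: "Re q = 0" for q
  proof -
    define v where "v = Im q"
    have v: "v > 0" "q = of_real v * \<i>" using q R by (auto simp: v_def uhp_def complex_eq_iff)
    have "(1 - v)\<^sup>2 * h = (1 - h)\<^sup>2 * v"
      using d i q v h by (simp add: udist_eq_iff cmod_diff_sq)
    then have "(v - h) * (v * h - 1) = 0" by (simp add: algebra_simps power2_eq_square)
    then have "v = h \<or> v * h = 1" by auto
    then consider "v = h" | "v = 1 / h" using h by (auto simp: field_simps)
    then show ?thesis
    proof cases
      case 1
      then show ?thesis using v isom_id by auto
    next
      case 2
      have "- 1 / q = of_real h * \<i>" 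
      proof -
        have "v * h = 1" using 2 h by simp
        then have "(of_real h * \<i>) * q = - 1"
          unfolding v by (metis (no_types, lifting) i_squared mult.assoc mult.commute mult_minus_right mult.right_neutral of_real_1 of_real_mult)
        moreover have "q \<noteq> 0" using v by auto
        ultimately show ?thesis by (metis nonzero_mult_div_cancel_right)
      qed
      then show ?thesis using isom_inversion by (intro exI[of _ "\<lambda>z. - 1 / z"]) (auto simp: field_simps)
    qed
  qed
  show ?thesis
  proof (cases "Re q = 0")
    case True
    then show ?thesis using axis[OF q d True] that by blast
  next
    case False
    \<comment> \<open>The maps \<open>mob 1 (- e) e 1\<close> are rotations about \<i>. The image of
      q has real part 0 when e^2 = k e + 1, and \<open>e\<close> is a root of this equation.\<close>
    define k where "k = ((Re q)\<^sup>2 + (Im q)\<^sup>2 - 1) / Re q"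
    define e where "e = (k + sqrt (k\<^sup>2 + 4)) / 2"
    have "e * e = k * e + 1"
    proof -
      have "sqrt (k\<^sup>2 + 4) * sqrt (k\<^sup>2 + 4) = k\<^sup>2 + 4" by simp
      then show ?thesis unfolding e_def by (simp add: field_simps power2_eq_square)
    qed
    then have "Re q * (e * e) = ((Re q)\<^sup>2 + (Im q)\<^sup>2 - 1) * e + Re q"
      using False by (simp add: k_def field_simps)
    then have R: "e * ((Re q)\<^sup>2 + (Im q)\<^sup>2) + (1 - e\<^sup>2) * Re q - e = 0"
      by (simp add: algebra_simps power2_eq_square)
    have det: "1 * 1 - (- e) * e > 0" by (simp add: add_pos_nonneg)
    let ?m = "mob 1 (- e) e 1"
    have m: "isom ?m" using det by (intro isom_of_mob) auto
    have meq: "?m z = (z - of_real e) / (of_real e * z + 1)" for z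
      using det by (simp add: mob_def lft_def)
    have mi: "?m \<i> = \<i>"
    proof -
      have "of_real e * \<i> + 1 \<noteq> 0" by (simp add: complex_eq_iff)
      then show ?thesis unfolding meq by (simp add: field_simps)
    qed
    have "Re (?m q) = 0"
      unfolding meq Re_divide using R by (simp add: algebra_simps power2_eq_square)
    moreover have "udist \<i> (?m q) = udist \<i> (of_real h * \<i>)"
      using isom_udist[OF m i(1) q] mi d by simp
    ultimately obtain m' where "isom m'" "m' \<i> = \<i>" "m' (?m q) = of_real h * \<i>"
      using axis[of "?m q"] isom_in_uhp[OF m q] by blast
    then show ?thesis using that[of "m' \<circ> ?m"] isom_comp[OF _ m] mi by auto
  qed
qed

text \<open>Rigidity: once x and a point y above it have been normalised on both sides to points of
  the imaginary axis, distances to these two determine every image up to reflection in the axis. A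
  further point v off the axis shows that the same alternative holds everywhere.\<close>

lemma isometric_on_open_is_isom:
  assumes S: "open S" "S \<subseteq> uhp" "x \<in> S" and f: "f ` S \<subseteq> uhp"
    and iso: "\<And>z w. z \<in> S \<Longrightarrow> w \<in> S \<Longrightarrow> udist (f z) (f w) = udist z w"
  shows "\<exists>m. isom m \<and> (\<forall>z\<in>S. f z = m z)"
proof -
  define P where "P z m m' \<longleftrightarrow> isom m \<and> isom m' \<and> m \<i> = z \<and> m' z = \<i> \<and> (\<forall>w. m (m' w) = w) \<and> (\<forall>w. m' (m w) = w)
        \<and> (\<forall>w. Re w = 0 \<longrightarrow> Re (m w) = Re z) \<and> (\<forall>w. Re w = Re z \<longrightarrow> Re (m' w) = 0)" for z m m'
  have affine: "\<exists>m m'. P z m m'" if "z \<in> uhp" for z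
  proof -
    have p: "Im z > 0" using that by (simp add: uhp_def)
    let ?m = "\<lambda>w::complex. of_real (Im z) * w + of_real (Re z)"
    let ?m' = "\<lambda>w::complex. of_real (1 / Im z) * w + of_real (- Re z / Im z)"
    have A: "isom ?m" "isom ?m'" using p by (intro isom_affine; simp)+
    have B: "?m \<i> = z" "?m' z = \<i>" using p by (auto simp: complex_eq_iff field_simps)
    have C: "?m (?m' w) = w" "?m' (?m w) = w" for w using p by (simp_all add: complex_eq_iff, simp_all add: field_simps)
    have D: "Re w = 0 \<Longrightarrow> Re (?m w) = Re z" "Re w = Re z \<Longrightarrow> Re (?m' w) = 0" for w using p by auto
    show ?thesis unfolding P_def
      by (intro exI[of _ ?m] exI[of _ ?m'] conjI allI impI) (fact A B C | erule D)+
  qed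
  obtain a a' where "P x a a'" using affine[of x] S by blast
  then have a: "isom a" "isom a'" "a \<i> = x" "a' x = \<i>" "\<And>w. a (a' w) = w" "\<And>w. a' (a w) = w"
    "\<And>w. Re w = 0 \<Longrightarrow> Re (a w) = Re x" "\<And>w. Re w = Re x \<Longrightarrow> Re (a' w) = 0"
    unfolding P_def by simp_all
  obtain b b' where "P (f x) b b'" using affine[of "f x"] S f by blast
  then have b: "isom b" "isom b'" "b \<i> = f x" "b' (f x) = \<i>" "\<And>w. b (b' w) = w" "\<And>w. b' (b w) = w"
    unfolding P_def by simp_all
  obtain \<epsilon> where \<epsilon>: "\<epsilon> > 0" "ball x \<epsilon> \<subseteq> S" using S openE by blast
  define y where "y = x + of_real (\<epsilon> / 2) * \<i>"
  define v where "v = x + of_real (\<epsilon> / 2)"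
  have yS: "y \<in> S" and vS: "v \<in> S" using \<epsilon> by (auto simp: y_def v_def dist_norm norm_mult intro!: subsetD[OF \<epsilon>(2)])
  have inS: "z \<in> uhp" "f z \<in> uhp" if "z \<in> S" for z using that S f by auto
  have iu: "\<i> \<in> uhp" by (simp add: uhp_def)
  define h where "h = Im (a' y)"
  have h: "h > 0" using isom_in_uhp[OF a(2), of y] yS S by (auto simp: h_def uhp_def)
  have ay: "a' y = of_real h * \<i>" using a(8)[of y] by (simp add: complex_eq_iff h_def y_def)
  have h1: "h \<noteq> 1"
  proof
    assume "h = 1"
    then have "a (a' y) = a \<i>" using ay by simp
    then show False using a \<epsilon> by (simp add: y_def)
  qed
  let ?g = "\<lambda>z. b' (f (a z))"
  have "udist \<i> (b' (f y)) = udist (b' (f x)) (b' (f y))" using b by simp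
  also have "\<dots> = udist x y" using isom_udist[OF b(2)] inS S yS iso by simp
  also have "\<dots> = udist (a' x) (a' y)" using isom_udist[OF a(2)] inS S yS by simp
  also have "\<dots> = udist \<i> (of_real h * \<i>)" using a ay by simp
  finally have dist_y: "udist \<i> (b' (f y)) = udist \<i> (of_real h * \<i>)" .
  have bu: "b' (f z) \<in> uhp" if "z \<in> S" for z using isom_in_uhp[OF b(2) inS(2)[OF that]] .
  obtain m where m: "isom m" "m \<i> = \<i>" "m (b' (f y)) = of_real h * \<i>"
    by (rule isom_moving_to_axis[OF bu[OF yS] h dist_y])
  define F where "F = (\<lambda>z. m (b' (f z)))"
  have Fu: "F z \<in> uhp" if "z \<in> S" for z
    unfolding F_def using isom_in_uhp[OF m(1) bu[OF that]] .
  have Fd: "udist (F z) (F w) = udist (a' z) (a' w)" if "z \<in> S" "w \<in> S" for z w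
    unfolding F_def isom_udist[OF m(1) bu[OF that(1)] bu[OF that(2)]] isom_udist[OF b(2) inS(2)[OF that(1)] inS(2)[OF that(2)]]
      isom_udist[OF a(2) inS(1)[OF that(1)] inS(1)[OF that(2)]] by (rule iso[OF that])
  have Fx: "F x = \<i>" "F y = of_real h * \<i>" using m b by (auto simp: F_def)
  have alt: "F z = a' z \<or> F z = - cnj (a' z)" if "z \<in> S" for z
    by (rule udist_sphere_fixed_points[OF isom_in_uhp[OF a(2) inS(1)[OF that]] Fu[OF that] h h1])
       (use Fd[OF that S(3)] Fd[OF that yS] Fx a(4) ay in simp_all)
  have av: "Re (a' v) \<noteq> 0"
  proof
    assume "Re (a' v) = 0"
    then have "Re (a (a' v)) = Re x" by (rule a(7))
    then show False using a \<epsilon> by (simp add: v_def)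
  qed
  \<comment> \<open>If z took the other alternative than v, then \<open>a' z\<close> and its mirror
    image would be equally far from \<open>a' v\<close>. So \<open>a' z\<close> would lie on the
    axis, where the alternatives coincide.\<close>
  have third: "F z = n (a' z)" if "F v = n (a' v)" "n = (\<lambda>w. w) \<or> n = (\<lambda>w. - cnj w)" "z \<in> S" for z n
  proof (rule ccontr)
    assume ne: "F z \<noteq> n (a' z)"
    have n: "isom n" using that(2) isom_id isom_reflect[of 0] by (elim disjE) simp_all
    have nn: "n (n w) = w" for w using that(2) by auto
    have Fz: "F z = n (- cnj (a' z))" using alt[OF that(3)] ne that(2) by auto
    have au: "a' z \<in> uhp" "a' v \<in> uhp" "- cnj (a' z) \<in> uhp" using isom_in_uhp[OF a(2)] inS that vS by (auto simp: uhp_def)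
    have "udist (a' z) (a' v) = udist (n (- cnj (a' z))) (n (a' v))" using Fd[OF that(3) vS] Fz that(1) by simp
    also have "\<dots> = udist (- cnj (a' z)) (a' v)" using isom_udist[OF n] au by simp
    finally have "(cmod (a' z - a' v))\<^sup>2 = (cmod (- cnj (a' z) - a' v))\<^sup>2"
      using au by (simp add: udist_eq_iff) (simp add: uhp_def)
    then have "(Re (a' z) - Re (a' v))\<^sup>2 = (- Re (a' z) - Re (a' v))\<^sup>2" by (simp add: cmod_diff_sq)
    then have "Re (a' z) * Re (a' v) = 0" by (simp add: power2_eq_square algebra_simps)
    then have "Re (a' z) = 0" using av by simp
    then have "- cnj (a' z) = a' z" by (simp add: complex_eq_iff)
    then show False using ne Fz by simp
  qed
  have r0: "isom (\<lambda>w. - cnj w)" using isom_reflect[of 0] by simp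
  obtain n where n: "isom n" "\<And>z. z \<in> S \<Longrightarrow> F z = n (a' z)"
    using alt[OF vS]
  proof
    assume e: "F v = a' v"
    show ?thesis
      by (rule that[OF isom_id]) (rule third[where n = "\<lambda>w. w", OF e disjI1[OF refl]])
  next
    assume e: "F v = - cnj (a' v)"
    show ?thesis
      by (rule that[OF r0]) (rule third[where n = "\<lambda>w. - cnj w", OF e disjI2[OF refl]])
  qed
  obtain m' where m': "isom m'" "\<forall>z\<in>uhp. m' (m z) = z \<and> m (m' z) = z"
    using isom_inverse[OF m(1)] by blast
  show ?thesis
  proof (intro exI conjI ballI)
    show "isom (b \<circ> (m' \<circ> (n \<circ> a')))" by (intro isom_comp a b m' n)
    fix z assume z: "z \<in> S"
    have "m' (F z) = b' (f z)" using m' isom_in_uhp[OF b(2)] inS z by (simp add: F_def)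
    then show "f z = (b \<circ> (m' \<circ> (n \<circ> a'))) z" using n(2)[OF z] b by simp
  qed
qed

text \<open>The distances to x and to x + e, x - e suffice. Along this horizontal line the second
  difference of |v - z|^2 does not depend on v, which gives the height of \<open>m w\<close>; the
  first difference then gives its real part.\<close>

lemma isom_fixing_open_set:
  assumes m: "isom m" and S: "open S" "S \<subseteq> uhp" "x \<in> S" and fp: "\<And>z. z \<in> S \<Longrightarrow> m z = z"
    and w: "w \<in> uhp"
  shows "m w = w"
proof -
  define v where "v = m w"
  have v: "v \<in> uhp" using isom_in_uhp[OF m w] by (simp add: v_def)
  have eq: "(cmod (v - z))\<^sup>2 * Im w = (cmod (w - z))\<^sup>2 * Im v" if "z \<in> S" for z
  proof -
    have z: "z \<in> uhp" using that S by auto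
    have "udist v z = udist w z" using isom_udist[OF m w z] fp[OF that] by (simp add: v_def)
    then have "Im z * ((cmod (v - z))\<^sup>2 * Im w) = Im z * ((cmod (w - z))\<^sup>2 * Im v)"
      using udist_eq_iff[OF v z w z] by (simp add: mult_ac)
    then show ?thesis using z by (simp add: uhp_def)
  qed
  obtain \<epsilon> where \<epsilon>: "\<epsilon> > 0" "ball x \<epsilon> \<subseteq> S" using S openE by blast
  define e where "e = \<epsilon> / 2"
  have e: "e > 0" using \<epsilon> by (simp add: e_def)
  have "x + of_real e \<in> S" "x - of_real e \<in> S"
    using \<epsilon> by (auto simp: e_def dist_norm intro!: subsetD[OF \<epsilon>(2)])
  note E = eq[OF this(1)] eq[OF this(2)] eq[OF S(3)]
  have 1: "((Re v - (Re x + e))\<^sup>2 + (Im v - Im x)\<^sup>2) * Im w = ((Re w - (Re x + e))\<^sup>2 + (Im w - Im x)\<^sup>2) * Im v"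
    "((Re v - (Re x - e))\<^sup>2 + (Im v - Im x)\<^sup>2) * Im w = ((Re w - (Re x - e))\<^sup>2 + (Im w - Im x)\<^sup>2) * Im v"
    "((Re v - Re x)\<^sup>2 + (Im v - Im x)\<^sup>2) * Im w = ((Re w - Re x)\<^sup>2 + (Im w - Im x)\<^sup>2) * Im v"
    using E unfolding cmod_diff_sq by simp_all
  define p q r k where "p = Re v - Re x" and "q = Re w - Re x" and "r = (Im v - Im x)\<^sup>2" and "k = (Im w - Im x)\<^sup>2"
  have 2: "((p - e)\<^sup>2 + r) * Im w = ((q - e)\<^sup>2 + k) * Im v" "((p + e)\<^sup>2 + r) * Im w = ((q + e)\<^sup>2 + k) * Im v"
    "(p\<^sup>2 + r) * Im w = (q\<^sup>2 + k) * Im v"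
    using 1 unfolding p_def q_def r_def k_def diff_diff_eq diff_diff_eq2 by (simp_all add: diff_add_eq)
  have "2 * (e * e) * Im w - 2 * (e * e) * Im v = (((p - e)\<^sup>2 + r) * Im w - ((q - e)\<^sup>2 + k) * Im v) +
    (((p + e)\<^sup>2 + r) * Im w - ((q + e)\<^sup>2 + k) * Im v) - 2 * ((p\<^sup>2 + r) * Im w - (q\<^sup>2 + k) * Im v)"
    by (simp add: power2_eq_square algebra_simps)
  then have "2 * (e * e) * Im w = 2 * (e * e) * Im v" using 2 by simp
  then have I: "Im v = Im w" using e by simp
  have "4 * (e * (p - q) * Im w) = (((p + e)\<^sup>2 + r) * Im w - ((q + e)\<^sup>2 + k) * Im w) -
    (((p - e)\<^sup>2 + r) * Im w - ((q - e)\<^sup>2 + k) * Im w)"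
    by (simp add: power2_eq_square algebra_simps)
  then have "4 * (e * (p - q) * Im w) = 0" using 2 I by simp
  then have "p = q" using e w by (simp add: uhp_def)
  then have "Re v = Re w" by (simp add: p_def q_def)
  with I show ?thesis by (simp add: v_def complex_eq_iff)
qed

subsection \<open>Local isometries and charts\<close>

text \<open>Local isometries on subsets of the half-plane; the neighbourhoods are Euclidean discs.\<close>

definition liso :: "'f::metric_space set \<Rightarrow> complex set \<Rightarrow> (complex \<Rightarrow> 'f) \<Rightarrow> bool" where
  "liso F U f \<longleftrightarrow> f ` U \<subseteq> F \<and>
    (\<forall>x\<in>U. \<exists>e>0. \<forall>y\<in>U \<inter> ball x e. \<forall>z\<in>U \<inter> ball x e. dist (f y) (f z) = udist y z)"

lemma lisoD:
  assumes "liso F U f" "x \<in> U"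
  shows "\<exists>e>0. \<forall>y\<in>U \<inter> ball x e. \<forall>z\<in>U \<inter> ball x e. dist (f y) (f z) = udist y z"
  using assms unfolding liso_def by simp

lemma liso_ball:
  assumes "liso F U f" "x \<in> U" "open U"
  shows "\<exists>e>0. ball x e \<subseteq> U \<and> (\<forall>y\<in>ball x e. \<forall>z\<in>ball x e. dist (f y) (f z) = udist y z)"
proof -
  obtain e1 where e1: "e1 > 0" "\<forall>y\<in>U \<inter> ball x e1. \<forall>z\<in>U \<inter> ball x e1. dist (f y) (f z) = udist y z"
    using lisoD[OF assms(1,2)] by blast
  obtain e2 where e2: "e2 > 0" "ball x e2 \<subseteq> U" using assms openE by blast
  have sub: "ball x (min e1 e2) \<subseteq> U \<inter> ball x e1" using e2 by auto
  show ?thesis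
  proof (intro exI[of _ "min e1 e2"] conjI ballI)
    show "dist (f y) (f z) = udist y z" if "y \<in> ball x (min e1 e2)" "z \<in> ball x (min e1 e2)" for y z
      using e1(2) subsetD[OF sub that(1)] subsetD[OF sub that(2)] by simp
  qed (use sub e1 e2 in auto)
qed

lemma liso_in: "liso F U f \<Longrightarrow> x \<in> U \<Longrightarrow> f x \<in> F"
  unfolding liso_def by blast

lemma liso_subset:
  assumes f: "liso F U f" and V: "V \<subseteq> U" and fg: "\<And>z. z \<in> V \<Longrightarrow> g z = f z"
  shows "liso F V g"
  unfolding liso_def
proof (intro conjI ballI)
  show "g ` V \<subseteq> F" using f V fg unfolding liso_def by auto
  fix x assume x: "x \<in> V"
  obtain e where e: "e > 0" "\<forall>y\<in>U \<inter> ball x e. \<forall>z\<in>U \<inter> ball x e. dist (f y) (f z) = udist y z"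
    using lisoD[OF f subsetD[OF V x]] by blast
  have sub: "V \<inter> ball x e \<subseteq> U \<inter> ball x e" using V by blast
  have "dist (g y) (g z) = udist y z" if "y \<in> V \<inter> ball x e" "z \<in> V \<inter> ball x e" for y z
    using e(2) subsetD[OF sub that(1)] subsetD[OF sub that(2)] fg[of y] fg[of z] that by simp
  then show "\<exists>e>0. \<forall>y\<in>V \<inter> ball x e. \<forall>z\<in>V \<inter> ball x e. dist (g y) (g z) = udist y z"
    by (intro exI[of _ e] conjI ballI e(1))
qed

lemma liso_locally:
  assumes "\<And>x. x \<in> U \<Longrightarrow> \<exists>V. open V \<and> x \<in> V \<and> liso F (U \<inter> V) f"
  shows "liso F U f"
  unfolding liso_def
proof (intro conjI ballI)
  show "f ` U \<subseteq> F" using assms unfolding liso_def by blast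
  fix x assume x: "x \<in> U"
  obtain V where V: "open V" "x \<in> V" "liso F (U \<inter> V) f" using assms[OF x] by blast
  obtain e1 where e1: "e1 > 0" "\<forall>y\<in>(U \<inter> V) \<inter> ball x e1. \<forall>z\<in>(U \<inter> V) \<inter> ball x e1. dist (f y) (f z) = udist y z"
    using lisoD[OF V(3) IntI[OF x V(2)]] by blast
  obtain e2 where e2: "e2 > 0" "ball x e2 \<subseteq> V" using V openE by blast
  have "dist (f y) (f z) = udist y z" if "y \<in> U \<inter> ball x (min e1 e2)" "z \<in> U \<inter> ball x (min e1 e2)" for y z
  proof -
    have "U \<inter> ball x (min e1 e2) \<subseteq> (U \<inter> V) \<inter> ball x e1" using e2 by auto
    then show ?thesis using e1(2) that by (simp add: subset_iff)
  qed
  then show "\<exists>e>0. \<forall>y\<in>U \<inter> ball x e. \<forall>z\<in>U \<inter> ball x e. dist (f y) (f z) = udist y z"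
    using e1(1) e2(1) by (intro exI[of _ "min e1 e2"] conjI ballI) simp_all
qed

lemma isom_nhd:
  assumes "isom m" "x \<in> uhp" "open V" "m x \<in> V"
  obtains e where "e > 0" "ball x e \<subseteq> uhp" "m ` ball x e \<subseteq> V"
proof -
  have "open (uhp \<inter> m -` V)"
    using continuous_open_preimage[OF continuous_on_isom[OF assms(1)] open_uhp assms(3)] .
  then obtain e where "e > 0" "ball x e \<subseteq> uhp \<inter> m -` V" using assms openE[of "uhp \<inter> m -` V" x] by blast
  then show ?thesis using that by auto
qed

lemma liso_comp:
  assumes f: "liso F U f" and m: "isom m" and V: "V \<subseteq> uhp" "m ` V \<subseteq> U" and U: "U \<subseteq> uhp"
  shows "liso F V (\<lambda>z. f (m z))"
  unfolding liso_def
proof (intro conjI ballI)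
  show "(\<lambda>z. f (m z)) ` V \<subseteq> F" using f V unfolding liso_def by blast
  fix x assume x: "x \<in> V"
  have mx: "m x \<in> U" using V x by blast
  obtain e where e: "e > 0" "\<forall>y\<in>U \<inter> ball (m x) e. \<forall>z\<in>U \<inter> ball (m x) e. dist (f y) (f z) = udist y z"
    using lisoD[OF f mx] by blast
  obtain d where d: "d > 0" "ball x d \<subseteq> uhp" "m ` ball x d \<subseteq> ball (m x) e"
    using isom_nhd[OF m, of x "ball (m x) e"] x V e by auto
  have "dist (f (m y)) (f (m z)) = udist y z" if "y \<in> V \<inter> ball x d" "z \<in> V \<inter> ball x d" for y z
  proof -
    have "m y \<in> U \<inter> ball (m x) e" "m z \<in> U \<inter> ball (m x) e" using that d V by blast+
    moreover have "y \<in> uhp" "z \<in> uhp" using that V by auto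
    ultimately show ?thesis using e(2) isom_udist[OF m, of y z] by simp
  qed
  then show "\<exists>e>0. \<forall>y\<in>V \<inter> ball x e. \<forall>z\<in>V \<inter> ball x e. dist (f (m y)) (f (m z)) = udist y z"
    by (intro exI[of _ d] conjI ballI d(1))
qed

lemma liso_continuous:
  assumes f: "liso F U f" and U: "U \<subseteq> uhp"
  shows "continuous_on U f"
  unfolding continuous_on_iff
proof (intro ballI allI impI)
  fix \<epsilon> :: "real" and a assume x: "a \<in> U" and \<epsilon>: "\<epsilon> > 0"
  obtain e where e: "e > 0" "\<forall>y\<in>U \<inter> ball a e. \<forall>z\<in>U \<inter> ball a e. dist (f y) (f z) = udist y z"
    using lisoD[OF f x] by blast
  obtain d where d: "d > 0" "ball a d \<subseteq> uhp" "\<And>z w. z \<in> ball a d \<Longrightarrow> w \<in> ball a d \<Longrightarrow> udist z w < \<epsilon>"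
    using udist_small_nhd[of a \<epsilon>] x U \<epsilon> by blast
  have "dist (f z) (f a) < \<epsilon>" if "z \<in> U" "dist z a < min d e" for z
  proof -
    have "dist (f z) (f a) = udist z a" using e that x by (auto simp: dist_commute udist_commute)
    also have "\<dots> < \<epsilon>" by (rule d(3)) (use that d in \<open>auto simp: dist_commute\<close>)
    finally show ?thesis .
  qed
  then show "\<exists>d>0. \<forall>x'\<in>U. dist x' a < d \<longrightarrow> dist (f x') (f a) < \<epsilon>"
    using d(1) e(1) by (intro exI[of _ "min d e"]) auto
qed

lemma liso_inj_nhd:
  assumes f: "liso F U f" and U: "open U" "U \<subseteq> uhp" "x \<in> U"
  obtains e where "e > 0" "ball x e \<subseteq> U" "inj_on f (ball x e)"
proof -
  obtain e where e: "e > 0" "ball x e \<subseteq> U"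
    "\<forall>y\<in>ball x e. \<forall>z\<in>ball x e. dist (f y) (f z) = udist y z"
    using liso_ball[OF f U(3,1)] by blast
  have "inj_on f (ball x e)"
  proof
    fix y z assume *: "y \<in> ball x e" "z \<in> ball x e" "f y = f z"
    then have "udist y z = 0" using e(3)[rule_format, of y z] by simp
    then show "y = z" using udist_eq_0_iff[of y z] * e(2) U(2) by blast
  qed
  then show ?thesis using that e by blast
qed

text \<open>Charts run from hyperbolic discs into F, against the direction used for surfaces, so
  that a local isometry becomes \<open>\<kappa> \<circ> m\<close> with m an isometry of the
  half-plane. Their images are full metric balls, so values near q can be lifted pointwise.\<close>

locale hyp_charts =
  fixes F :: "'f::metric_space set"
  assumes complete_F: "complete F"
    and chart: "q \<in> F \<Longrightarrow> \<exists>r>0. \<exists>w\<in>uhp. \<exists>\<kappa>. \<kappa> w = q \<and> \<kappa> ` {z\<in>uhp. udist w z < r} = F \<inter> ball q r \<and>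
      (\<forall>y\<in>{z\<in>uhp. udist w z < r}. \<forall>z\<in>{z\<in>uhp. udist w z < r}. dist (\<kappa> y) (\<kappa> z) = udist y z)"
begin

definition is_chart :: "'f \<Rightarrow> real \<Rightarrow> complex \<Rightarrow> (complex \<Rightarrow> 'f) \<Rightarrow> bool" where
  "is_chart q r w \<kappa> \<longleftrightarrow> q \<in> F \<and> r > 0 \<and> w \<in> uhp \<and> \<kappa> w = q \<and> \<kappa> ` {z\<in>uhp. udist w z < r} = F \<inter> ball q r \<and>
      (\<forall>y\<in>{z\<in>uhp. udist w z < r}. \<forall>z\<in>{z\<in>uhp. udist w z < r}. dist (\<kappa> y) (\<kappa> z) = udist y z)"

lemma ex_chart: 
  assumes "q \<in> F" obtains r w \<kappa> where "is_chart q r w \<kappa>"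
  using chart[OF assms] assms unfolding is_chart_def by blast

lemma chartD:
  assumes "is_chart q r w \<kappa>"
  shows "q \<in> F" "r > 0" "w \<in> uhp" "\<kappa> w = q" 
    "\<And>p. p \<in> F \<Longrightarrow> dist q p < r \<Longrightarrow> \<exists>z\<in>uhp. udist w z < r \<and> \<kappa> z = p"
    "\<And>z. z \<in> uhp \<Longrightarrow> udist w z < r \<Longrightarrow> \<kappa> z \<in> F"
    "\<And>y z. y \<in> uhp \<Longrightarrow> udist w y < r \<Longrightarrow> z \<in> uhp \<Longrightarrow> udist w z < r \<Longrightarrow> dist (\<kappa> y) (\<kappa> z) = udist y z"
proof -
  note A = assms[unfolded is_chart_def]
  show "q \<in> F" "r > 0" "w \<in> uhp" "\<kappa> w = q" using A by blast+
  have img: "\<kappa> ` {z\<in>uhp. udist w z < r} = F \<inter> ball q r" using A by blast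
  show "\<exists>z\<in>uhp. udist w z < r \<and> \<kappa> z = p" if "p \<in> F" "dist q p < r" for p
  proof -
    have "p \<in> F \<inter> ball q r" using that by simp
    then show ?thesis unfolding img[symmetric] by auto
  qed
  show "\<kappa> z \<in> F" if "z \<in> uhp" "udist w z < r" for z
  proof -
    have "\<kappa> z \<in> \<kappa> ` {z\<in>uhp. udist w z < r}" using that by auto
    then show ?thesis unfolding img by auto
  qed
  show "dist (\<kappa> y) (\<kappa> z) = udist y z" if "y \<in> uhp" "udist w y < r" "z \<in> uhp" "udist w z < r" for y z
    using A that by blast
qed

lemma chart_center: "is_chart q r w \<kappa> \<Longrightarrow> udist w w < r"
  using chartD(2,3)[of q r w \<kappa>] udist_eq_0_iff[of w w] by simp

lemma chart_inj:
  assumes "is_chart q r w \<kappa>" "y \<in> uhp" "udist w y < r" "z \<in> uhp" "udist w z < r" "\<kappa> y = \<kappa> z"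
  shows "y = z"
proof -
  have "udist y z = 0" using chartD(7)[OF assms(1-5)] assms(6) by simp
  then show ?thesis using udist_eq_0_iff assms by blast
qed

text \<open>Pointwise lifting through the chart preserves distances on a small ball, and rigidity
  makes the lift an isometry. The value f x need not be the centre q: for continuation q will be a
  limit of values of f.\<close>

lemma liso_in_chart:
  assumes f: "liso F U f" and U: "open U" "U \<subseteq> uhp" "x \<in> U" and c: "is_chart q r w \<kappa>" and near: "dist q (f x) < r"
  shows "\<exists>m e. isom m \<and> e > 0 \<and> ball x e \<subseteq> U \<and> (\<forall>z\<in>ball x e. udist w (m z) < r \<and> f z = \<kappa> (m z))"
proof -
  obtain e1 where e1: "e1 > 0" "ball x e1 \<subseteq> U"
    "\<forall>y\<in>ball x e1. \<forall>z\<in>ball x e1. dist (f y) (f z) = udist y z"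
    using liso_ball[OF f U(3,1)] by blast
  obtain e2 where e2: "e2 > 0" "ball x e2 \<subseteq> uhp" 
    "\<And>z w. z \<in> ball x e2 \<Longrightarrow> w \<in> ball x e2 \<Longrightarrow> udist z w < r - dist q (f x)"
    using udist_small_nhd[of x "r - dist q (f x)"] U near by auto
  define e where "e = min e1 e2"
  have e: "e > 0" "ball x e \<subseteq> U" "ball x e \<subseteq> uhp" using e1 e2 by (auto simp: e_def)
  have inb: "\<exists>y\<in>uhp. udist w y < r \<and> \<kappa> y = f z" if "z \<in> ball x e" for z
  proof (rule chartD(5)[OF c])
    show "f z \<in> F" using liso_in[OF f] that e by blast
    have "dist (f x) (f z) = udist x z" using e1 that by (simp add: e_def)
    also have "\<dots> < r - dist q (f x)" by (rule e2(3)) (use that e2 in \<open>auto simp: e_def\<close>)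
    finally show "dist q (f z) < r" using dist_triangle[of q "f z" "f x"] by simp
  qed
  define h where "h z = (SOME y. y \<in> uhp \<and> udist w y < r \<and> \<kappa> y = f z)" for z
  have h: "h z \<in> uhp" "udist w (h z) < r" "\<kappa> (h z) = f z" if "z \<in> ball x e" for z
    using someI_ex[of "\<lambda>y. y \<in> uhp \<and> udist w y < r \<and> \<kappa> y = f z"] inb[OF that] unfolding h_def by auto
  have hd: "udist (h y) (h z) = udist y z" if "y \<in> ball x e" "z \<in> ball x e" for y z
    using chartD(7)[OF c h(1,2)[OF that(1)] h(1,2)[OF that(2)]] h(3)[OF that(1)] h(3)[OF that(2)] e1(3) that
    by (simp add: e_def)
  have hu: "h ` ball x e \<subseteq> uhp" using h by auto
  have xb: "x \<in> ball x e" using e by simp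
  have "\<exists>m. isom m \<and> (\<forall>z\<in>ball x e. h z = m z)"
    by (rule isometric_on_open_is_isom[OF open_ball e(3) xb hu]) (rule hd)
  then obtain m where m: "isom m" "\<forall>z\<in>ball x e. h z = m z" by blast
  show ?thesis
  proof (intro exI conjI ballI)
    fix z assume "z \<in> ball x e"
    then show "udist w (m z) < r" "f z = \<kappa> (m z)" using h[of z] m(2) by simp_all
  qed (use m e in auto)
qed

text \<open>Both maps are read in one chart about the common value; m is the quotient of the two
  readings.\<close>

lemma transition:
  assumes f: "liso F U f" and U: "open U" "U \<subseteq> uhp" "x \<in> U"
    and f': "liso F U' f'" and U': "open U'" "U' \<subseteq> uhp" "x' \<in> U'" and eq: "f x = f' x'"
  shows "\<exists>m e. isom m \<and> m x' = x \<and> e > 0 \<and> ball x' e \<subseteq> U' \<and> (\<forall>z\<in>ball x' e. m z \<in> U \<and> f' z = f (m z))"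
proof -
  obtain r w \<kappa> where c: "is_chart (f x) r w \<kappa>" using ex_chart[OF liso_in[OF f U(3)]] by blast
  have d0: "dist (f x) (f x) < r" "dist (f x) (f' x') < r" using chartD(2)[OF c] eq by auto
  obtain g e where g0: "isom g" "e > 0" "ball x e \<subseteq> U" "\<forall>z\<in>ball x e. udist w (g z) < r \<and> f z = \<kappa> (g z)"
    using liso_in_chart[OF f U c d0(1)] by blast
  have g: "isom g" "e > 0" "ball x e \<subseteq> U" "\<And>z. z \<in> ball x e \<Longrightarrow> udist w (g z) < r" "\<And>z. z \<in> ball x e \<Longrightarrow> f z = \<kappa> (g z)"
    using g0 by simp_all
  obtain g' e' where g0': "isom g'" "e' > 0" "ball x' e' \<subseteq> U'" "\<forall>z\<in>ball x' e'. udist w (g' z) < r \<and> f' z = \<kappa> (g' z)"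
    using liso_in_chart[OF f' U' c d0(2)] by blast
  have g': "isom g'" "e' > 0" "ball x' e' \<subseteq> U'" "\<And>z. z \<in> ball x' e' \<Longrightarrow> udist w (g' z) < r" "\<And>z. z \<in> ball x' e' \<Longrightarrow> f' z = \<kappa> (g' z)"
    using g0' by simp_all
  obtain k where k: "isom k" "\<forall>z\<in>uhp. k (g z) = z \<and> g (k z) = z" using isom_inverse[OF g(1)] by blast
  have xu: "x \<in> uhp" "x' \<in> uhp" using U U' by auto
  have gx: "g x = g' x'"
    by (rule chart_inj[OF c isom_in_uhp[OF g(1) xu(1)] g(4) isom_in_uhp[OF g'(1) xu(2)] g'(4)])
       (use g(5)[of x] g'(5)[of x'] g(2) g'(2) eq in auto)
  define m where "m = k \<circ> g'"
  have m: "isom m" unfolding m_def by (rule isom_comp[OF k(1) g'(1)])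
  have mx: "m x' = x" using gx k(2) xu by (auto simp: m_def simp flip: gx)
  obtain d where d: "d > 0" "ball x' d \<subseteq> uhp" "m ` ball x' d \<subseteq> ball x e"
    using isom_nhd[OF m xu(2), of "ball x e"] mx g(2) by auto
  show ?thesis
  proof (intro exI[of _ m] exI[of _ "min d e'"] conjI ballI m mx)
    show "ball x' (min d e') \<subseteq> U'" using g'(3) by auto
    fix z assume z: "z \<in> ball x' (min d e')"
    then have zd: "z \<in> ball x' d" "z \<in> ball x' e'" by auto
    then have mz: "m z \<in> ball x e" using d by blast
    then show "m z \<in> U" using g by blast
    have "z \<in> uhp" using zd d by blast
    then have "g (m z) = g' z" using k(2) isom_in_uhp[OF g'(1)] by (simp add: m_def)
    then show "f' z = f (m z)" using g(5)[OF mz] g'(5)[OF zd(2)] by simp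
  qed (use d g' in auto)
qed

text \<open>Local injectivity of f turns f (m z) = f z into m z = z as long as m z stays near x,
  which holds on a small ball because m fixes x. The set S need not contain x: in the identity
  principle x may lie on the boundary of the region of agreement.\<close>

lemma stabilizer_trivial:
  assumes f: "liso F U f" and U: "open U" "U \<subseteq> uhp" "x \<in> U" and m: "isom m" "m x = x"
  shows "\<exists>d>0. ball x d \<subseteq> U \<and> (\<forall>S. open S \<longrightarrow> S \<noteq> {} \<longrightarrow> S \<subseteq> ball x d \<longrightarrow> (\<forall>z\<in>S. f (m z) = f z) \<longrightarrow> (\<forall>z\<in>uhp. m z = z))"
proof -
  obtain e where e: "e > 0" "ball x e \<subseteq> U" "inj_on f (ball x e)" using liso_inj_nhd[OF f U] by blast
  obtain d where d: "d > 0" "ball x d \<subseteq> uhp" "m ` ball x d \<subseteq> ball x e"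
    using isom_nhd[OF m(1), of x "ball x e"] m(2) e(1) U by auto
  show ?thesis
  proof (intro exI[of _ "min d e"] conjI allI impI ballI)
    fix S z assume S': "open S" "S \<noteq> {}" "S \<subseteq> ball x (min d e)" "\<forall>z\<in>S. f (m z) = f z" and z: "z \<in> uhp"
    then obtain t where S: "open S" "t \<in> S" "S \<subseteq> ball x (min d e)" "\<And>z. z \<in> S \<Longrightarrow> f (m z) = f z"
      by auto
    have Sm: "m y = y" if "y \<in> S" for y
    proof -
      have "y \<in> ball x d" "y \<in> ball x e" using S(3) that by auto
      then show ?thesis using inj_onD[OF e(3) S(4)[OF that]] d(3) by blast
    qed
    show "m z = z"
    proof (rule isom_fixing_open_set[OF m(1) S(1) _ S(2) Sm z])
      have "ball x (min d e) \<subseteq> ball x d" by auto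
      then show "S \<subseteq> uhp" using S(3) d(2) by blast
    qed
  qed (use d e in auto)
qed

text \<open>Identity principle. Agreement at a single point is too weak, since f and g may differ by
  a rotation or a reflection there; so \<open>T\<close> collects the points with a whole
  neighbourhood of agreement. At a limit point of \<open>T\<close> the transition isometry fixes an
  open set, hence is the identity.\<close>

lemma liso_unique:
  assumes U: "open U" "U \<subseteq> uhp" "connected U" and f: "liso F U f" and g: "liso F U g"
    and S: "open S" "s \<in> S" "S \<subseteq> U" "\<And>z. z \<in> S \<Longrightarrow> f z = g z" and z: "z \<in> U"
  shows "f z = g z"
proof -
  define T where "T = {x \<in> U. \<exists>e>0. ball x e \<subseteq> U \<and> (\<forall>z\<in>ball x e. f z = g z)}"
  have cf: "continuous_on U f" "continuous_on U g" using liso_continuous f g U by auto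
  have oT: "open T"
  proof (subst open_contains_ball, rule ballI)
    fix x assume "x \<in> T"
    then obtain e where e: "e > 0" "ball x e \<subseteq> U" "\<forall>z\<in>ball x e. f z = g z" by (auto simp: T_def)
    have "ball x e \<subseteq> T"
    proof
      fix y assume y: "y \<in> ball x e"
      then obtain d where "d > 0" "ball y d \<subseteq> ball x e" using openE[OF open_ball] by blast
      then show "y \<in> T" using e y unfolding T_def by blast
    qed
    then show "\<exists>e>0. ball x e \<subseteq> T" using e by blast
  qed
  have oT': "open (U - T)"
  proof (subst open_contains_ball, rule ballI)
    fix x assume x: "x \<in> U - T"
    show "\<exists>e>0. ball x e \<subseteq> U - T"
    proof (cases "f x = g x")
      case False
      define e where "e = dist (f x) (g x) / 2"
      have e: "e > 0" using False by (simp add: e_def)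
      obtain d1 where d1: "d1 > 0" "\<And>y. y \<in> U \<Longrightarrow> dist y x < d1 \<Longrightarrow> dist (f y) (f x) < e"
        using cf(1) x e unfolding continuous_on_iff by blast
      obtain d2 where d2: "d2 > 0" "\<And>y. y \<in> U \<Longrightarrow> dist y x < d2 \<Longrightarrow> dist (g y) (g x) < e"
        using cf(2) x e unfolding continuous_on_iff by blast
      obtain d3 where d3: "d3 > 0" "ball x d3 \<subseteq> U" using U(1) x openE by blast
      have "ball x (min d1 (min d2 d3)) \<subseteq> U - T"
      proof
        fix y assume y: "y \<in> ball x (min d1 (min d2 d3))"
        have yU: "y \<in> U" using y d3 by auto
        have "dist (f y) (f x) < e" "dist (g y) (g x) < e" using d1(2)[OF yU] d2(2)[OF yU] y by (auto simp: dist_commute)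
        then have "f y \<noteq> g y"
          using dist_triangle[of "f x" "g x" "f y"] by (auto simp: e_def dist_commute)
        then show "y \<in> U - T" using yU by (force simp: T_def)
      qed
      then show ?thesis using d1 d2 d3 by (intro exI[of _ "min d1 (min d2 d3)"]) auto
    next
      case True
      have xU: "x \<in> U" using x by simp
      obtain m e where m: "isom m" "m x = x" "e > 0" "ball x e \<subseteq> U" "\<forall>z\<in>ball x e. m z \<in> U \<and> g z = f (m z)"
        using transition[OF f U(1,2) xU g U(1,2) xU True] by blast
      obtain d where d: "d > 0" "ball x d \<subseteq> U"
        "\<forall>S. open S \<longrightarrow> S \<noteq> {} \<longrightarrow> S \<subseteq> ball x d \<longrightarrow> (\<forall>z\<in>S. f (m z) = f z) \<longrightarrow> (\<forall>z\<in>uhp. m z = z)"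
        using stabilizer_trivial[OF f U(1,2) xU m(1,2)] by (elim exE conjE)
      have "ball x (min d e) \<inter> T = {}"
      proof (rule ccontr)
        assume "ball x (min d e) \<inter> T \<noteq> {}"
        then obtain t where t: "t \<in> ball x (min d e)" "t \<in> T" by blast
        then obtain k where k: "k > 0" "\<forall>z\<in>ball t k. f z = g z" by (auto simp: T_def)
        define S where "S = ball t k \<inter> ball x (min d e)"
        have "open S" "t \<in> S" "S \<subseteq> ball x d" using t k by (auto simp: S_def)
        moreover have "\<forall>z\<in>S. f (m z) = f z" using k m(5) by (simp add: S_def)
        ultimately have "\<forall>z\<in>uhp. m z = z" using d(3)[rule_format, of S] by auto
        then have "\<forall>z\<in>ball x e. f z = g z" using m(5) subset_trans[OF m(4) U(2)] by (simp add: subset_iff)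
        then have "x \<in> T" using m xU by (auto simp: T_def)
        then show False using x by simp
      qed
      then have "ball x (min d e) \<subseteq> U - T" using d by auto
      then show ?thesis using d m by (intro exI[of _ "min d e"]) auto
    qed
  qed
  have "s \<in> T"
  proof -
    obtain e where "e > 0" "ball s e \<subseteq> S" using S openE by blast
    then have "s \<in> U" "e > 0" "ball s e \<subseteq> U" "\<forall>z\<in>ball s e. f z = g z" using S by auto
    then show ?thesis unfolding T_def by blast
  qed
  then have "(U - T) \<inter> U = {}"
    using connectedD[OF U(3) oT oT'] S by blast
  then have "z \<in> T" using z by blast
  then show ?thesis unfolding T_def using centre_in_ball by blast
qed

end

text \<open>Locally f is Lipschitz with constant 1 / c for the Euclidean distance; the segment from
  x to y stays in U by convexity, and bisection along it adds the local estimates up. The estimate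
  on all of U serves to carry Cauchy sequences to Cauchy sequences.\<close>

lemma liso_lipschitz:
  assumes f: "liso F U f" and U: "convex U" "U \<subseteq> uhp" and c: "c > 0" "\<And>z. z \<in> U \<Longrightarrow> c \<le> Im z"
    and xy: "x \<in> U" "y \<in> U"
  shows "dist (f x) (f y) \<le> dist x y / c"
proof -
  define \<gamma> where "\<gamma> t = x + of_real t * (y - x)" for t :: real
  have \<gamma>U: "\<gamma> t \<in> U" if "0 \<le> t" "t \<le> 1" for t
  proof -
    have "\<gamma> t = (1 - t) *\<^sub>R x + t *\<^sub>R y" by (simp add: \<gamma>_def scaleR_conv_of_real algebra_simps)
    then show ?thesis using convexD[OF U(1) xy, of "1 - t" t] that by simp
  qed
  have \<gamma>d: "dist (\<gamma> s) (\<gamma> t) = \<bar>t - s\<bar> * dist x y" for s t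
  proof -
    have "\<gamma> s - \<gamma> t = of_real (t - s) * (x - y)" by (simp add: \<gamma>_def algebra_simps)
    then show ?thesis by (simp only: dist_norm norm_mult norm_of_real)
  qed
  define P where "P s t \<longleftrightarrow> (0 \<le> s \<and> t \<le> 1 \<longrightarrow> dist (f (\<gamma> s)) (f (\<gamma> t)) \<le> (t - s) * (dist x y / c))" for s t
  have "(0::real) \<le> 1" by simp
  then have "P 0 1"
  proof (induction rule: Bolzano)
    case (trans r s t)
    show ?case unfolding P_def
    proof
      assume "0 \<le> r \<and> t \<le> 1"
      then have "dist (f (\<gamma> r)) (f (\<gamma> s)) \<le> (s - r) * (dist x y / c)" "dist (f (\<gamma> s)) (f (\<gamma> t)) \<le> (t - s) * (dist x y / c)"
        using trans by (auto simp: P_def)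
      moreover have "(t - r) * (dist x y / c) = (s - r) * (dist x y / c) + (t - s) * (dist x y / c)"
        by (simp only: distrib_right[symmetric]) simp
      ultimately show "dist (f (\<gamma> r)) (f (\<gamma> t)) \<le> (t - r) * (dist x y / c)"
        using dist_triangle[of "f (\<gamma> r)" "f (\<gamma> t)" "f (\<gamma> s)"] by linarith
    qed
  next
    case (local t)
    then have "\<gamma> t \<in> U" by (intro \<gamma>U) auto
    then obtain e where e: "e > 0" "\<forall>y\<in>U \<inter> ball (\<gamma> t) e. \<forall>z\<in>U \<inter> ball (\<gamma> t) e. dist (f y) (f z) = udist y z"
      using lisoD[OF f] by blast
    define d where "d = e / (1 + dist x y)"
    have pos: "1 + dist x y > 0" by (smt (verit) zero_le_dist)
    have d: "d > 0" using e pos by (simp add: d_def)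
    have "P r s" if rs: "r \<le> t" "t \<le> s" "s - r < d" for r s
      unfolding P_def
    proof
      assume 01: "0 \<le> r \<and> s \<le> 1"
      have U': "\<gamma> r \<in> U" "\<gamma> s \<in> U" using \<gamma>U 01 rs by auto
      have "\<bar>v - t\<bar> * dist x y < e" if "\<bar>v - t\<bar> \<le> s - r" for v
      proof -
        have "\<bar>v - t\<bar> * dist x y \<le> (s - r) * (1 + dist x y)" using that by (intro mult_mono) auto
        also have "\<dots> < d * (1 + dist x y)" using rs pos by simp
        also have "\<dots> = e" using pos by (simp add: d_def)
        finally show ?thesis .
      qed
      from this[of r] this[of s] have "\<gamma> r \<in> ball (\<gamma> t) e" "\<gamma> s \<in> ball (\<gamma> t) e"
        using rs by (auto simp: \<gamma>d abs_minus_commute)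
      then have "dist (f (\<gamma> r)) (f (\<gamma> s)) = udist (\<gamma> r) (\<gamma> s)" using e U' by auto
      also have "\<dots> \<le> cmod (\<gamma> r - \<gamma> s) / c" using U' U c by (intro udist_le) auto
      also have "\<dots> = (s - r) * (dist x y / c)" using \<gamma>d[of r s] rs by (simp add: dist_norm)
      finally show "dist (f (\<gamma> r)) (f (\<gamma> s)) \<le> (s - r) * (dist x y / c)" .
    qed
    then show ?case using d by blast
  qed
  then show ?thesis by (simp add: P_def \<gamma>_def)
qed

text \<open>The point dividing the segment from p to q in the ratio r : s lies in both balls and in
  the closure of U; the intersection of the balls is open, so it meets U itself.\<close>

lemma balls_meet_inside_convex:
  fixes U :: "'a::euclidean_space set"
  assumes U: "convex U" and p: "p \<in> closure U" "q \<in> closure U" and m: "ball p r \<inter> ball q s \<noteq> {}"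
    and rs: "r > 0" "s > 0"
  shows "ball p r \<inter> ball q s \<inter> U \<noteq> {}"
proof -
  define t where "t = r / (r + s)"
  have t: "0 < t" "t < 1" "t * (r + s) = r" "(1 - t) * (r + s) = s" using rs by (auto simp: t_def field_simps)
  define c where "c = (1 - t) *\<^sub>R p + t *\<^sub>R q"
  have c: "c \<in> closure U"
    unfolding c_def using convexD[OF convex_closure[OF U] p, of "1 - t" t] t by simp
  have "dist p q < r + s" using m by (metis disjoint_ballI linorder_not_less)
  then have d: "t * dist p q < t * (r + s)" "(1 - t) * dist p q < (1 - t) * (r + s)"
    using t(1,2) by (auto intro!: mult_strict_left_mono)
  have "p - c = t *\<^sub>R (p - q)" "q - c = (1 - t) *\<^sub>R (q - p)" by (simp_all add: c_def algebra_simps)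
  then have "dist p c = t * dist p q" "dist q c = (1 - t) * dist p q"
    using t by (simp_all add: dist_norm norm_minus_commute)
  then have "c \<in> ball p r \<inter> ball q s" using d t by simp
  then have "(ball p r \<inter> ball q s) \<inter> closure U \<noteq> {}" using c by blast
  then show ?thesis using open_Int_closure_eq_empty[of "ball p r \<inter> ball q s" U] by auto
qed

context hyp_charts
begin

text \<open>Completeness of F enters here: the values along a sequence tending to p converge to some
  q in F. A chart about q, matched with f at a point x near p, continues f across p.\<close>

lemma liso_extend_at_closure_point:
  assumes f: "liso F U f" and U: "open U" "convex U" "U \<subseteq> uhp" and c: "c > 0" "\<And>z. z \<in> U \<Longrightarrow> c \<le> Im z"
    and p: "p \<in> closure U"
  shows "\<exists>e h. e > 0 \<and> ball p e \<subseteq> uhp \<and> liso F (ball p e) h \<and> (\<forall>z\<in>U \<inter> ball p e. h z = f z)"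
proof -
  have lip: "dist (f x) (f y) \<le> dist x y / c" if "x \<in> U" "y \<in> U" for x y
    using liso_lipschitz[OF f U(2,3) c that] .
  have pu: "p \<in> uhp"
  proof -
    have "closure U \<subseteq> {z. c \<le> Im z}"
      by (rule closure_minimal) (use c in \<open>auto intro!: closed_Collect_le continuous_intros\<close>)
    then show ?thesis using p c(1) by (auto simp: uhp_def)
  qed
  obtain u where u: "\<And>n. u n \<in> U" "u \<longlonglongrightarrow> p" using p closure_sequential[of p U] by auto
  have "Cauchy (\<lambda>n. f (u n))"
    unfolding Cauchy_def
  proof (intro allI impI)
    fix e :: real assume "e > 0"
    then obtain M where M: "\<forall>m\<ge>M. \<forall>n\<ge>M. dist (u m) (u n) < e * c"
      using LIMSEQ_imp_Cauchy[OF u(2)] c(1) unfolding Cauchy_def by (meson mult_pos_pos)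
    have "dist (f (u m)) (f (u n)) < e" if "m \<ge> M" "n \<ge> M" for m n
    proof -
      have "dist (u m) (u n) / c < e" using M that c(1) by (simp add: pos_divide_less_eq)
      then show ?thesis using lip[OF u(1) u(1), of m n] by linarith
    qed
    then show "\<exists>M. \<forall>m\<ge>M. \<forall>n\<ge>M. dist (f (u m)) (f (u n)) < e" by blast
  qed
  then obtain q where q: "q \<in> F" "(\<lambda>n. f (u n)) \<longlonglongrightarrow> q"
    using completeE[OF complete_F] liso_in[OF f u(1)] by metis
  have lq: "dist q (f x) \<le> dist p x / c" if "x \<in> U" for x
  proof (rule tendsto_le[OF sequentially_bot])
    show "(\<lambda>n. dist (f (u n)) (f x)) \<longlonglongrightarrow> dist q (f x)" by (intro tendsto_intros q)
    show "(\<lambda>n. dist (u n) x / c) \<longlonglongrightarrow> dist p x / c" using c(1) by (intro tendsto_intros u) auto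
    show "\<forall>\<^sub>F n in sequentially. dist (f (u n)) (f x) \<le> dist (u n) x / c" using lip[OF u(1) that] by simp
  qed
  obtain r w \<kappa> where ch: "is_chart q r w \<kappa>" using ex_chart[OF q(1)] by blast
  have r: "r > 0" and wu: "w \<in> uhp" using chartD[OF ch] by auto
  obtain \<rho> where \<rho>: "\<rho> > 0" "ball w \<rho> \<subseteq> uhp" "\<And>z v. z \<in> ball w \<rho> \<Longrightarrow> v \<in> ball w \<rho> \<Longrightarrow> udist z v < r"
    using udist_small_nhd[OF wu r] by blast
  \<comment> \<open>A quantitative substitute for the triangle inequality of the hyperbolic distance near \<open>w\<close>.\<close>
  have "\<exists>\<eta>>0. \<forall>v\<in>uhp. udist w v < \<eta> \<longrightarrow> (\<forall>v'\<in>uhp. udist v v' < \<eta> \<longrightarrow> udist w v' < r)"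
  proof -
    have iw: "Im w > 0" using wu by (simp add: uhp_def)
    define l where "l = min (\<rho> / 2) (Im w)"
    have l: "l > 0" using \<rho> iw by (simp add: l_def)
    obtain \<eta> where \<eta>: "\<eta> > 0" "\<forall>x\<in>uhp. \<forall>z\<in>uhp. Im x \<le> 2 * Im w \<longrightarrow> udist x z < \<eta> \<longrightarrow> cmod (x - z) < l"
      using udist_ball_subset[of "2 * Im w" l] iw l by auto
    have "udist w v' < r" if v: "v \<in> uhp" "udist w v < \<eta>" "v' \<in> uhp" "udist v v' < \<eta>" for v v'
    proof -
      have 1: "cmod (w - v) < l" using \<eta>(2)[rule_format, of w v] wu v iw by simp
      then have "Im v \<le> 2 * Im w" using abs_Im_le_cmod[of "w - v"] by (simp add: l_def abs_if split: if_splits)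
      then have 2: "cmod (v - v') < l" using \<eta>(2)[rule_format, of v v'] v by simp
      have "dist w v' \<le> dist w v + dist v v'" by (rule dist_triangle)
      then have "dist w v' < \<rho>" using 1 2 by (simp add: dist_norm l_def)
      then show ?thesis using \<rho> by simp
    qed
    then show ?thesis using \<eta>(1) by blast
  qed
  then obtain \<eta> where \<eta>: "\<eta> > 0" "\<And>v v'. v \<in> uhp \<Longrightarrow> udist w v < \<eta> \<Longrightarrow> v' \<in> uhp \<Longrightarrow> udist v v' < \<eta> \<Longrightarrow> udist w v' < r"
    by blast
  obtain d where d: "d > 0" "ball p d \<subseteq> uhp" "\<And>z v. z \<in> ball p d \<Longrightarrow> v \<in> ball p d \<Longrightarrow> udist z v < \<eta>"
    using udist_small_nhd[OF pu \<eta>(1)] by blast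
  \<comment> \<open>For x and z in \<open>ball p e\<close>, the point \<open>m x\<close> is within
    \<open>\<eta>\<close> of w because f x is close to q, and \<open>m z\<close> is within
    \<open>\<eta>\<close> of \<open>m x\<close>; by the choice of \<open>\<eta>\<close> the point
    \<open>m z\<close> then stays in the chart disc.\<close>
  define e where "e = min d (min \<eta> r * c)"
  have e: "e > 0" using d \<eta> r c by (simp add: e_def)
  obtain n where n: "dist (u n) p < e" using u(2) e by (metis LIMSEQ_def order_refl)
  define x where "x = u n"
  have x: "x \<in> U" "x \<in> ball p e" "x \<in> uhp" using u n U by (auto simp: x_def dist_commute)
  have fx: "dist q (f x) < min \<eta> r"
  proof -
    have "dist p x < min \<eta> r * c" using x(2) by (simp add: e_def)
    then have "dist p x / c < min \<eta> r" using pos_divide_less_eq[OF c(1), of "dist p x" "min \<eta> r"] by blast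
    then show ?thesis using lq[OF x(1)] by linarith
  qed
  obtain m k where m: "isom m" "k > 0" "ball x k \<subseteq> U" "\<forall>z\<in>ball x k. udist w (m z) < r \<and> f z = \<kappa> (m z)"
    using liso_in_chart[OF f U(1,3) x(1) ch] fx by auto
  have xk: "udist w (m x) < r" "f x = \<kappa> (m x)" using m(2,4) by auto
  have mx: "m x \<in> uhp" using isom_in_uhp[OF m(1) x(3)] .
  have wm: "udist w (m x) < \<eta>"
    using chartD(7)[OF ch wu chart_center[OF ch] mx xk(1)] chartD(4)[OF ch] xk(2) fx by simp
  have inW: "udist w (m z) < r" "z \<in> uhp" if "z \<in> ball p e" for z
  proof -
    have z: "z \<in> ball p d" "x \<in> ball p d" using that x(2) by (auto simp: e_def)
    show zu: "z \<in> uhp" using z d by auto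
    have "udist (m x) (m z) < \<eta>" using isom_udist[OF m(1) x(3) zu] d(3)[OF z(2,1)] by simp
    then show "udist w (m z) < r" using \<eta>(2)[OF mx wm isom_in_uhp[OF m(1) zu]] by simp
  qed
  define W where "W = {z\<in>uhp. udist w z < r}"
  have \<kappa>W: "liso F W \<kappa>"
    unfolding liso_def
  proof (intro conjI ballI)
    show "\<kappa> ` W \<subseteq> F" using chartD(6)[OF ch] by (auto simp: W_def)
    show "\<exists>e>0. \<forall>y\<in>W \<inter> ball x e. \<forall>z\<in>W \<inter> ball x e. dist (\<kappa> y) (\<kappa> z) = udist y z" for x
      using chartD(7)[OF ch] by (intro exI[of _ 1]) (auto simp: W_def)
  qed
  have mW: "m ` ball p e \<subseteq> W" using inW isom_in_uhp[OF m(1)] by (auto simp: W_def)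
  have bu: "ball p e \<subseteq> uhp" using inW by auto
  have lh: "liso F (ball p e) (\<lambda>z. \<kappa> (m z))"
    by (rule liso_comp[OF \<kappa>W m(1) bu mW]) (auto simp: W_def)
  have "\<kappa> (m z) = f z" if z: "z \<in> U \<inter> ball p e" for z
  proof (rule liso_unique[OF _ _ _ _ _ _ _ _ _ z])
    show "open (U \<inter> ball p e)" "U \<inter> ball p e \<subseteq> uhp" using U by auto
    show "connected (U \<inter> ball p e)" using U by (intro convex_connected convex_Int convex_ball)
    show "liso F (U \<inter> ball p e) (\<lambda>z. \<kappa> (m z))" using lh by (rule liso_subset) auto
    show "liso F (U \<inter> ball p e) f" using f by (rule liso_subset) auto
    show "open (ball x k \<inter> ball p e)" by auto
    show "x \<in> ball x k \<inter> ball p e" using x m(2) by auto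
    show "ball x k \<inter> ball p e \<subseteq> U \<inter> ball p e" using m(3) by auto
    show "\<kappa> (m z) = f z" if "z \<in> ball x k \<inter> ball p e" for z using m(4) that by simp
  qed
  with e bu lh show ?thesis by (intro exI[of _ e] exI[of _ "\<lambda>z. \<kappa> (m z)"]) auto
qed

text \<open>Two of the local extensions agree where their balls overlap: the balls then also overlap
  inside the convex set U, where both maps are f, and the intersection of the balls is
  connected.\<close>

lemma liso_extend_closure:
  assumes f: "liso F U f" and U: "open U" "convex U" "U \<subseteq> uhp" and c: "c > 0" "\<And>z. z \<in> U \<Longrightarrow> c \<le> Im z"
  shows "\<exists>V h. open V \<and> closure U \<subseteq> V \<and> V \<subseteq> uhp \<and> liso F V h \<and> (\<forall>z\<in>U. h z = f z)"
proof -
  have "\<forall>p. \<exists>e h. p \<in> closure U \<longrightarrow> e > 0 \<and> ball p e \<subseteq> uhp \<and> liso F (ball p e) h \<and> (\<forall>z\<in>U \<inter> ball p e. h z = f z)"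
    using liso_extend_at_closure_point[OF f U c] by blast
  then obtain e h where eh0: "\<forall>p. p \<in> closure U \<longrightarrow> e p > 0 \<and> ball p (e p) \<subseteq> uhp \<and> liso F (ball p (e p)) (h p) \<and> (\<forall>z\<in>U \<inter> ball p (e p). h p z = f z)"
    by metis
  have eh: "e p > 0" "ball p (e p) \<subseteq> uhp" "liso F (ball p (e p)) (h p)" "\<And>z. z \<in> U \<inter> ball p (e p) \<Longrightarrow> h p z = f z"
    if "p \<in> closure U" for p using eh0 that by blast+
  have consistent: "h p z = h q z" if p: "p \<in> closure U" and q: "q \<in> closure U" and z: "z \<in> ball p (e p) \<inter> ball q (e q)" for p q z
  proof -
    define B where "B = ball p (e p) \<inter> ball q (e q)"
    have "B \<inter> U \<noteq> {}"
      unfolding B_def using balls_meet_inside_convex[OF U(2) p q _ eh(1)[OF p] eh(1)[OF q]] z by blast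
    then obtain s where s: "s \<in> B \<inter> U" by blast
    show ?thesis
    proof (rule liso_unique[of B "h p" "h q" "B \<inter> U" s z])
      show "open B" "B \<subseteq> uhp" using eh(2)[OF p] by (auto simp: B_def)
      show "connected B" unfolding B_def by (intro convex_connected convex_Int convex_ball)
      show "liso F B (h p)" using eh(3)[OF p] by (rule liso_subset) (auto simp: B_def)
      show "liso F B (h q)" using eh(3)[OF q] by (rule liso_subset) (auto simp: B_def)
      show "h p z = h q z" if "z \<in> B \<inter> U" for z
        using eh(4)[OF p, of z] eh(4)[OF q, of z] that by (simp add: B_def)
    qed (use s z U(1) in \<open>auto simp: B_def\<close>)
  qed
  define V where "V = (\<Union>p\<in>closure U. ball p (e p))"
  define sel where "sel z = (SOME p. p \<in> closure U \<and> z \<in> ball p (e p))" for z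
  have sel: "sel z \<in> closure U" "z \<in> ball (sel z) (e (sel z))" if "z \<in> V" for z
    using someI_ex[of "\<lambda>p. p \<in> closure U \<and> z \<in> ball p (e p)"] that unfolding sel_def V_def by blast+
  define H where "H z = h (sel z) z" for z
  have H: "H z = h p z" if "p \<in> closure U" "z \<in> ball p (e p)" for p z
  proof -
    have "z \<in> V" using that by (auto simp: V_def)
    then show ?thesis unfolding H_def using consistent[OF sel(1) that(1), of z z] sel(2)[of z] that by simp
  qed
  have "liso F V H"
  proof (rule liso_locally)
    fix x assume x: "x \<in> V"
    have "V \<inter> ball (sel x) (e (sel x)) \<subseteq> ball (sel x) (e (sel x))" by blast
    then have "liso F (V \<inter> ball (sel x) (e (sel x))) H"
      using eh(3)[OF sel(1)[OF x]] by (elim liso_subset[rotated]) (use H[OF sel(1)[OF x]] in auto)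
    then show "\<exists>W. open W \<and> x \<in> W \<and> liso F (V \<inter> W) H" using sel[OF x] by blast
  qed
  moreover have "closure U \<subseteq> V" using eh(1) by (auto simp: V_def)
  moreover have "H z = f z" if "z \<in> U" for z
  proof -
    have zc: "z \<in> closure U" using that closure_subset by blast
    then show ?thesis using H[OF zc, of z] eh(1,4)[OF zc] that by simp
  qed
  moreover have "open V" "V \<subseteq> uhp" using eh(2) by (auto simp: V_def)
  ultimately show ?thesis by blast
qed

end

subsection \<open>Extension of local isometries to the half-plane\<close>

text \<open>The open and closed hyperbolic discs about \<open>\<i>\<close> whose radius has hyperbolic cosine \<open>C\<close>.\<close>

definition odisc :: "real \<Rightarrow> complex set" where
  "odisc C = {w. (cmod w)\<^sup>2 + 1 < 2 * C * Im w}"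

definition cdisc :: "real \<Rightarrow> complex set" where
  "cdisc C = {w. (cmod w)\<^sup>2 + 1 \<le> 2 * C * Im w}"

lemma dist_center_sq: "(dist (of_real C * \<i>) w)\<^sup>2 = (cmod w)\<^sup>2 - 2 * C * Im w + C\<^sup>2"
  unfolding dist_norm cmod_power2 by (simp add: power2_eq_square algebra_simps)

lemma odisc_ball: "C > 1 \<Longrightarrow> odisc C = ball (of_real C * \<i>) (sqrt (C\<^sup>2 - 1))"
proof -
  assume C: "C > 1"
  have "dist (of_real C * \<i>) w < sqrt (C\<^sup>2 - 1) \<longleftrightarrow> (dist (of_real C * \<i>) w)\<^sup>2 < C\<^sup>2 - 1" for w
    using real_sqrt_less_iff[of "(dist (of_real C * \<i>) w)\<^sup>2" "C\<^sup>2 - 1"] by simp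
  then show "odisc C = ball (of_real C * \<i>) (sqrt (C\<^sup>2 - 1))"
    by (intro set_eqI) (simp only: odisc_def mem_ball mem_Collect_eq dist_center_sq, linarith)
qed

lemma cdisc_cball: "C \<ge> 1 \<Longrightarrow> cdisc C = cball (of_real C * \<i>) (sqrt (C\<^sup>2 - 1))"
proof -
  assume C: "C \<ge> 1"
  have "dist (of_real C * \<i>) w \<le> sqrt (C\<^sup>2 - 1) \<longleftrightarrow> (dist (of_real C * \<i>) w)\<^sup>2 \<le> C\<^sup>2 - 1" for w
    using real_sqrt_le_iff[of "(dist (of_real C * \<i>) w)\<^sup>2" "C\<^sup>2 - 1"] by simp
  then show "cdisc C = cball (of_real C * \<i>) (sqrt (C\<^sup>2 - 1))"
    by (intro set_eqI) (simp only: cdisc_def mem_cball mem_Collect_eq dist_center_sq, linarith)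
qed

lemma closure_odisc: "C > 1 \<Longrightarrow> closure (odisc C) = cdisc C"
  using odisc_ball[of C] cdisc_cball[of C] closure_ball[of "sqrt (C\<^sup>2 - 1)"] by (simp add: power_strict_increasing_iff)

lemma open_odisc: "open (odisc C)"
  unfolding odisc_def by (intro open_Collect_less continuous_intros)

lemma convex_odisc: "C > 1 \<Longrightarrow> convex (odisc C)"
  by (simp add: odisc_ball convex_ball)

lemma disc_Im: 
  assumes "C \<ge> 1" "w \<in> cdisc C" shows "Im w \<ge> 1 / (2 * C)" "Im w > 0"
proof -
  have "1 \<le> 2 * C * Im w" using assms(2) unfolding cdisc_def by (smt (verit) mem_Collect_eq zero_le_power2)
  then show "Im w \<ge> 1 / (2 * C)" using assms by (simp add: pos_divide_le_eq mult_ac)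
  then show "Im w > 0" using assms by (smt (verit) divide_pos_pos)
qed

lemma odisc_subset_cdisc: "odisc C \<subseteq> cdisc C"
  by (auto simp: odisc_def cdisc_def)

lemma odisc_uhp: "C \<ge> 1 \<Longrightarrow> odisc C \<subseteq> uhp" "C \<ge> 1 \<Longrightarrow> cdisc C \<subseteq> uhp"
  using disc_Im(2) subsetD[OF odisc_subset_cdisc] by (auto simp: uhp_def)

lemma odisc_mono: "1 \<le> C \<Longrightarrow> C \<le> C' \<Longrightarrow> odisc C \<subseteq> odisc C'"
proof
  fix w assume *: "1 \<le> C" "C \<le> C'" "w \<in> odisc C"
  then have "Im w > 0" using odisc_uhp by (auto simp: uhp_def)
  then have "2 * C * Im w \<le> 2 * C' * Im w" using * by simp
  then show "w \<in> odisc C'" using * by (simp add: odisc_def)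
qed

lemma mem_odisc_iff: "Im w > 0 \<Longrightarrow> w \<in> odisc C \<longleftrightarrow> ((cmod w)\<^sup>2 + 1) / (2 * Im w) < C"
  by (simp add: odisc_def pos_divide_less_eq mult_ac)

lemma mem_cdisc_iff: "Im w > 0 \<Longrightarrow> w \<in> cdisc C \<longleftrightarrow> ((cmod w)\<^sup>2 + 1) / (2 * Im w) \<le> C"
  by (simp add: cdisc_def pos_divide_le_eq mult_ac)

text \<open>The quotient (|w|^2 + 1) / (2 Im w) is cosh of the distance from \<i>. On the compact
  part of \<open>cdisc (C + 1)\<close> outside V it has a minimum above C, and discs up to that
  minimum stay in V.\<close>

lemma larger_odisc:
  assumes C: "C \<ge> 1" and V: "open V" "cdisc C \<subseteq> V"
  shows "\<exists>C'>C. odisc C' \<subseteq> V"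
proof -
  define K where "K = cdisc (C + 1) - V"
  have K: "compact K" unfolding K_def using C V cdisc_cball[of "C+1"] by (simp add: compact_diff)
  have Ku: "Im w > 0" if "w \<in> K" for w using disc_Im(2)[of "C+1" w] that C by (simp add: K_def)
  show ?thesis
  proof (cases "K = {}")
    case True
    then show ?thesis using odisc_subset_cdisc[of "C+1"] by (intro exI[of _ "C+1"]) (auto simp: K_def)
  next
    case False
    have "continuous_on K (\<lambda>w. ((cmod w)\<^sup>2 + 1) / (2 * Im w))"
      by (intro continuous_intros) (use Ku in force)
    then obtain v where v: "v \<in> K" "\<forall>w\<in>K. ((cmod v)\<^sup>2 + 1) / (2 * Im v) \<le> ((cmod w)\<^sup>2 + 1) / (2 * Im w)"
      using continuous_attains_inf[OF K False] by blast
    define b where "b = ((cmod v)\<^sup>2 + 1) / (2 * Im v)"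
    have "b > C" using v(1) V(2) mem_cdisc_iff[OF Ku[OF v(1)], of C] by (auto simp: b_def K_def)
    moreover have "odisc (min b (C + 1)) \<subseteq> V"
    proof
      fix w assume w: "w \<in> odisc (min b (C + 1))"
      have I: "Im w > 0" using w odisc_uhp(1)[of "min b (C+1)"] C \<open>b > C\<close> by (auto simp: uhp_def)
      have lt: "((cmod w)\<^sup>2 + 1) / (2 * Im w) < min b (C + 1)" using w mem_odisc_iff[OF I] by simp
      then have "w \<in> cdisc (C + 1)" using mem_cdisc_iff[OF I] by simp
      then show "w \<in> V" using v(2) lt by (force simp: K_def b_def)
    qed
    ultimately show ?thesis by (intro exI[of _ "min b (C + 1)"]) auto
  qed
qed

context hyp_charts
begin

text \<open>Continuation over concentric discs: extensions to discs of different size agree by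
  uniqueness and can be glued. A finite supremum of the attained sizes is impossible, since the
  extension to that open disc continues past its closure.\<close>

lemma extend_from_disc:
  assumes C0: "C0 > 1" and f0: "liso F (odisc C0) f0"
  shows "\<exists>N. liso F uhp N \<and> (\<forall>z\<in>odisc C0. N z = f0 z)"
proof -
  define Ext where "Ext C f \<longleftrightarrow> liso F (odisc C) f \<and> (\<forall>z\<in>odisc C0. f z = f0 z)" for C f
  have o0: "\<i> \<in> odisc C0" using C0 by (simp add: odisc_def)
  have unique: "f z = g z" if "C0 \<le> C" "Ext C f" "liso F (odisc C) g" "\<forall>z\<in>odisc C0. g z = f0 z" "z \<in> odisc C" for C f g z
  proof (rule liso_unique[of "odisc C" f g "odisc C0" \<i> z])
    show "connected (odisc C)" using convex_odisc[of C] C0 that by (simp add: convex_connected)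
  qed (use that C0 o0 open_odisc odisc_uhp odisc_mono in \<open>auto simp: Ext_def\<close>)
  have glue: "\<exists>f. liso F (\<Union>C\<in>I. odisc C) f \<and> (\<forall>z\<in>odisc C0. f z = f0 z)"
    if I: "C0 \<in> I" "\<And>C. C \<in> I \<Longrightarrow> C0 \<le> C" "\<And>C. C \<in> I \<Longrightarrow> \<exists>f. Ext C f" for I
  proof -
    obtain h where h: "\<And>C. C \<in> I \<Longrightarrow> Ext C (h C)" using bchoice[of I Ext] I(3) by blast
    define sel where "sel z = (SOME C. C \<in> I \<and> z \<in> odisc C)" for z
    have sel: "sel z \<in> I" "z \<in> odisc (sel z)" if "z \<in> odisc C" "C \<in> I" for z C
      using someI[of "\<lambda>C. C \<in> I \<and> z \<in> odisc C" C] that unfolding sel_def by blast+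
    have same: "h C z = h C' z" if "C \<in> I" "C' \<in> I" "z \<in> odisc C" "C \<le> C'" for C C' z
    proof (rule unique[OF I(2)[OF that(1)] h[OF that(1)] _ _ that(3)])
      have e: "liso F (odisc C') (h C')" "\<forall>z\<in>odisc C0. h C' z = f0 z" using h[OF that(2)] by (auto simp: Ext_def)
      show "liso F (odisc C) (h C')"
        by (rule liso_subset[OF e(1)]) (use odisc_mono[of C C'] that I(2)[OF that(1)] C0 in auto)
      show "\<forall>z\<in>odisc C0. h C' z = f0 z" by (rule e(2))
    qed
    define H where "H z = h (sel z) z" for z
    have H: "H z = h C z" if "C \<in> I" "z \<in> odisc C" for C z
    proof (cases "C \<le> sel z")
      case True
      show ?thesis unfolding H_def by (rule same[OF that(1) sel(1)[OF that(2,1)] that(2) True, symmetric])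
    next
      case False
      then show ?thesis unfolding H_def
        using same[OF sel(1)[OF that(2,1)] that(1) sel(2)[OF that(2,1)]] by simp
    qed
    have "liso F (\<Union>C\<in>I. odisc C) H"
    proof (rule liso_locally)
      fix x assume "x \<in> (\<Union>C\<in>I. odisc C)"
      then obtain C where C: "C \<in> I" "x \<in> odisc C" by blast
      have "(\<Union>C\<in>I. odisc C) \<inter> odisc C = odisc C" using C by blast
      moreover have "liso F (odisc C) H"
        by (rule liso_subset[of F "odisc C" "h C"]) (use h[OF C(1)] H[OF C(1)] in \<open>auto simp: Ext_def\<close>)
      ultimately show "\<exists>V. open V \<and> x \<in> V \<and> liso F ((\<Union>C\<in>I. odisc C) \<inter> V) H"
        using open_odisc C by (intro exI[of _ "odisc C"]) simp
    qed
    moreover have "\<forall>z\<in>odisc C0. H z = f0 z" using H[OF I(1)] h[OF I(1)] by (simp add: Ext_def)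
    ultimately show ?thesis by blast
  qed
  define Q where "Q = {C. C0 \<le> C \<and> (\<exists>f. Ext C f)}"
  have Q0: "C0 \<in> Q" using f0 by (auto simp: Q_def Ext_def)
  have down: "C' \<in> Q" if dn: "C \<in> Q" "C0 \<le> C'" "C' \<le> C" for C C'
  proof -
    obtain f where "liso F (odisc C) f" "\<forall>z\<in>odisc C0. f z = f0 z" using dn unfolding Q_def Ext_def by blast
    then have "Ext C' f" unfolding Ext_def using liso_subset[of F "odisc C" f "odisc C'" f] odisc_mono[of C' C] dn C0 by auto
    then show ?thesis using dn by (auto simp: Q_def)
  qed
  have all: "C \<in> Q" if "C0 \<le> C" for C
  proof (rule ccontr)
    assume "C \<notin> Q"
    then have ub: "C' \<le> C" if "C' \<in> Q" for C' using down[OF that] \<open>C0 \<le> C\<close> by (meson nle_le)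
    then have bdd: "bdd_above Q" by (auto simp: bdd_above_def)
    define s where "s = Sup Q"
    have s: "C0 \<le> s" unfolding s_def by (rule cSup_upper[OF Q0 bdd])
    \<comment> \<open>The open disc of the supremal size is exhausted by the attained ones, so
      gluing already defines the map on it, whether or not the supremum is attained.\<close>
    have "odisc s \<subseteq> (\<Union>C\<in>Q. odisc C)"
    proof
      fix w assume w: "w \<in> odisc s"
      have I: "Im w > 0" using w odisc_uhp(1)[of s] s C0 by (auto simp: uhp_def)
      then have "((cmod w)\<^sup>2 + 1) / (2 * Im w) < Sup Q" using w mem_odisc_iff[OF I] by (simp add: s_def)
      then obtain C where "C \<in> Q" "((cmod w)\<^sup>2 + 1) / (2 * Im w) < C"
        using less_cSup_iff[OF _ bdd] Q0 by blast
      then show "w \<in> (\<Union>C\<in>Q. odisc C)" using mem_odisc_iff[OF I] by blast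
    qed
    moreover have "\<exists>f. liso F (\<Union>C\<in>Q. odisc C) f \<and> (\<forall>z\<in>odisc C0. f z = f0 z)"
      by (rule glue[OF Q0]) (simp_all add: Q_def)
    then obtain f where f: "liso F (\<Union>C\<in>Q. odisc C) f" "\<forall>z\<in>odisc C0. f z = f0 z" by (elim exE conjE)
    ultimately have fs: "liso F (odisc s) f" using liso_subset[OF f(1), of "odisc s" f] by simp
    have s1: "s > 1" using s C0 by simp
    have "\<exists>V h. open V \<and> closure (odisc s) \<subseteq> V \<and> V \<subseteq> uhp \<and> liso F V h \<and> (\<forall>z\<in>odisc s. h z = f z)"
      by (rule liso_extend_closure[OF fs open_odisc convex_odisc[OF s1] _ _, of "1 / (2 * s)"])
         (use s1 odisc_uhp disc_Im(1)[of s] subsetD[OF odisc_subset_cdisc] in auto)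
    then obtain V h where V: "open V" "cdisc s \<subseteq> V" "liso F V h" "\<forall>z\<in>odisc s. h z = f z"
      using closure_odisc[OF s1] by auto
    obtain C' where C': "C' > s" "odisc C' \<subseteq> V" using larger_odisc[OF _ V(1,2)] s1 by auto
    have "liso F (odisc C') h" using liso_subset[OF V(3) C'(2)] by simp
    moreover have "\<forall>z\<in>odisc C0. h z = f0 z" using V(4) f(2) odisc_mono[of C0 s] s C0 by auto
    ultimately have "C' \<in> Q" using s C' by (auto simp: Q_def Ext_def)
    then have "C' \<le> s" unfolding s_def by (rule cSup_upper[OF _ bdd])
    then show False using C' by simp
  qed
  have "\<exists>f. liso F (\<Union>C\<in>{C0..}. odisc C) f \<and> (\<forall>z\<in>odisc C0. f z = f0 z)"
    by (rule glue) (use all in \<open>simp_all add: Q_def\<close>)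
  then obtain N where N: "liso F (\<Union>C\<in>{C0..}. odisc C) N" "\<forall>z\<in>odisc C0. N z = f0 z" by (elim exE conjE)
  have "uhp \<subseteq> (\<Union>C\<in>{C0..}. odisc C)"
  proof
    fix w assume "w \<in> uhp"
    then have I: "Im w > 0" by (simp add: uhp_def)
    define C where "C = max C0 (((cmod w)\<^sup>2 + 1) / (2 * Im w) + 1)"
    have "w \<in> odisc C" using mem_odisc_iff[OF I] by (simp add: C_def)
    then show "w \<in> (\<Union>C\<in>{C0..}. odisc C)" by (auto simp: C_def)
  qed
  then have "liso F uhp N" using liso_subset[OF N(1)] by simp
  then show ?thesis using N(2) by blast
qed

theorem liso_extension:
  assumes f: "liso F V f" and V: "open V" "connected V" "V \<subseteq> uhp" "V \<noteq> {}"
  shows "\<exists>N. liso F uhp N \<and> (\<forall>z\<in>V. N z = f z)"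
proof -
  obtain x where x: "x \<in> V" using V by blast
  have p: "Im x > 0" using x V by (auto simp: uhp_def)
  define a where "a w = of_real (Im x) * w + of_real (Re x)" for w :: complex
  have a: "isom a" "a \<i> = x" unfolding a_def using p by (auto intro: isom_affine simp: complex_eq_iff)
  obtain a' where a': "isom a'" "\<forall>z\<in>uhp. a' (a z) = z \<and> a (a' z) = z" using isom_inverse[OF a(1)] by blast
  have iu: "\<i> \<in> uhp" by (simp add: uhp_def)
  obtain e where e: "e > 0" "ball \<i> e \<subseteq> uhp" "a ` ball \<i> e \<subseteq> V"
    using isom_nhd[OF a(1) iu V(1)] a(2) x by auto
  \<comment> \<open>\<open>cdisc 1\<close> is the single point \<i>, so \<open>larger_odisc\<close>
    produces a disc of positive radius inside the ball.\<close>
  have "cdisc 1 \<subseteq> ball \<i> e" using cdisc_cball[of 1] e by simp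
  then obtain C where C: "C > 1" "odisc C \<subseteq> ball \<i> e" using larger_odisc[of 1 "ball \<i> e"] by auto
  have fa: "liso F (odisc C) (\<lambda>z. f (a z))"
    by (rule liso_comp[OF f a(1)]) (use C e V(3) in blast)+
  obtain N where N: "liso F uhp N" "\<forall>z\<in>odisc C. N z = f (a z)" using extend_from_disc[OF C(1) fa] by blast
  have N': "liso F uhp (\<lambda>z. N (a' z))"
    by (rule liso_comp[OF N(1) a'(1)]) (use isom_in_uhp[OF a'(1)] in auto)
  have a'x: "a' x \<in> odisc C" using a' a(2) iu C by (auto simp: odisc_def simp flip: a(2))
  have xu: "x \<in> uhp" using x V by auto
  obtain k where k: "k > 0" "ball x k \<subseteq> uhp" "a' ` ball x k \<subseteq> odisc C"
    using isom_nhd[OF a'(1) xu open_odisc a'x] by blast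
  have "N (a' z) = f z" if z: "z \<in> V" for z
  proof (rule liso_unique[OF V(1,3,2) _ f _ _ _ _ z])
    show "liso F V (\<lambda>z. N (a' z))" by (rule liso_subset[OF N' V(3)]) simp
    show "N (a' z) = f z" if "z \<in> ball x k \<inter> V" for z
    proof -
      have "a' z \<in> odisc C" "z \<in> uhp" using that k by blast+
      then show ?thesis using N(2) a'(2) by simp
    qed
    show "x \<in> ball x k \<inter> V" using x k(1) by simp
  qed (use V in auto)
  with N' show ?thesis by blast
qed

text \<open>The local transition isometry is defined on the whole half-plane, so the identity
  principle spreads the relation from a small ball. For P = N this produces deck transformations;
  for P the lift of a cusp it compares N with that cusp.\<close>

lemma global_transition:
  assumes N: "liso F uhp N" and P: "liso F uhp P" and x: "x \<in> uhp" "y \<in> uhp" "N x = P y"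
  shows "\<exists>m. isom m \<and> m x = y \<and> (\<forall>z\<in>uhp. P (m z) = N z)"
proof -
  have "P y = N x" using x by simp
  then obtain m e where m: "isom m" "m x = y" "e > 0" "ball x e \<subseteq> uhp" "\<forall>z\<in>ball x e. m z \<in> uhp \<and> N z = P (m z)"
    using transition[OF P open_uhp order_refl x(2) N open_uhp order_refl x(1)] by blast
  have Pm: "liso F uhp (\<lambda>z. P (m z))"
    by (rule liso_comp[OF P m(1)]) (use isom_in_uhp[OF m(1)] in auto)
  have "P (m z) = N z" if "z \<in> uhp" for z
    by (rule liso_unique[OF open_uhp order_refl convex_connected[OF convex_uhp] Pm N open_ball _ m(4) _ that, of x])
       (use m in auto)
  then show ?thesis using m by blast
qed

lemma deck_free:
  assumes N: "liso F uhp N" and m: "isom m" "\<forall>z\<in>uhp. N (m z) = N z" and x: "x \<in> uhp" "m x = x" and z: "z \<in> uhp"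
  shows "m z = z"
proof -
  obtain d where d: "d > 0" "ball x d \<subseteq> uhp" 
      "\<forall>S. open S \<longrightarrow> S \<noteq> {} \<longrightarrow> S \<subseteq> ball x d \<longrightarrow> (\<forall>z\<in>S. N (m z) = N z) \<longrightarrow> (\<forall>z\<in>uhp. m z = z)"
    using stabilizer_trivial[OF N open_uhp order_refl x(1) m(1) x(2)] by (elim exE conjE)
  have "\<forall>z\<in>uhp. m z = z"
  proof (rule d(3)[THEN spec, THEN mp, THEN mp, THEN mp, THEN mp])
    show "\<forall>z\<in>ball x d. N (m z) = N z" using d(2) m(2) by blast
  qed (use d(1) in auto)
  then show ?thesis using z by blast
qed

end

subsection \<open>Deck transformations and cusps\<close>

text \<open>The four forms separate the isometries by orientation and by whether they fix infinity.
  When the coefficient c is not 0, s = a / c is the image of infinity, s' = - d / c its preimage,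
  and \<open>\<rho>\<close> is the absolute value of the determinant over c^2.\<close>

lemma isom_cases:
  assumes "isom m"
  obtains
    (affine) k c where "k > 0" "\<forall>z\<in>uhp. m z = of_real k * z + of_real c"
  | (affine_cnj) k c where "k > 0" "\<forall>z\<in>uhp. m z = of_real c - of_real k * cnj z"
  | (inv) s s' \<rho> where "\<rho> > 0" "\<forall>z\<in>uhp. m z = of_real s - of_real \<rho> / (z - of_real s')"
  | (inv_cnj) s s' \<rho> where "\<rho> > 0" "\<forall>z\<in>uhp. m z = of_real s + of_real \<rho> / (cnj z - of_real s')"
proof -
  obtain a b c d where D: "a * d - b * c \<noteq> 0" "\<And>z. z \<in> uhp \<Longrightarrow> m z = mob a b c d z"
    using assms unfolding isom_def by blast
  show ?thesis
  proof (cases "c = 0")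
    case True
    then have ad: "a * d \<noteq> 0" "d \<noteq> 0" using D by auto
    have l: "lft a b c d z = of_real (a / d) * z + of_real (b / d)" for z
      using True by (simp add: lft_def add_divide_distrib)
    show ?thesis
    proof (cases "a * d > 0")
      case t: True
      then have "a / d > 0" by (simp add: zero_less_mult_iff zero_less_divide_iff)
      moreover have "m z = of_real (a / d) * z + of_real (b / d)" if "z \<in> uhp" for z
        using D(2)[OF that] t True l by (simp add: mob_def)
      ultimately show ?thesis using affine by blast
    next
      case f: False
      then have "- (a / d) > 0" using ad by (simp add: zero_less_mult_iff divide_less_0_iff) linarith
      moreover have "m z = of_real (b / d) - of_real (- (a / d)) * cnj z" if "z \<in> uhp" for z
        using D(2)[OF that] f True l by (simp add: mob_def)
      ultimately show ?thesis using affine_cnj by blast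
    qed
  next
    case False
    define \<rho> where "\<rho> = \<bar>a * d - b * c\<bar> / c\<^sup>2"
    have \<rho>: "\<rho> > 0" using D False by (simp add: \<rho>_def)
    have l: "lft a b c d z = of_real (a / c) - of_real ((a * d - b * c) / c\<^sup>2) / (z - of_real (- d / c))" if "Im z \<noteq> 0" for z
    proof -
      have 1: "of_real c * z + of_real d \<noteq> (0::complex)" by (rule lft_denom_nz[OF D(1) that])
      have 2: "z - of_real (- d / c) = (of_real c * z + of_real d) / of_real c" using False by (simp add: add_divide_distrib)
      have 3: "of_real c \<noteq> (0::complex)" using False by simp
      show ?thesis
        unfolding 2 lft_def using 1 3 by (simp add: divide_simps) (simp add: algebra_simps power2_eq_square)
    qed
    show ?thesis
    proof (cases "a * d - b * c > 0")
      case True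
      then have "m z = of_real (a / c) - of_real \<rho> / (z - of_real (- d / c))" if "z \<in> uhp" for z
        using D(2)[OF that] l[of z] that by (simp add: mob_def \<rho>_def uhp_def)
      then show ?thesis using inv \<rho> by blast
    next
      case f: False
      then have "\<bar>a * d - b * c\<bar> = - (a * d - b * c)" by simp
      then have r: "\<rho> = - ((a * d - b * c) / c\<^sup>2)" unfolding \<rho>_def by (simp only: minus_divide_left)
      have "m z = of_real (a / c) + of_real \<rho> / (cnj z - of_real (- d / c))" if "z \<in> uhp" for z
        using D(2)[OF that] l[of "cnj z"] that f unfolding r by (simp add: mob_def uhp_def)
      then show ?thesis using inv_cnj \<rho> by blast
    qed
  qed
qed

lemma uhp_add_real: "z \<in> uhp \<Longrightarrow> z + of_real t \<in> uhp"
  by (simp add: uhp_def)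

lemma isom_translation: "isom (\<lambda>z. z + of_real t)"
  using isom_affine[of 1 t] by simp

section \<open>Deck transformations, translations and the geometry of a cusp\<close>

context hyp_charts
begin

text \<open>Composing m with the inverse of m' gives a deck transformation with a fixed
  point.\<close>

lemma deck_eq:
  assumes N: "liso F uhp N" and m: "isom m" "\<forall>z\<in>uhp. N (m z) = N z" and m': "isom m'" "\<forall>z\<in>uhp. N (m' z) = N z"
    and x: "x \<in> uhp" "m x = m' x" and z: "z \<in> uhp"
  shows "m z = m' z"
proof -
  obtain k where k: "isom k" "\<forall>z\<in>uhp. k (m' z) = z \<and> m' (k z) = z" using isom_inverse[OF m'(1)] by blast
  have "(k \<circ> m) z = z"
  proof (rule deck_free[OF N isom_comp[OF k(1) m(1)] _ x(1) _ z])
    show "\<forall>z\<in>uhp. N ((k \<circ> m) z) = N z"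
    proof
      fix z assume z: "z \<in> uhp"
      have mz: "m z \<in> uhp" using isom_in_uhp[OF m(1) z] .
      have kz: "k (m z) \<in> uhp" using isom_in_uhp[OF k(1) mz] .
      have "N (k (m z)) = N (m' (k (m z)))" using m'(2) kz by simp
      also have "\<dots> = N z" using k(2) mz m(2) z by simp
      finally show "N ((k \<circ> m) z) = N z" by simp
    qed
    show "(k \<circ> m) x = x" using x k(2) by simp
  qed
  then have "m' (k (m z)) = m' z" by simp
  then show ?thesis using k(2) isom_in_uhp[OF m(1) z] by simp
qed

lemma affine_deck_unit:
  assumes N: "liso F uhp N" and \<tau>: "\<tau> \<noteq> 0" "\<forall>z\<in>uhp. N (z + of_real \<tau>) = N z"
    and k: "k > 0" and m: "\<forall>z\<in>uhp. N (m z) = N z"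
    and aff: "(\<forall>z\<in>uhp. m z = of_real k * z + of_real c) \<or> (\<forall>z\<in>uhp. m z = of_real c - of_real k * cnj z)"
  shows "k = 1"
proof (rule ccontr)
  assume k1: "k \<noteq> 1"
  \<comment> \<open>Conjugation by \<open>m\<close> rescales the translation, so \<open>N\<close> would be invariant under arbitrarily short
    translations.\<close>
  define T where "T = {t. \<forall>z\<in>uhp. N (z + of_real t) = N z}"
  have neg: "- t \<in> T" if "t \<in> T" for t
  proof -
    have "N (z + of_real (- t)) = N z" if "z \<in> uhp" for z
    proof -
      have "N ((z + of_real (- t)) + of_real t) = N (z + of_real (- t))"
        using \<open>t \<in> T\<close> uhp_add_real[OF that, of "- t"] unfolding T_def by blast
      then show ?thesis by simp
    qed
    then show ?thesis unfolding T_def by blast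
  qed
  \<comment> \<open>\<open>\<sigma>\<close> is the orientation sign of m, which conjugates the
    translation by t to the one by \<open>\<sigma> * k * t\<close>; the inverse of m gives the
    factor \<open>\<sigma> * (1 / k)\<close>. The sign is absorbed later because \<open>T\<close> is
    closed under negation.\<close>
  define \<sigma> :: real where "\<sigma> = (if (\<forall>z\<in>uhp. m z = of_real k * z + of_real c) then 1 else - 1)"
  have mt: "m (z + of_real t) = m z + of_real (\<sigma> * k * t)" "m z \<in> uhp" if z: "z \<in> uhp" for z t
  proof -
    have zt: "z + of_real t \<in> uhp" by (rule uhp_add_real[OF z])
    have "m (z + of_real t) = m z + of_real (\<sigma> * k * t) \<and> m z \<in> uhp"
    proof (cases "\<forall>z\<in>uhp. m z = of_real k * z + of_real c")
      case True
      then have s: "\<sigma> = 1" by (simp add: \<sigma>_def)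
      show ?thesis using z k unfolding s bspec[OF True zt] bspec[OF True z] by (simp add: uhp_def algebra_simps)
    next
      case False
      then have s: "\<sigma> = - 1" by (auto simp: \<sigma>_def)
      have F: "\<forall>z\<in>uhp. m z = of_real c - of_real k * cnj z" using aff False by blast
      show ?thesis using z k unfolding s bspec[OF F zt] bspec[OF F z] by (simp add: uhp_def algebra_simps)
    qed
    then show "m (z + of_real t) = m z + of_real (\<sigma> * k * t)" "m z \<in> uhp" by simp_all
  qed
  have \<sigma>: "\<sigma> * \<sigma> = 1" "\<sigma> = 1 \<or> \<sigma> = - 1" by (auto simp: \<sigma>_def)
  have surj: "\<exists>w\<in>uhp. m w = z" if "z \<in> uhp" for z
  proof (cases "\<forall>z\<in>uhp. m z = of_real k * z + of_real c")
    case True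
    have "(z - of_real c) / of_real k \<in> uhp" using that k by (simp add: uhp_def Im_divide_of_real)
    moreover have "m ((z - of_real c) / of_real k) = z" using True calculation k by simp
    ultimately show ?thesis by blast
  next
    case False
    then have F: "\<forall>z\<in>uhp. m z = of_real c - of_real k * cnj z" using aff by blast
    have "(of_real c - cnj z) / of_real k \<in> uhp" using that k by (simp add: uhp_def Im_divide_of_real)
    moreover have "m ((of_real c - cnj z) / of_real k) = z" using F calculation k by simp
    ultimately show ?thesis by blast
  qed
  have up: "\<sigma> * k * t \<in> T" if t: "t \<in> T" for t
  proof -
    have "N (z + of_real (\<sigma> * k * t)) = N z" if z: "z \<in> uhp" for z
    proof -
      obtain w where w: "w \<in> uhp" "m w = z" using surj[OF z] by blast
      have "N (m (w + of_real t)) = N (w + of_real t)" using m uhp_add_real[OF w(1)] by blast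
      also have "\<dots> = N w" using t w by (simp add: T_def)
      also have "\<dots> = N (m w)" using m w(1) by metis
      finally show ?thesis using mt[OF w(1)] w by simp
    qed
    then show ?thesis by (simp add: T_def)
  qed
  have down: "\<sigma> * (1 / k) * t \<in> T" if t: "t \<in> T" for t
  proof -
    have "N (z + of_real (\<sigma> * (1 / k) * t)) = N z" if z: "z \<in> uhp" for z
    proof -
      have e: "\<sigma> * k * (\<sigma> * (1 / k) * t) = t" using \<sigma> k by auto
      have "N (m (z + of_real (\<sigma> * (1 / k) * t))) = N (m z + of_real t)" using mt(1)[OF z, of "\<sigma> * (1 / k) * t"] e by simp
      also have "\<dots> = N (m z)" using t mt(2)[OF z] by (simp add: T_def)
      finally show ?thesis using m z uhp_add_real[OF z] by metis
    qed
    then show ?thesis by (simp add: T_def)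
  qed
  have scale: "r * t \<in> T" if "t \<in> T" "r = k \<or> r = 1 / k" for t r
    using up[OF that(1)] down[OF that(1)] neg that(2) \<sigma>(2) by force
  \<comment> \<open>Whichever of k and 1 / k is below 1 is iterated; the resulting tiny translations
    contradict local injectivity of N at \<i>.\<close>
  define r where "r = (if k < 1 then k else 1 / k)"
  have r: "0 < r" "r < 1" "r = k \<or> r = 1 / k" using k k1 by (auto simp: r_def)
  have pow: "r ^ n * \<tau> \<in> T" for n
  proof (induction n)
    case 0 then show ?case using \<tau> by (simp add: T_def)
  next
    case (Suc n)
    then show ?case using scale[OF Suc r(3)] by (simp add: mult_ac)
  qed
  have iu: "\<i> \<in> uhp" by (simp add: uhp_def)
  obtain e where e: "e > 0" "ball \<i> e \<subseteq> uhp" "inj_on N (ball \<i> e)" using liso_inj_nhd[OF N open_uhp order_refl iu] by blast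
  obtain n where n: "r ^ n < e / \<bar>\<tau>\<bar>" using real_arch_pow_inv[of "e / \<bar>\<tau>\<bar>" r] e r \<tau> by auto
  have "\<bar>r ^ n * \<tau>\<bar> < e" using n \<tau> r by (simp add: abs_mult pos_less_divide_eq)
  then have "\<i> + of_real (r ^ n * \<tau>) \<in> ball \<i> e" by (simp add: dist_norm norm_mult norm_power abs_mult power_abs)
  moreover have "N (\<i> + of_real (r ^ n * \<tau>)) = N \<i>" using pow[of n] iu unfolding T_def by blast
  ultimately have "\<i> + of_real (r ^ n * \<tau>) = \<i>" using inj_onD[OF e(3)] e(1) by (metis centre_in_ball)
  then show False using r \<tau> by simp
qed

text \<open>A quantitative form of openness: the chart about N z covers a metric ball of F, and near
  z the map N is this chart preceded by an isometry, so preimages close to w in the chart can be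
  pulled back close to z.\<close>

lemma liso_open_at:
  assumes N: "liso F uhp N" and z: "z \<in> uhp" and e: "e > 0"
  shows "\<exists>r>0. \<forall>q\<in>F. dist (N z) q < r \<longrightarrow> (\<exists>z'\<in>uhp. cmod (z - z') < e \<and> N z' = q)"
proof -
  obtain r w \<kappa> where c: "is_chart (N z) r w \<kappa>" using ex_chart[OF liso_in[OF N z]] by blast
  have "dist (N z) (N z) < r" using chartD(2)[OF c] by simp
  then obtain m k where m: "isom m" "k > 0" "ball z k \<subseteq> uhp" "\<forall>x\<in>ball z k. udist w (m x) < r \<and> N x = \<kappa> (m x)"
    using liso_in_chart[OF N open_uhp order_refl z c] by blast
  obtain m' where m': "isom m'" "\<forall>z\<in>uhp. m' (m z) = z \<and> m (m' z) = z" using isom_inverse[OF m(1)] by blast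
  have mz: "m z = w"
    using chart_inj[OF c isom_in_uhp[OF m(1) z] _ chartD(3)[OF c] chart_center[OF c]] m(2,4) chartD(4)[OF c] by simp
  obtain d where d: "d > 0" "\<forall>x\<in>uhp. \<forall>y\<in>uhp. Im x \<le> Im z \<longrightarrow> udist x y < d \<longrightarrow> cmod (x - y) < min e k"
    using udist_ball_subset[of "Im z" "min e k"] z e m(2) by (auto simp: uhp_def)
  have "\<exists>z'\<in>uhp. cmod (z - z') < e \<and> N z' = q" if q: "q \<in> F" "dist (N z) q < min r d" for q
  proof -
    obtain v where v: "v \<in> uhp" "udist w v < r" "\<kappa> v = q" using chartD(5)[OF c q(1)] q(2) by auto
    have "udist w v < d"
      using chartD(7)[OF c chartD(3)[OF c] chart_center[OF c] v(1,2)] chartD(4)[OF c] v(3) q(2) by simp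
    define z' where "z' = m' v"
    have z': "z' \<in> uhp" "m z' = v" using isom_in_uhp[OF m'(1) v(1)] m'(2) v(1) by (auto simp: z'_def)
    have "udist z z' < d" using isom_udist[OF m(1) z z'(1)] mz z'(2) \<open>udist w v < d\<close> by simp
    then have "cmod (z - z') < min e k" using d(2) z z'(1) by blast
    moreover from this have "N z' = q" using m(4) z'(2) v(3) by (simp add: dist_norm)
    ultimately show ?thesis using z'(1) by auto
  qed
  then show ?thesis using d(1) chartD(2)[OF c] by (intro exI[of _ "min r d"]) auto
qed

text \<open>High up, w and w + \<tau> are hyperbolically close and have the same image. If N w were
  near N z, a deck transformation would move both into a ball about z on which N is
  injective.\<close>

lemma liso_leaves_neighbourhoods:
  assumes N: "liso F uhp N" and \<tau>: "\<tau> \<noteq> 0" "\<forall>z\<in>uhp. N (z + of_real \<tau>) = N z" and z: "z \<in> uhp"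
  shows "\<exists>r>0. \<exists>Y. \<forall>w\<in>uhp. Y < Im w \<longrightarrow> r \<le> dist (N z) (N w)"
proof -
  obtain e where e: "e > 0" "ball z e \<subseteq> uhp" "inj_on N (ball z e)" using liso_inj_nhd[OF N open_uhp order_refl z] by blast
  obtain r where r: "r > 0" "\<forall>q\<in>F. dist (N z) q < r \<longrightarrow> (\<exists>z'\<in>uhp. cmod (z - z') < e / 2 \<and> N z' = q)"
    using liso_open_at[OF N z, of "e / 2"] e(1) by auto
  obtain d where d: "d > 0" "\<forall>x\<in>uhp. \<forall>y\<in>uhp. Im x \<le> Im z + e \<longrightarrow> udist x y < d \<longrightarrow> cmod (x - y) < e / 2"
    using udist_ball_subset[of "Im z + e" "e / 2"] z e by (auto simp: uhp_def)
  define K where "K = cosh d - 1"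
  have K: "K > 0" using cosh_minus_1_pos[OF d(1)] by (simp add: K_def)
  \<comment> \<open>Above height \<open>Y\<close> one has \<tau>^2 < 2 K (Im w)^2, that is,
    \<open>udist w (w + of_real \<tau>) < d\<close>. The entry 1 guarantees Im w \<le> (Im
    w)^2.\<close>
  define Y where "Y = max 1 (\<tau>\<^sup>2 / (2 * K))"
  have "r \<le> dist (N z) (N w)" if w: "w \<in> uhp" "Y < Im w" for w
  proof (rule ccontr)
    assume "\<not> r \<le> dist (N z) (N w)"
    then obtain z' where z': "z' \<in> uhp" "cmod (z - z') < e / 2" "N z' = N w" using r(2) liso_in[OF N w(1)] by auto
    obtain m where m: "isom m" "m w = z'" "\<forall>z\<in>uhp. N (m z) = N z"
      using global_transition[OF N N w(1) z'(1)] z'(3) by auto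
    have wt: "w + of_real \<tau> \<in> uhp" using uhp_add_real[OF w(1)] .
    have "\<tau>\<^sup>2 < 2 * K * Im w" using w(2) K by (simp add: Y_def pos_divide_less_eq mult_ac)
    also have "\<dots> \<le> 2 * K * (Im w * Im w)" using w(2) K by (simp add: Y_def)
    finally have "udist w (w + of_real \<tau>) < d"
      using udist_less_iff[OF w(1) wt d(1)] by (simp add: K_def[symmetric] mult_ac)
    then have "udist z' (m (w + of_real \<tau>)) < d" using isom_udist[OF m(1) w(1) wt] m(2) by simp
    moreover have "Im z' \<le> Im z + e" using abs_Im_le_cmod[of "z - z'"] z'(2) by simp
    ultimately have "cmod (z' - m (w + of_real \<tau>)) < e / 2" using d(2) z'(1) isom_in_uhp[OF m(1) wt] by blast
    then have "dist z (m (w + of_real \<tau>)) < e"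
      using dist_triangle_half_r[of z' z e "m (w + of_real \<tau>)"] z'(2) by (simp add: dist_norm norm_minus_commute)
    moreover have "N (m (w + of_real \<tau>)) = N z'" using m(3) wt \<tau>(2) w(1) z'(3) by simp
    moreover have "z' \<in> ball z e" using z'(2) e(1) by (simp add: dist_norm)
    ultimately have "m (w + of_real \<tau>) = m w" using inj_onD[OF e(3)] m(2) by simp
    then have "w + of_real \<tau> = w" using isom_inj[OF m(1) wt w(1)] by simp
    then show False using \<tau>(1) by simp
  qed
  then show ?thesis using r(1) by blast
qed

text \<open>The lift P of the cusp is periodic with period \<open>\<tau>\<close>. The isometry
  \<open>\<delta>\<close> from N to P carries the whole ray into the half-plane of the cusp and must
  therefore fix infinity; being affine, it turns the period of P into a period of N.\<close>

lemma cusp_translation: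
  assumes N: "liso F uhp N" and h0: "h0 > 0" and p: "liso F {z. h0 < Im z} p" and \<tau>: "\<tau> \<noteq> 0"
    and id: "\<And>x y. h0 < Im x \<Longrightarrow> h0 < Im y \<Longrightarrow> p x = p y \<longleftrightarrow> (\<exists>n::nat. y = x + of_real (of_nat n * \<tau>) \<or> x = y + of_real (of_nat n * \<tau>))"
    and ray: "\<And>y. y > h \<Longrightarrow> N (Complex \<rho>0 y) \<in> p ` {z. h0 < Im z}" and h: "h \<ge> 0"
  shows "\<exists>\<tau>'. \<tau>' \<noteq> 0 \<and> (\<forall>z\<in>uhp. N (z + of_real \<tau>') = N z)"
proof -
  define B where "B = {z. h0 < Im z}"
  have B: "open B" "B \<subseteq> uhp" "convex B" "B \<noteq> {}"
    using h0 unfolding B_def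
    by (auto intro!: open_Collect_less continuous_intros convex_halfspace_Im_gt simp: uhp_def intro: exI[of _ "Complex 0 (h0 + 1)"])
  obtain P where P: "liso F uhp P" "\<forall>z\<in>B. P z = p z"
    using liso_extension[OF p[folded B_def] B(1) convex_connected[OF B(3)] B(2,4)] by blast
  have tau: "P (z + of_real \<tau>) = P z" if "z \<in> uhp" for z
  proof (rule liso_unique[OF open_uhp order_refl convex_connected[OF convex_uhp] _ P(1) B(1) _ B(2) _ that])
    show "liso F uhp (\<lambda>z. P (z + of_real \<tau>))"
      by (rule liso_comp[OF P(1) isom_translation]) (auto simp: uhp_def)
    show "Complex 0 (h0 + 1) \<in> B" by (simp add: B_def)
    fix z assume z: "z \<in> B"
    then have "z + of_real \<tau> \<in> B" by (simp add: B_def)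
    moreover have "p z = p (z + of_real \<tau>)" using z by (subst id) (auto simp: B_def intro: exI[of _ "1::nat"])
    ultimately show "P (z + of_real \<tau>) = P z" using P(2) z by simp
  qed
  have taun: "P (z + of_real (of_nat n * \<tau>)) = P z" "P (z + of_real (- (of_nat n * \<tau>))) = P z" if "z \<in> uhp" for z n
  proof -
    have *: "P (z + of_real (of_nat n * \<tau>)) = P z" if "z \<in> uhp" for z
    proof (induction n)
      case (Suc n)
      have e: "z + of_real (of_nat (Suc n) * \<tau>) = (z + of_real (of_nat n * \<tau>)) + of_real \<tau>" by (simp add: algebra_simps)
      show ?case unfolding e using tau[OF uhp_add_real[OF that, of "of_nat n * \<tau>"]] Suc by simp
    qed simp
    show "P (z + of_real (of_nat n * \<tau>)) = P z" by (rule *[OF that])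
    show "P (z + of_real (- (of_nat n * \<tau>))) = P z" using *[OF uhp_add_real[OF that, of "- (of_nat n * \<tau>)"]] by simp
  qed
  define R where "R = {z. Re z = \<rho>0 \<and> h < Im z}"
  have R: "R \<subseteq> uhp" using h by (auto simp: R_def uhp_def)
  have "R = {z. Re z = \<rho>0} \<inter> {z. h < Im z}" by (auto simp: R_def)
  moreover have "convex {z. Re z = \<rho>0}" by (auto simp: convex_alt) (simp add: algebra_simps)
  ultimately have Rc: "connected R" by (simp add: convex_connected convex_Int convex_halfspace_Im_gt)
  have NR: "N z \<in> p ` B" if "z \<in> R" for z
    using ray[of "Im z"] that complex_surj[of z] by (auto simp: R_def B_def)
  define z0 where "z0 = Complex \<rho>0 (h + 1)"
  have z0: "z0 \<in> R" "z0 \<in> uhp" using h by (auto simp: z0_def R_def uhp_def)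
  obtain w0 where w0: "w0 \<in> B" "N z0 = p w0" using NR[OF z0(1)] by blast
  obtain \<delta> where \<delta>: "isom \<delta>" "\<delta> z0 = w0" "\<forall>z\<in>uhp. P (\<delta> z) = N z"
    using global_transition[OF N P(1) z0(2), of w0] w0 P(2) B(2) by auto
  have c\<delta>: "continuous_on uhp \<delta>" by (rule continuous_on_isom[OF \<delta>(1)])
  \<comment> \<open>\<open>A\<close> and \<open>A'\<close> separate the part of the ray carried into \<open>B\<close> from the part carried into other
    lifts of the cusp.\<close>
  define A where "A = uhp \<inter> \<delta> -` B"
  define D where "D = {\<eta>. isom \<eta> \<and> (\<forall>z\<in>uhp. P (\<eta> z) = P z) \<and> (\<exists>v\<in>uhp. v \<notin> B \<and> \<eta> v \<in> B)}"
  define A' where "A' = (\<Union>\<eta>\<in>D. uhp \<inter> (\<eta> \<circ> \<delta>) -` B)"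
  have oA: "open A" unfolding A_def by (rule continuous_open_preimage[OF c\<delta> open_uhp B(1)])
  have oA': "open A'"
    unfolding A'_def
  proof (intro open_UN ballI)
    fix \<eta> assume "\<eta> \<in> D"
    then have "isom (\<eta> \<circ> \<delta>)" using isom_comp \<delta>(1) by (auto simp: D_def)
    then show "open (uhp \<inter> (\<eta> \<circ> \<delta>) -` B)" by (intro continuous_open_preimage continuous_on_isom open_uhp B)
  qed
  \<comment> \<open>If \<open>\<eta>\<close> moves a point of B within B, then p identifies the two
    points, so \<open>\<eta>\<close> agrees there with a translation. By \<open>deck_eq\<close> it
    is this translation and preserves heights, so it cannot bring a point v from outside into
    B.\<close>
  have disj: "A \<inter> A' \<inter> R = {}"
  proof (rule ccontr)
    assume "A \<inter> A' \<inter> R \<noteq> {}"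
    then obtain z \<eta> where z: "z \<in> uhp" "\<delta> z \<in> B" and \<eta>D: "\<eta> \<in> D" and \<eta>B: "\<eta> (\<delta> z) \<in> B" by (auto simp: A_def A'_def)
    have \<eta>: "isom \<eta>" "\<forall>z\<in>uhp. P (\<eta> z) = P z" using \<eta>D by (auto simp: D_def)
    obtain v where v: "v \<in> uhp" "v \<notin> B" "\<eta> v \<in> B" using \<eta>D by (auto simp: D_def)
    have du: "\<delta> z \<in> uhp" using isom_in_uhp[OF \<delta>(1) z(1)] .
    have "p (\<delta> z) = p (\<eta> (\<delta> z))" using P(2) z(2) \<eta>B \<eta>(2) du by metis
    then obtain n :: nat where "\<eta> (\<delta> z) = \<delta> z + of_real (of_nat n * \<tau>) \<or> \<delta> z = \<eta> (\<delta> z) + of_real (of_nat n * \<tau>)"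
      using id[of "\<delta> z" "\<eta> (\<delta> z)"] z(2) \<eta>B by (auto simp: B_def)
    then have "\<eta> (\<delta> z) = \<delta> z + of_real (of_nat n * \<tau>) \<or> \<eta> (\<delta> z) = \<delta> z + of_real (- (of_nat n * \<tau>))" by (auto simp: algebra_simps)
    then obtain t where t: "\<eta> (\<delta> z) = \<delta> z + of_real t" "\<forall>x\<in>uhp. P (x + of_real t) = P x" using taun by blast
    have "\<eta> v = v + of_real t"
      by (rule deck_eq[OF P(1) \<eta> isom_translation t(2) du t(1) v(1)])
    then show False using v by (simp add: B_def)
  qed
  have cover: "R \<subseteq> A \<union> A'"
  proof
    fix z assume z: "z \<in> R"
    have zu: "z \<in> uhp" using z R by blast
    have du: "\<delta> z \<in> uhp" using isom_in_uhp[OF \<delta>(1) zu] .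
    show "z \<in> A \<union> A'"
    proof (cases "\<delta> z \<in> B")
      case True then show ?thesis using zu by (simp add: A_def)
    next
      case False
      obtain w where w: "w \<in> B" "N z = p w" using NR[OF z] by blast
      have "P (\<delta> z) = P w" using w P(2) \<delta>(3) zu by simp
      then obtain \<eta> where "isom \<eta>" "\<eta> (\<delta> z) = w" "\<forall>z\<in>uhp. P (\<eta> z) = P z"
        using global_transition[OF P(1) P(1) du, of w] w B(2) by blast
      then have "\<eta> \<in> D" "\<eta> (\<delta> z) \<in> B" using False du w by (auto simp: D_def)
      then show ?thesis using zu by (auto simp: A'_def)
    qed
  qed
  have "z0 \<in> A" using z0 w0 \<delta>(2) by (simp add: A_def)
  then have "A' \<inter> R = {}" using connectedD[OF Rc oA oA' disj cover] z0(1) by blast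
  then have RA: "R \<subseteq> A" using cover by blast
  have conc: ?thesis if "k > 0" "\<sigma> = 1 \<or> \<sigma> = - 1" "\<And>z. z \<in> uhp \<Longrightarrow> \<delta> (z + of_real (\<sigma> * \<tau> / k)) = \<delta> z + of_real \<tau>" for k \<sigma>
  proof (intro exI conjI ballI)
    show "\<sigma> * \<tau> / k \<noteq> 0" using that \<tau> by auto
    fix z assume z: "z \<in> uhp"
    have "N (z + of_real (\<sigma> * \<tau> / k)) = P (\<delta> (z + of_real (\<sigma> * \<tau> / k)))" using \<delta>(3) uhp_add_real[OF z] by metis
    also have "\<dots> = P (\<delta> z)" using that(3)[OF z] tau isom_in_uhp[OF \<delta>(1) z] by simp
    also have "\<dots> = N z" using \<delta>(3) z by simp
    finally show "N (z + of_real (\<sigma> * \<tau> / k)) = N z" .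
  qed
  \<comment> \<open>An isometry not fixing infinity satisfies this height bound, so it would push
    the high points of the ray below \<open>h0\<close>.\<close>
  have deep: False if \<rho>: "\<rho> > 0" and i: "\<And>z. z \<in> uhp \<Longrightarrow> Im (\<delta> z) \<le> \<rho> / Im z" for \<rho>
  proof -
    define y where "y = max (h + 1) (\<rho> / h0)"
    have y: "y > h" "y > 0" "y \<ge> \<rho> / h0" using h by (auto simp: y_def)
    then have "Complex \<rho>0 y \<in> A" using RA by (auto simp: R_def)
    then have "h0 < Im (\<delta> (Complex \<rho>0 y))" "Complex \<rho>0 y \<in> uhp" by (auto simp: A_def B_def)
    moreover have "\<rho> / y \<le> h0" using y h0 \<rho> by (simp add: field_simps)
    ultimately show False using i[of "Complex \<rho>0 y"] by simp
  qed
  have bound: "\<rho> * Im z / (cmod (z - of_real s))\<^sup>2 \<le> \<rho> / Im z" if "z \<in> uhp" "\<rho> > 0" for \<rho> z s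
  proof -
    have I: "Im z > 0" using that by (simp add: uhp_def)
    have "\<rho> * Im z / (cmod (z - of_real s))\<^sup>2 \<le> \<rho> * Im z / (Im z)\<^sup>2"
      using I that by (intro divide_left_mono) (auto simp: cmod_power2 intro!: mult_pos_pos add_nonneg_pos)
    also have "\<dots> = \<rho> / Im z" using I by (simp add: power2_eq_square)
    finally show ?thesis .
  qed
  show ?thesis
  proof (cases rule: isom_cases[OF \<delta>(1)])
    case (1 k c)
    have "\<delta> (z + of_real (1 * \<tau> / k)) = \<delta> z + of_real \<tau>" if z: "z \<in> uhp" for z
      unfolding bspec[OF 1(2) z] bspec[OF 1(2) uhp_add_real[OF z]] using 1(1) by (simp add: distrib_left)
    then show ?thesis by (rule conc[OF 1(1) disjI1[OF refl]])
  next
    case (2 k c)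
    have "\<delta> (z + of_real (- 1 * \<tau> / k)) = \<delta> z + of_real \<tau>" if z: "z \<in> uhp" for z
      unfolding bspec[OF 2(2) z] bspec[OF 2(2) uhp_add_real[OF z]] using 2(1) by (simp add: right_diff_distrib)
    then show ?thesis by (rule conc[OF 2(1) disjI2[OF refl]])
  next
    case (3 s s' \<rho>)
    have "Im (\<delta> z) \<le> \<rho> / Im z" if "z \<in> uhp" for z
      using 3 that bound[OF that, of \<rho> s'] by (simp add: Im_divide cmod_power2)
    then show ?thesis using deep 3 by blast
  next
    case (4 s s' \<rho>)
    have "Im (\<delta> z) \<le> \<rho> / Im z" if "z \<in> uhp" for z
      using 4 that bound[OF that, of \<rho> s'] by (simp add: Im_divide cmod_power2)
    then show ?thesis using deep 4 by blast
  qed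
qed

end

subsection \<open>Crossing inequalities\<close>

text \<open>The data are those of an isometry \<open>m z = s - \<rho> / (z - s')\<close> with \<open>m (n + \<i> y1) = n + \<i> y2\<close>,
  where \<open>X = y1\<^sup>2\<close> and \<open>Y = y2\<^sup>2\<close>. The hypotheses \<open>c0\<close> and \<open>c1\<close> say that \<open>m\<close> does not carry the
  vertical lines over 0 and 1 to lines crossing them, and \<open>hyp\<close> that \<open>m\<close> has no fixed point.\<close>

lemma crossing_preserving:
  fixes n s s' \<rho> X Y :: real
  assumes n: "0 < n" "n < 1" and s: "s < n" "n < s'" 
    and X: "n * (1 - n) \<le> X" and e1: "((n - s')\<^sup>2 + X) * (n - s) = \<rho> * (s' - n)"
    and Y: "n * (1 - n) \<le> Y" and e2: "((n - s)\<^sup>2 + Y) * (s' - n) = \<rho> * (n - s)"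
    and c0: "s * s' \<ge> 0 \<or> - (s * s') \<ge> \<rho>"
    and c1: "(1 - s) * (1 - s') \<ge> 0 \<or> - ((1 - s) * (1 - s')) \<ge> \<rho>"
    and hyp: "4 * \<rho> \<le> (s' - s)\<^sup>2"
  shows False
proof -
  define u u' m where "u = n - s" and "u' = s' - n" and "m = 1 - n"
  have p: "u > 0" "u' > 0" "m > 0" using s n by (auto simp: u_def u'_def m_def)
  have eq: "n - s' = - u'" "n - s = u" "s' - n = u'" "s = n - u" "s' = n + u'" "1 - s = m + u" "1 - s' = m - u'" "1 - (n - u) = m + u" "1 - (n + u') = m - u'" "1 - n = m" "n + m = 1"
    by (auto simp: u_def u'_def m_def)
  have nm: "n * m > 0" using n p by simp
  have "(u'\<^sup>2 + n * m) * u \<le> (u'\<^sup>2 + X) * u" "(u\<^sup>2 + n * m) * u' \<le> (u\<^sup>2 + Y) * u'" 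
    using X Y p eq by (auto intro!: mult_right_mono)
  then have E1: "(u'\<^sup>2 + n * m) * u \<le> \<rho> * u'" and E2: "(u\<^sup>2 + n * m) * u' \<le> \<rho> * u"
    using e1 e2 unfolding eq by auto
  have "\<rho> * u' > 0" using E1 p nm by (smt (verit) mult_pos_pos zero_le_power2)
  then have r: "\<rho> > 0" using p by (simp add: zero_less_mult_iff)
  \<comment> \<open>\<open>L1\<close> and \<open>L2\<close> are lower bounds for \<rho> with a free
    slope a, to be chosen in each case; the restriction on a comes from the height n m of the side
    from 0 to 1.\<close>
  have L1: "u * u' + a * u \<le> \<rho>" if "a * u' \<le> n * m" for a
  proof -
    have "(u'\<^sup>2 + a * u') * u \<le> \<rho> * u'" using E1 mult_right_mono[OF that, of u] p unfolding distrib_right by linarith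
    then have "(u * u' + a * u) * u' \<le> \<rho> * u'" by (simp add: algebra_simps power2_eq_square)
    then show ?thesis using p by simp
  qed
  have L2: "u * u' + a * u' \<le> \<rho>" if "a * u \<le> n * m" for a
  proof -
    have "(u\<^sup>2 + a * u) * u' \<le> \<rho> * u" using E2 mult_right_mono[OF that, of u'] p unfolding distrib_right by linarith
    then have "(u * u' + a * u') * u \<le> \<rho> * u" by (simp add: algebra_simps power2_eq_square)
    then show ?thesis using p by simp
  qed
  have c1': "(m + u) * (m - u') \<ge> 0 \<or> - ((m + u) * (m - u')) \<ge> \<rho>" using c1 unfolding eq(6,7) .
  \<comment> \<open>\<open>u \<le> n\<close> means s \<ge> 0 and \<open>u' \<le> m\<close> means s'
    \<le> 1. With both s and s' in [0, 1] the absence of fixed points decides; otherwise the line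
    over 0 or the line over 1 does, or both together.\<close>
  consider "u \<le> n" "u' \<le> m" | "u > n" "u' \<le> m" | "u \<le> n" "u' > m" | "u > n" "u' > m" by linarith
  then show False
  proof cases
    case 1
    then have "u * u' \<le> n * m" using p n by (intro mult_mono) auto
    then have "u * u' + u * u \<le> \<rho>" "u * u' + u' * u' \<le> \<rho>" using L1[of u] L2[of u'] by (auto simp: mult_ac)
    moreover have "4 * \<rho> \<le> (u + u')\<^sup>2" using hyp by (simp add: eq add.commute)
    ultimately have "(u + u')\<^sup>2 \<le> 0" by (simp add: power2_eq_square algebra_simps)
    then show False using p by simp
  next
    case 2
    have "s * s' < 0" using 2 n p eq by (simp add: mult_neg_pos)
    then have "\<rho> \<le> (u - n) * (n + u')" using c0 by (auto simp: eq algebra_simps)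
    moreover have "u * u' + n * u \<le> \<rho>" by (rule L1) (use 2 n in simp)
    moreover have "n * n > 0" "n * u' > 0" using n p by auto
    ultimately show False by (simp add: algebra_simps)
  next
    case 3
    have "(m + u) * (m - u') < 0" using 3 n p eq by (simp add: mult_pos_neg)
    then have "\<rho> \<le> (m + u) * (u' - m)" using c1' by (auto simp: algebra_simps)
    moreover have "u * u' + m * u' \<le> \<rho>" by (rule L2) (use 3 p in simp)
    moreover have "m * m > 0" "m * u > 0" using p by auto
    ultimately show False by (simp add: algebra_simps)
  next
    case 4
    have "s * s' < 0" using 4 n p eq by (simp add: mult_neg_pos)
    then have A: "\<rho> \<le> (u - n) * (n + u')" using c0 by (auto simp: eq algebra_simps)
    have "(m + u) * (m - u') < 0" using 4 n p eq by (simp add: mult_pos_neg)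
    then have B: "\<rho> \<le> (m + u) * (u' - m)" using c1' by (auto simp: algebra_simps)
    \<comment> \<open>The larger of u and u' fixes the slope n m / u or n m / u'. The condition at
      the vertex 1 or 0, respectively, then makes the smaller one exceed the larger one by
      1.\<close>
    show False
    proof (cases "u' \<le> u")
      case True
      have "u * u' + n * m \<le> \<rho>" using L1[of "n * m / u"] mult_left_mono[OF True, of "n * m"] p nm by (simp add: pos_divide_le_eq)
      then have "m * (n + m + u) \<le> m * u'" using B by (simp add: algebra_simps)
      then show False using p n True by (simp add: mult_le_cancel_left_pos)
    next
      case False
      have "u * u' + n * m \<le> \<rho>" using L2[of "n * m / u'"] mult_left_mono[of u u' "n * m"] False p nm by (simp add: pos_divide_le_eq)
      then have "n * (n + m + u') \<le> n * u" using A by (simp add: algebra_simps)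
      then show False using p n False by (simp add: mult_le_cancel_left_pos)
    qed
  qed
qed

text \<open>The corresponding statement for \<open>m z = s + \<rho> / (cnj z - s')\<close>. Here \<open>c1\<close> comes from the
  line over 1 and its image under \<open>m \<circ> m\<close>.\<close>

lemma crossing_reversing:
  fixes n s s' \<rho> X :: real
  assumes n: "0 < n" "n < 1" and s: "s < s'" "s' < n" 
    and X: "n * (1 - n) \<le> X" and e1: "((n - s')\<^sup>2 + X) * (n - s) = \<rho> * (n - s')"
    and c0: "s * s' \<le> 0 \<or> s * s' \<ge> \<rho>"
    and c1: "\<rho> \<le> (s' - s) * (1 - s')"
  shows False
proof -
  define u u' m where "u = n - s" and "u' = n - s'" and "m = 1 - n"
  have p: "u > 0" "u' > 0" "m > 0" using s n by (auto simp: u_def u'_def m_def)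
  have eq: "n - s' = u'" "n - s = u" "s = n - u" "s' = n - u'" "s' - s = u - u'" "1 - s' = m + u'" "1 - (n - u') = m + u'" "1 - n = m"
    by (auto simp: u_def u'_def m_def)
  have nm: "n * m > 0" using n p by simp
  have "(u'\<^sup>2 + n * m) * u \<le> (u'\<^sup>2 + X) * u" using X p eq by (auto intro!: mult_right_mono)
  then have E1: "(u'\<^sup>2 + n * m) * u \<le> \<rho> * u'" using e1 unfolding eq by auto
  \<comment> \<open>\<open>u' \<le> n\<close> means s' \<ge> 0, and then \<open>c1\<close>
    contradicts E1. Otherwise s and s' are both negative and the line over 0 gives \<rho> \<le> s s'
    \<le> u u', while E1 gives u u' < \<rho>.\<close>
  show False
  proof (cases "u' \<le> n")
    case True
    have "\<rho> * u' \<le> (u - u') * (m + u') * u'" using c1 p unfolding eq by (intro mult_right_mono) auto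
    moreover have "u' * (m * u) \<le> n * (m * u)" using True p by (intro mult_right_mono) auto
    moreover have "m * (u' * u') > 0" "u' * (u' * u') > 0" using p by auto
    ultimately show False using E1 by (simp add: algebra_simps power2_eq_square)
  next
    case False
    then have "u > n" using s eq by linarith
    then have "s * s' > 0" using False eq by (simp add: mult_neg_neg)
    then have "\<rho> \<le> (u - n) * (u' - n)" using c0 by (auto simp: eq algebra_simps)
    moreover have "u'\<^sup>2 * u < \<rho> * u'" using E1 nm p mult_pos_pos[OF nm p(1)] by (simp add: algebra_simps)
    then have "u * u' < \<rho>" using p by (simp add: power2_eq_square mult.commute)
    moreover have "(u - n) * (u' - n) \<le> u * u'" using False \<open>u > n\<close> n p by (intro mult_mono) auto
    ultimately show False by linarith
  qed
qed

text \<open>Here Q = |x - s'|^2 for x at height y1 over n, and its image at height y2 satisfies |m x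
  - s| |x - s'| = |\<rho>|. This converts the equation for m into the one for its inverse, with s
  and s' exchanged. The sign of \<rho> is left open to serve both normal forms.\<close>

lemma crossing_equation_sym:
  fixes n s s' \<rho> y1 y2 Q :: real
  assumes Q_def: "Q = (n - s')\<^sup>2 + y1\<^sup>2" and Q: "Q > 0" and \<rho>: "\<rho> \<noteq> 0"
    and e1: "Q * (n - s) = \<rho> * (n - s')" and im: "(Q * y2)\<^sup>2 = (\<rho> * y1)\<^sup>2"
  shows "((n - s)\<^sup>2 + y2\<^sup>2) * (n - s') = \<rho> * (n - s)"
proof -
  have "((n - s)\<^sup>2 + y2\<^sup>2) * Q\<^sup>2 = (Q * (n - s))\<^sup>2 + (Q * y2)\<^sup>2"
    by (simp add: power_mult_distrib distrib_left mult.commute)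
  also have "\<dots> = \<rho>\<^sup>2 * Q" unfolding e1 im by (simp add: Q_def power_mult_distrib distrib_left)
  finally have q2: "((n - s)\<^sup>2 + y2\<^sup>2) * Q = \<rho>\<^sup>2" using Q by (simp add: power2_eq_square)
  have "(((n - s)\<^sup>2 + y2\<^sup>2) * (n - s')) * (\<rho> * Q) = (((n - s)\<^sup>2 + y2\<^sup>2) * Q) * (Q * (n - s))"
    unfolding e1 by (simp add: mult_ac)
  also have "\<dots> = (\<rho> * (n - s)) * (\<rho> * Q)" unfolding q2 by (simp add: power2_eq_square mult_ac)
  finally show ?thesis using \<rho> Q by simp
qed

text \<open>Equating the real part with v and solving for the height gives h^2 = \<open>Q\<close>;
  the hypotheses are what makes \<open>Q\<close> positive. They say that v separates s from s' and
  also s from the image of v.\<close>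

lemma cross_vertical_preserving:
  fixes s s' \<rho> v :: real
  assumes "(v - s) * (v - s') < 0" "- ((v - s) * (v - s')) < \<rho>"
  shows "\<exists>h>0. Re (of_real s - of_real \<rho> / (Complex v h - of_real s')) = v"
proof -
  define \<sigma> \<sigma>' where "\<sigma> = s - v" and "\<sigma>' = s' - v"
  have p: "\<sigma> * \<sigma>' < 0" "- (\<sigma> * \<sigma>') < \<rho>" using assms by (auto simp: \<sigma>_def \<sigma>'_def algebra_simps)
  then have nz: "\<sigma> \<noteq> 0" "\<sigma>' \<noteq> 0" by auto
  define Q where "Q = (- \<sigma>' / \<sigma>) * (\<rho> + \<sigma> * \<sigma>')"
  have "- \<sigma>' / \<sigma> > 0" using p(1) by (auto simp: mult_less_0_iff divide_less_0_iff)
  then have Q: "Q > 0" unfolding Q_def using p(2) by (intro mult_pos_pos) auto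
  have e: "\<sigma>'\<^sup>2 + Q = - \<rho> * \<sigma>' / \<sigma>" using nz by (simp add: Q_def field_simps power2_eq_square)
  have "Re (of_real s - of_real \<rho> / (Complex v (sqrt Q) - of_real s')) = s + \<rho> * \<sigma>' / (\<sigma>'\<^sup>2 + Q)"
    using Q by (simp add: Re_divide \<sigma>'_def power2_commute[of v s'] diff_divide_distrib algebra_simps)
  also have "\<dots> = s - \<sigma>" unfolding e using nz p by (simp add: field_simps)
  finally show ?thesis using Q by (intro exI[of _ "sqrt Q"]) (simp add: \<sigma>_def)
qed

text \<open>The same equation with the sign of \<rho> changed, so that now s and s' lie on the same
  side of v.\<close>

lemma cross_vertical_reversing:
  fixes s s' \<rho> v :: real
  assumes "(v - s) * (v - s') > 0" "(v - s) * (v - s') < \<rho>"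
  shows "\<exists>h>0. Re (of_real s + of_real \<rho> / (cnj (Complex v h) - of_real s')) = v"
proof -
  define \<sigma> \<sigma>' where "\<sigma> = s - v" and "\<sigma>' = s' - v"
  have p: "\<sigma> * \<sigma>' > 0" "\<sigma> * \<sigma>' < \<rho>" using assms by (auto simp: \<sigma>_def \<sigma>'_def algebra_simps)
  then have nz: "\<sigma> \<noteq> 0" "\<sigma>' \<noteq> 0" by auto
  define Q where "Q = (\<sigma>' / \<sigma>) * (\<rho> - \<sigma> * \<sigma>')"
  have "\<sigma>' / \<sigma> > 0" using p(1) by (auto simp: zero_less_mult_iff zero_less_divide_iff)
  then have Q: "Q > 0" unfolding Q_def using p(2) by (intro mult_pos_pos) auto
  have e: "\<sigma>'\<^sup>2 + Q = \<rho> * \<sigma>' / \<sigma>" using nz by (simp add: Q_def field_simps power2_eq_square)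
  have "Re (of_real s + of_real \<rho> / (cnj (Complex v (sqrt Q)) - of_real s')) = s - \<rho> * \<sigma>' / (\<sigma>'\<^sup>2 + Q)"
    using Q by (simp add: Re_divide \<sigma>'_def power2_commute[of v s'] diff_divide_distrib algebra_simps)
  also have "\<dots> = s - \<sigma>" unfolding e using nz p by (simp add: field_simps)
  finally show ?thesis using Q by (intro exI[of _ "sqrt Q"]) (simp add: \<sigma>_def)
qed

lemma Complex_uhp: "Complex v h \<in> uhp \<longleftrightarrow> h > 0"
  by (simp add: uhp_def)

lemma isom_to_1: "isom (\<lambda>z. 1 - 1 / z)"
  unfolding isom_def
proof (intro exI conjI ballI)
  show "(1::real) * 0 - (-1) * 1 \<noteq> 0" by simp
  fix z assume "z \<in> uhp"
  then have "z \<noteq> 0" by (auto simp: uhp_def)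
  then show "1 - 1 / z = mob 1 (-1) 1 0 z" by (simp add: mob_def lft_def field_simps)
qed

section \<open>Deck transformations against the sides of the triangle\<close>

context hyp_charts
begin

text \<open>The ideal triangle is the one with vertices \<open>\<infinity>\<close>, \<open>0\<close>, \<open>1\<close>; the maps \<open>- 1 / z\<close> and
  \<open>1 - 1 / z\<close> carry \<open>\<infinity>\<close> to the other two vertices.\<close>

definition cusped_triangle :: "(complex \<Rightarrow> 'f) \<Rightarrow> bool" where
  "cusped_triangle N \<longleftrightarrow> liso F uhp N \<and>
    (\<forall>x>0. \<forall>y>0. N (Complex 0 x) = N (Complex 0 y) \<longrightarrow> x = y) \<and>
    (\<forall>x>0. \<forall>y>0. N (Complex 1 x) = N (Complex 1 y) \<longrightarrow> x = y) \<and>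
    (\<exists>\<tau>. \<tau> \<noteq> 0 \<and> (\<forall>z\<in>uhp. N (z + of_real \<tau>) = N z)) \<and>
    (\<exists>\<tau>. \<tau> \<noteq> 0 \<and> (\<forall>z\<in>uhp. N (- 1 / (z + of_real \<tau>)) = N (- 1 / z))) \<and>
    (\<exists>\<tau>. \<tau> \<noteq> 0 \<and> (\<forall>z\<in>uhp. N (1 - 1 / (z + of_real \<tau>)) = N (1 - 1 / z)))"

lemma cusped_triangleD:
  assumes "cusped_triangle N"
  shows "liso F uhp N"
    "\<And>v x y. v = 0 \<or> v = 1 \<Longrightarrow> x > 0 \<Longrightarrow> y > 0 \<Longrightarrow> N (Complex v x) = N (Complex v y) \<Longrightarrow> x = y"
    "\<exists>\<tau>. \<tau> \<noteq> 0 \<and> (\<forall>z\<in>uhp. N (z + of_real \<tau>) = N z)"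
    "\<exists>\<tau>. \<tau> \<noteq> 0 \<and> (\<forall>z\<in>uhp. N (- 1 / (z + of_real \<tau>)) = N (- 1 / z))"
    "\<exists>\<tau>. \<tau> \<noteq> 0 \<and> (\<forall>z\<in>uhp. N (1 - 1 / (z + of_real \<tau>)) = N (1 - 1 / z))"
  using assms unfolding cusped_triangle_def by blast+

text \<open>Reflection in the line over 1/2 fixes infinity and exchanges 0 and 1; the periods at
  these two vertices are exchanged with opposite sign. It will move poles lying to the right of n to
  the left.\<close>

lemma cusped_triangle_reflect:
  assumes "cusped_triangle N"
  shows "cusped_triangle (\<lambda>z. N (1 - cnj z))"
proof -
  note D = cusped_triangleD[OF assms]
  have "liso F uhp (\<lambda>z. N (of_real 1 - cnj z))"
    by (rule liso_comp[OF D(1) isom_reflect]) (auto simp: uhp_def)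
  then have 1: "liso F uhp (\<lambda>z. N (1 - cnj z))" by simp
  have C: "1 - cnj (Complex v h) = Complex (1 - v) h" for v h by (simp add: complex_eq_iff)
  have 2: "x = y" if "v = 0 \<or> v = 1" "x > 0" "y > 0" "N (1 - cnj (Complex v x)) = N (1 - cnj (Complex v y))" for v x y
    by (rule D(2)[of "1 - v"]) (use that in \<open>auto simp: C\<close>)
  have nc: "- cnj z \<in> uhp" if "z \<in> uhp" for z using that by (simp add: uhp_def)
  obtain a where a: "a \<noteq> 0" "\<forall>z\<in>uhp. N (z + of_real a) = N z" using D(3) by blast
  have 3: "N (1 - cnj (z + of_real a)) = N (1 - cnj z)" if "z \<in> uhp" for z
  proof -
    have "1 - cnj (z + of_real a) \<in> uhp" using that by (simp add: uhp_def)
    then have "N ((1 - cnj (z + of_real a)) + of_real a) = N (1 - cnj (z + of_real a))" using a(2) by blast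
    then show ?thesis by simp
  qed
  obtain b where b: "b \<noteq> 0" "\<forall>z\<in>uhp. N (- 1 / (z + of_real b)) = N (- 1 / z)" using D(4) by blast
  have 4: "N (1 - cnj (1 - 1 / (z + of_real (- b)))) = N (1 - cnj (1 - 1 / z))" if "z \<in> uhp" for z
  proof -
    have "- 1 / (- cnj z + of_real b) = 1 - cnj (1 - 1 / (z + of_real (- b)))" 
      by (simp add: minus_divide_right flip: minus_divide_left)
    moreover have "- 1 / (- cnj z) = 1 - cnj (1 - 1 / z)" by simp
    ultimately show ?thesis using bspec[OF b(2) nc[OF that]] by metis
  qed
  obtain c where c: "c \<noteq> 0" "\<forall>z\<in>uhp. N (1 - 1 / (z + of_real c)) = N (1 - 1 / z)" using D(5) by blast
  have 5: "N (1 - cnj (- 1 / (z + of_real (- c)))) = N (1 - cnj (- 1 / z))" if "z \<in> uhp" for z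
  proof -
    have "1 - 1 / (- cnj z + of_real c) = 1 - cnj (- 1 / (z + of_real (- c)))"
      by (simp add: minus_divide_right flip: minus_divide_left)
    moreover have "1 - 1 / (- cnj z) = 1 - cnj (- 1 / z)" by simp
    ultimately show ?thesis using bspec[OF c(2) nc[OF that]] by metis
  qed
  show ?thesis
    unfolding cusped_triangle_def
  proof (intro conjI)
    show "\<exists>\<tau>. \<tau> \<noteq> 0 \<and> (\<forall>z\<in>uhp. N (1 - cnj (- 1 / (z + of_real \<tau>))) = N (1 - cnj (- 1 / z)))"
      using 5 c(1) by (intro exI[of _ "- c"] conjI ballI) simp_all
    show "\<exists>\<tau>. \<tau> \<noteq> 0 \<and> (\<forall>z\<in>uhp. N (1 - cnj (1 - 1 / (z + of_real \<tau>))) = N (1 - cnj (1 - 1 / z)))"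
      using 4 b(1) by (intro exI[of _ "- b"] conjI ballI) simp_all
  qed (use 1 2 3 a in \<open>blast+\<close>)
qed

text \<open>A point of the side and its image have the same value under N, so injectivity on the
  side makes it a fixed point, and freeness does the rest.\<close>

lemma deck_vertical_side:
  assumes T: "cusped_triangle N" and v: "v = 0 \<or> v = 1" and h: "h > 0"
    and m: "isom m" "\<forall>z\<in>uhp. N (m z) = N z" "Re (m (Complex v h)) = v" and z: "z \<in> uhp"
  shows "m z = z"
proof -
  have u: "Complex v h \<in> uhp" using h by (simp add: uhp_def)
  have mu: "m (Complex v h) \<in> uhp" by (rule isom_in_uhp[OF m(1) u])
  have e: "m (Complex v h) = Complex v (Im (m (Complex v h)))" using m(3) by (simp add: complex_eq_iff)
  have "N (Complex v (Im (m (Complex v h)))) = N (Complex v h)" using m(2) u e by metis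
  moreover have "Im (m (Complex v h)) > 0" using mu by (simp add: uhp_def)
  ultimately have "Im (m (Complex v h)) = h" using cusped_triangleD(2)[OF T v _ h] by blast
  then have "m (Complex v h) = Complex v h" using e by simp
  then show ?thesis using deck_free[OF cusped_triangleD(1)[OF T] m(1,2) u _ z] by simp
qed

text \<open>By itself m gives at the vertex 1 only \<rho> \<le> (1 - s)(1 - s'). The sharper bound
  that \<open>crossing_reversing\<close> asks for comes from m \<circ> m, once equality has been
  excluded.\<close>

lemma reversing_deck_no_crossing:
  assumes T: "cusped_triangle N" and m: "isom m" "\<forall>z\<in>uhp. N (m z) = N z"
    and \<rho>: "\<rho> > 0" and form: "\<forall>z\<in>uhp. m z = of_real s + of_real \<rho> / (cnj z - of_real s')"
    and n: "0 < n" "n < 1" and s: "s < s'" "s' < n"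
    and X: "n * (1 - n) \<le> X" and e1: "((n - s')\<^sup>2 + X) * (n - s) = \<rho> * (n - s')"
  shows False
proof -
  have N: "liso F uhp N" using cusped_triangleD(1)[OF T] .
  have not_id: "\<exists>z\<in>uhp. m z \<noteq> z"
  proof (rule ccontr)
    assume "\<not> ?thesis"
    then have "m (Complex s' 1) = Complex s' 1" by (simp add: uhp_def)
    then have "Re (m (Complex s' 1)) = s'" by simp
    moreover have "Re (m (Complex s' 1)) = s" using form by (simp add: uhp_def Re_divide)
    ultimately show False using s by simp
  qed
  have side: "\<not> ((v - s) * (v - s') > 0 \<and> (v - s) * (v - s') < \<rho>)" if v: "v = 0 \<or> v = 1" for v
  proof
    assume "(v - s) * (v - s') > 0 \<and> (v - s) * (v - s') < \<rho>"
    then obtain h where h: "h > 0" "Re (of_real s + of_real \<rho> / (cnj (Complex v h) - of_real s')) = v"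
      using cross_vertical_reversing[of v s s' \<rho>] by blast
    have "m (Complex v h) = of_real s + of_real \<rho> / (cnj (Complex v h) - of_real s')"
      by (rule bspec[OF form]) (use h in \<open>simp add: uhp_def\<close>)
    then show False using deck_vertical_side[OF T v h(1) m] h(2) not_id by auto
  qed
  have c0: "s * s' \<le> 0 \<or> s * s' \<ge> \<rho>" using side[of 0] by auto
  have "(1 - s) * (1 - s') > 0" using s n by (intro mult_pos_pos) auto
  then have c1: "\<rho> \<le> (1 - s) * (1 - s')" using side[of 1] by auto
  \<comment> \<open>Otherwise \<open>m\<close> fixes the cusp 1 without being parabolic.\<close>
  have "\<rho> \<noteq> (1 - s) * (1 - s')"
  proof
    assume \<rho>_eq: "\<rho> = (1 - s) * (1 - s')"
    obtain \<tau> where \<tau>: "\<tau> \<noteq> 0" "\<forall>z\<in>uhp. N (1 - 1 / (z + of_real \<tau>)) = N (1 - 1 / z)"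
      using cusped_triangleD(5)[OF T] by blast
    have J: "liso F uhp (\<lambda>z. N (1 - 1 / z))"
      by (rule liso_comp[OF N isom_to_1]) (use isom_in_uhp[OF isom_to_1] in auto)
    \<comment> \<open>Equality means that m fixes the ideal point 1. The affine map
      \<open>m'\<close> is m conjugated by 1 - 1 / z, which puts this point at infinity, and a
      factor k = 1 would give s = s'.\<close>
    define k where "k = (1 - s') / (1 - s)"
    define m' where "m' z = of_real (1 / (1 - s)) - of_real k * cnj z" for z
    have k: "k > 0" using s n by (simp add: k_def)
    have "k = 1"
    proof (rule affine_deck_unit[OF J \<tau> k, where m = m' and c = "1 / (1 - s)"])
      show "\<forall>z\<in>uhp. N (1 - 1 / m' z) = N (1 - 1 / z)"
      proof
        fix z assume z: "z \<in> uhp"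
        define w where "w = 1 - 1 / z"
        have wu: "w \<in> uhp" using isom_in_uhp[OF isom_to_1 z] by (simp add: w_def)
        define p q c where "p = complex_of_real (1 - s)" and "q = complex_of_real (1 - s')" and "c = cnj z"
        have nz: "c \<noteq> 0" "p \<noteq> 0" "q \<noteq> 0" using z s n by (auto simp: p_def q_def c_def uhp_def)
        have "q * c - 1 \<noteq> 0"
        proof
          assume "q * c - 1 = 0"
          then have "Im (q * c) = 0" by simp
          then show False using z s n by (simp add: q_def c_def uhp_def)
        qed
        have m'z: "m' z = (1 - q * c) / p" by (simp add: m'_def k_def p_def q_def c_def diff_divide_distrib left_diff_distrib)
        have "m w = (1 - p) + p * q / ((1 - 1 / c) - (1 - q))"
          using bspec[OF form wu] by (simp add: w_def \<rho>_eq p_def q_def c_def)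
        also have "(1 - 1 / c) - (1 - q) = (q * c - 1) / c" using nz by (simp add: field_simps)
        also have "(1 - p) + p * q / ((q * c - 1) / c) = 1 + p / (q * c - 1)"
          using nz \<open>q * c - 1 \<noteq> 0\<close> by (simp add: field_simps)
        also have "\<dots> = 1 - 1 / m' z" unfolding m'z using nz \<open>q * c - 1 \<noteq> 0\<close> by (simp add: field_simps)
        finally have "m w = 1 - 1 / m' z" .
        then show "N (1 - 1 / m' z) = N (1 - 1 / z)" using bspec[OF m(2) wu] by (simp add: w_def)
      qed
    qed (auto simp: m'_def)
    then show False using s n by (simp add: k_def)
  qed
  then have c1': "\<rho> < (1 - s) * (1 - s')" using c1 by simp
  have "\<rho> \<le> (s' - s) * (1 - s')"
  proof (rule ccontr)
    assume neg: "\<not> ?thesis"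
    \<comment> \<open>m \<circ> m has the orientation-preserving form, with s - r, s' + r, r^2 in
      place of s, s', \<rho>. The negated bound says s' + r > 1, so 1 lies between s - r and s' + r;
      and \<rho> < (1 - s)(1 - s') is precisely the second condition for a crossing over 1.\<close>
    define D where "D = s' - s"
    have D: "D > 0" using s by (simp add: D_def)
    define r where "r = \<rho> / D"
    have r: "r > 0" "r * D = \<rho>" using \<rho> D by (auto simp: r_def)
    have sq: "m (m z) = of_real (s - r) - of_real (r\<^sup>2) / (z - of_real (s' + r))" if z: "z \<in> uhp" for z
    proof -
      define u where "u = z - of_real s'"
      have Iu: "Im u \<noteq> 0" using z by (simp add: u_def uhp_def)
      then have u: "u \<noteq> 0" "u - of_real r \<noteq> 0" by (auto simp: complex_eq_iff)
      have mz: "m z = of_real s + of_real \<rho> / cnj u" using bspec[OF form z] by (simp add: u_def)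
      have "cnj (m z) - of_real s' = - of_real D + of_real r * of_real D / u"
        unfolding mz r(2)[symmetric] by (simp add: D_def)
      also have "\<dots> = - of_real D * (u - of_real r) / u" using u by (simp add: field_simps)
      finally have d: "cnj (m z) - of_real s' = - of_real D * (u - of_real r) / u" .
      have "m (m z) = of_real s + of_real \<rho> / (cnj (m z) - of_real s')"
        by (rule bspec[OF form isom_in_uhp[OF m(1) z]])
      also have "\<dots> = of_real s - of_real r * (u / (u - of_real r))"
        unfolding d using D u r(2) by (simp add: r_def)
      also have "u / (u - of_real r) = 1 + of_real r / (u - of_real r)" using u(2) by (simp add: field_simps)
      finally show ?thesis by (simp add: u_def algebra_simps power2_eq_square)
    qed
    have "(1 - (s - r)) * (1 - (s' + r)) < 0"
    proof (rule mult_pos_neg)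
      show "0 < 1 - (s - r)" using s n r by simp
      have "(1 - s') * D < r * D" using neg r(2) by (simp add: D_def mult.commute)
      then show "1 - (s' + r) < 0" using D by simp
    qed
    moreover have "- ((1 - (s - r)) * (1 - (s' + r))) < r\<^sup>2"
    proof -
      have "- ((1 - (s - r)) * (1 - (s' + r))) = r\<^sup>2 + r * D - (1 - s) * (1 - s')"
        by (simp add: D_def algebra_simps power2_eq_square)
      then show ?thesis using c1' r(2) by simp
    qed
    ultimately obtain h where h: "h > 0" "Re (of_real (s - r) - of_real (r\<^sup>2) / (Complex 1 h - of_real (s' + r))) = 1"
      using cross_vertical_preserving[of 1 "s - r" "s' + r" "r\<^sup>2"] by blast
    have mm: "isom (m \<circ> m)" by (rule isom_comp[OF m(1) m(1)])
    have Nmm: "\<forall>z\<in>uhp. N ((m \<circ> m) z) = N z" using m(2) isom_in_uhp[OF m(1)] by simp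
    have Re1: "Re ((m \<circ> m) (Complex 1 h)) = 1" using h sq[of "Complex 1 h"] by (simp add: Complex_uhp)
    have pu: "Complex (s' + r) 1 \<in> uhp" by (simp add: uhp_def)
    have "(m \<circ> m) (Complex (s' + r) 1) = Complex (s' + r) 1"
      by (rule deck_vertical_side[OF T disjI2[OF refl] h(1) mm Nmm Re1 pu])
    then have "Re (of_real (s - r) - of_real (r\<^sup>2) / (Complex (s' + r) 1 - of_real (s' + r))) = s' + r"
      using sq[OF pu] by simp
    then have "s - r = s' + r" by (simp add: Re_divide)
    then show False using s r by simp
  qed
  then show False using crossing_reversing[OF n s X e1 c0] by simp
qed

text \<open>If s' < s, the inverse of m has the same form with s and s' exchanged, and
  \<open>e2\<close> plays the part of \<open>e1\<close>.\<close>

lemma reversing_deck_left: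
  assumes T: "cusped_triangle N" and m: "isom m" "\<forall>z\<in>uhp. N (m z) = N z"
    and \<rho>: "\<rho> > 0" and form: "\<forall>z\<in>uhp. m z = of_real s + of_real \<rho> / (cnj z - of_real s')"
    and n: "0 < n" "n < 1" and s: "s \<noteq> s'" "s < n" "s' < n"
    and X: "n * (1 - n) \<le> X" and e1: "((n - s')\<^sup>2 + X) * (n - s) = \<rho> * (n - s')"
    and Y: "n * (1 - n) \<le> Y" and e2: "((n - s)\<^sup>2 + Y) * (n - s') = \<rho> * (n - s)"
  shows False
proof (cases "s < s'")
  case True
  then show False using reversing_deck_no_crossing[OF T m \<rho> form n _ s(3) X e1] by simp
next
  case False
  obtain k where k: "isom k" "\<forall>z\<in>uhp. k (m z) = z \<and> m (k z) = z" using isom_inverse[OF m(1)] by blast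
  have Nk: "\<forall>z\<in>uhp. N (k z) = N z" using k(2) m(2) isom_in_uhp[OF k(1)] by metis
  have kform: "k w = of_real s' + of_real \<rho> / (cnj w - of_real s)" if w: "w \<in> uhp" for w
  proof -
    define z where "z = k w"
    have z: "z \<in> uhp" "m z = w" using isom_in_uhp[OF k(1) w] k(2) w by (auto simp: z_def)
    have nz: "z - of_real s' \<noteq> 0" using z(1) by (auto simp: complex_eq_iff uhp_def)
    have "cnj w - of_real s = of_real \<rho> / (z - of_real s')"
      using bspec[OF form z(1)] z(2) by auto
    then show ?thesis using nz \<rho> by (simp add: z_def[symmetric])
  qed
  have "s' < s" using False s by simp
  then show False using reversing_deck_no_crossing[OF T k(1) Nk \<rho> _ n _ s(2) Y e2] kform by simp
qed

text \<open>Equal values give a deck transformation m between the two points. If m fixes infinity it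
  preserves heights; the other two normal forms are refuted by the crossing inequalities. The bounds
  \<open>X\<close> and \<open>Y\<close> place both points on or above the half-circle from 0 to
  1.\<close>

theorem slit_injective:
  assumes T: "cusped_triangle N" and n: "0 < n" "n < 1" and y: "y1 > 0" "y2 > 0"
    and X: "n * (1 - n) \<le> y1\<^sup>2" and Y: "n * (1 - n) \<le> y2\<^sup>2" and eq: "N (Complex n y1) = N (Complex n y2)"
  shows "y1 = y2"
proof (rule ccontr)
  assume ne: "y1 \<noteq> y2"
  have N: "liso F uhp N" using cusped_triangleD(1)[OF T] .
  define x where "x = Complex n y1"
  have xu: "x \<in> uhp" and yu: "Complex n y2 \<in> uhp" using y by (auto simp: x_def uhp_def)
  obtain m where m: "isom m" "m x = Complex n y2" "\<forall>z\<in>uhp. N (m z) = N z"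
    using global_transition[OF N N xu yu] eq by (auto simp: x_def)
  have not_id: "m z \<noteq> z" if "z \<in> uhp" for z
  proof
    assume "m z = z"
    then have "m x = x" using deck_free[OF N m(1,3) that _ xu] by simp
    then show False using m(2) ne by (simp add: x_def)
  qed
  obtain \<tau> where \<tau>: "\<tau> \<noteq> 0" "\<forall>z\<in>uhp. N (z + of_real \<tau>) = N z" using cusped_triangleD(3)[OF T] by blast
  show False
  proof (cases rule: isom_cases[OF m(1)])
    case (1 k c)
    have "k = 1" by (rule affine_deck_unit[OF N \<tau> 1(1) m(3) disjI1[OF 1(2)]])
    then have "Im (m x) = Im x" using 1(2) xu by simp
    then show False using m(2) ne by (simp add: x_def)
  next
    case (2 k c)
    have "k = 1" by (rule affine_deck_unit[OF N \<tau> 2(1) m(3) disjI2[OF 2(2)]])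
    then have "Im (m x) = Im x" using 2(2) xu by simp
    then show False using m(2) ne by (simp add: x_def)
  next
    case (3 s s' \<rho>)
    define Q where "Q = (n - s')\<^sup>2 + y1\<^sup>2"
    have Q: "Q > 0" using y by (simp add: Q_def add_nonneg_pos)
    have mx: "Complex n y2 = of_real s - of_real \<rho> / (x - of_real s')" using bspec[OF 3(2) xu] m(2) by simp
    have re: "n = s - \<rho> * (n - s') / Q" using arg_cong[OF mx, of Re] by (simp add: x_def Re_divide Q_def)
    have im: "y2 = \<rho> * y1 / Q" using arg_cong[OF mx, of Im] by (simp add: x_def Im_divide Q_def)
    have e1: "Q * (n - s) = \<rho> * (s' - n)" using re Q by (simp add: field_simps)
    have e1': "Q * (n - s) = - \<rho> * (n - s')" unfolding e1 by (simp add: algebra_simps)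
    have im': "(Q * y2)\<^sup>2 = (- \<rho> * y1)\<^sup>2" unfolding im using Q by simp
    have "((n - s)\<^sup>2 + y2\<^sup>2) * (n - s') = - \<rho> * (n - s)"
      by (rule crossing_equation_sym[OF Q_def Q _ e1' im']) (use 3(1) in simp)
    moreover have "((n - s)\<^sup>2 + y2\<^sup>2) * (s' - n) = - (((n - s)\<^sup>2 + y2\<^sup>2) * (n - s'))"
      by (simp only: mult_minus_right[symmetric] minus_diff_eq)
    ultimately have e2: "((n - s)\<^sup>2 + y2\<^sup>2) * (s' - n) = \<rho> * (n - s)" by simp
    have side: "(v - s) * (v - s') \<ge> 0 \<or> - ((v - s) * (v - s')) \<ge> \<rho>" if v: "v = 0 \<or> v = 1" for v
    proof (rule ccontr)
      assume "\<not> ?thesis"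
      then obtain h where h: "h > 0" "Re (of_real s - of_real \<rho> / (Complex v h - of_real s')) = v"
        using cross_vertical_preserving[of v s s' \<rho>] by auto
      have "m (Complex v h) = of_real s - of_real \<rho> / (Complex v h - of_real s')"
        by (rule bspec[OF 3(2)]) (use h in \<open>simp add: uhp_def\<close>)
      then have "m x = x" using deck_vertical_side[OF T v h(1) m(1,3) _ xu] h(2) by simp
      then show False using not_id xu by blast
    qed
    \<comment> \<open>Otherwise (z - s)(z - s') = - \<rho> has a root in the upper half-plane, which
      is a fixed point of m.\<close>
    have hyp: "4 * \<rho> \<le> (s' - s)\<^sup>2"
    proof (rule ccontr)
      assume "\<not> ?thesis"
      then have d: "4 * \<rho> - (s' - s)\<^sup>2 > 0" by simp
      define z where "z = Complex ((s + s') / 2) (sqrt (4 * \<rho> - (s' - s)\<^sup>2) / 2)"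
      have zu: "z \<in> uhp" using d by (simp add: z_def uhp_def)
      have nz: "z - of_real s' \<noteq> 0" using zu by (auto simp: complex_eq_iff uhp_def)
      have "(z - of_real s) * (z - of_real s') = - of_real \<rho>"
        using d by (simp add: z_def complex_eq_iff algebra_simps power2_eq_square, simp add: field_simps)
      then have "z - of_real s = - of_real \<rho> / (z - of_real s')" using nz by (metis nonzero_mult_div_cancel_right)
      then have "z = of_real s - of_real \<rho> / (z - of_real s')" by (simp add: algebra_simps)
      from trans[OF bspec[OF 3(2) zu] this[symmetric]] have "m z = z" .
      then show False using not_id[OF zu] by simp
    qed
    \<comment> \<open>By \<open>e1\<close>, n - s and s' - n have the same sign. The order s' < n <
      s is the order s < n < s' for the inverse of m, so s, s' and y1, y2 are exchanged.\<close>
    consider "n = s'" | "s' > n" | "s' < n" by linarith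
    then show False
    proof cases
      case 1
      then have "n = s" using e1 Q by simp
      then show False using hyp 1 3(1) by simp
    next
      case 2
      then have "Q * (n - s) > 0" using e1 3(1) by simp
      then have "s < n" using Q by (simp add: zero_less_mult_iff)
      then show False
        using crossing_preserving[OF n _ 2 X e1[unfolded Q_def] Y e2 _ _ hyp] side[of 0] side[of 1] by simp
    next
      case c: 3
      have "Q * (n - s) < 0" unfolding e1 using c 3(1) by (simp add: mult_pos_neg)
      then have "n < s" using Q by (simp add: mult_less_0_iff)
      moreover have "((n - s)\<^sup>2 + y2\<^sup>2) * (n - s') = \<rho> * (s - n)" "((n - s')\<^sup>2 + y1\<^sup>2) * (s - n) = \<rho> * (n - s')"
        using e1[unfolded Q_def] e2 by (simp_all add: algebra_simps)
      ultimately show False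
        using crossing_preserving[OF n c _ Y _ X, of s \<rho>] side[of 0] side[of 1] hyp
        by (simp add: mult.commute power2_commute)
    qed
  next
    case (4 s s' \<rho>)
    define Q where "Q = (n - s')\<^sup>2 + y1\<^sup>2"
    have Q: "Q > 0" using y by (simp add: Q_def add_nonneg_pos)
    have mx: "Complex n y2 = of_real s + of_real \<rho> / (cnj x - of_real s')" using bspec[OF 4(2) xu] m(2) by simp
    have re: "n = s + \<rho> * (n - s') / Q" using arg_cong[OF mx, of Re] by (simp add: x_def Re_divide Q_def)
    have im: "y2 = \<rho> * y1 / Q" using arg_cong[OF mx, of Im] by (simp add: x_def Im_divide Q_def)
    have e1: "Q * (n - s) = \<rho> * (n - s')" using re Q by (simp add: field_simps)
    have e2: "((n - s)\<^sup>2 + y2\<^sup>2) * (n - s') = \<rho> * (n - s)"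
      using crossing_equation_sym[OF Q_def Q _ e1] im Q 4(1) by simp
    \<comment> \<open>For s = s' the map is the inversion in the circle about s of radius sqrt
      \<rho>, whose points are fixed.\<close>
    have ss: "s \<noteq> s'"
    proof
      assume s: "s = s'"
      define z where "z = Complex s (sqrt \<rho>)"
      have zu: "z \<in> uhp" using 4(1) by (simp add: z_def uhp_def)
      have "m z = of_real s + of_real \<rho> / (cnj z - of_real s')" by (rule bspec[OF 4(2) zu])
      also have "\<dots> = z" using 4(1) s by (simp add: z_def complex_eq_iff Re_divide Im_divide real_div_sqrt)
      finally show False using not_id[OF zu] by simp
    qed
    \<comment> \<open>Now \<open>e1\<close> puts s and s' on the same side of n; when they lie to
      the right, the configuration is reflected in the line over 1/2.\<close>
    consider "n = s'" | "s' > n" | "s' < n" by linarith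
    then show False
    proof cases
      case 1
      then have "n = s" using e1 Q by simp
      then show False using ss 1 by simp
    next
      case 3
      then have "Q * (n - s) > 0" using e1 4(1) by simp
      then have "s < n" using Q by (simp add: zero_less_mult_iff)
      then show False
        using reversing_deck_left[OF T m(1,3) 4 n ss _ 3 X e1[unfolded Q_def] Y e2] by simp
    next
      case 2
      have "Q * (n - s) < 0" unfolding e1 using 2 4(1) by (simp add: mult_pos_neg)
      then have sn: "n < s" using Q by (simp add: mult_less_0_iff)
      define m' where "m' z = 1 - cnj (m (1 - cnj z))" for z
      have ru: "1 - cnj z \<in> uhp" if "z \<in> uhp" for z using that by (simp add: uhp_def)
      have refl: "isom (\<lambda>z. 1 - cnj z)" using isom_reflect[of 1] by simp
      have m': "isom m'" using isom_comp[OF refl isom_comp[OF m(1) refl]] by (simp add: m'_def[abs_def] comp_def)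
      have Nm': "\<forall>z\<in>uhp. N (1 - cnj (m' z)) = N (1 - cnj z)" using m(3) ru by (simp add: m'_def)
      have form': "\<forall>z\<in>uhp. m' z = of_real (1 - s) + of_real \<rho> / (cnj z - of_real (1 - s'))"
      proof
        fix z assume z: "z \<in> uhp"
        have "m' z = 1 - (of_real s + of_real \<rho> / ((1 - cnj z) - of_real s'))"
          using bspec[OF 4(2) ru[OF z]] by (simp add: m'_def)
        also have "(1 - cnj z) - of_real s' = - (cnj z - of_real (1 - s'))" by simp
        finally show "m' z = of_real (1 - s) + of_real \<rho> / (cnj z - of_real (1 - s'))"
          by (simp only: divide_minus_right) simp
      qed
      show False
      proof (rule reversing_deck_left[OF cusped_triangle_reflect[OF T] m' Nm' 4(1) form', of "1 - n" "y1\<^sup>2" "y2\<^sup>2"])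
        have sw: "(1 - n) - (1 - s') = - (n - s')" "(1 - n) - (1 - s) = - (n - s)" by simp_all
        show "((1 - n - (1 - s'))\<^sup>2 + y1\<^sup>2) * (1 - n - (1 - s)) = \<rho> * (1 - n - (1 - s'))"
          unfolding sw power2_minus mult_minus_right using e1[unfolded Q_def] by (simp only:)
        show "((1 - n - (1 - s))\<^sup>2 + y2\<^sup>2) * (1 - n - (1 - s')) = \<rho> * (1 - n - (1 - s))"
          unfolding sw power2_minus mult_minus_right using e2 by (simp only:)
      qed (use n ss sn 2 X Y in \<open>simp_all add: mult.commute\<close>)
    qed
  qed
qed

end

subsection \<open>From the Klein model to the half-plane\<close>

text \<open>The Klein model seen from the ideal point \<open>u\<close>: the upper half-plane with \<open>u\<close> at infinity.\<close>

definition klein :: "complex \<Rightarrow> complex \<Rightarrow> complex" where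
  "klein u z = u * Complex (((cmod z)\<^sup>2 - 1) / ((cmod z)\<^sup>2 + 1)) (2 * Re z / ((cmod z)\<^sup>2 + 1))"

definition unklein :: "complex \<Rightarrow> complex \<Rightarrow> complex" where
  "unklein u k = Complex (Im (cnj u * k) / (1 - k \<bullet> u)) (sqrt (1 - (cmod k)\<^sup>2) / (1 - k \<bullet> u))"

lemma inner_rotate: "cmod u = 1 \<Longrightarrow> (u * p) \<bullet> (u * q) = p \<bullet> q"
proof -
  assume "cmod u = 1"
  then have u: "(Re u)\<^sup>2 + (Im u)\<^sup>2 = 1" by (simp add: cmod_power2[symmetric])
  have "(u * p) \<bullet> (u * q) = ((Re u)\<^sup>2 + (Im u)\<^sup>2) * (p \<bullet> q)"
    by (simp add: inner_complex_def power2_eq_square algebra_simps)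
  then show ?thesis unfolding u by simp
qed

lemma cmod_sq_plus_1_pos: "(cmod z)\<^sup>2 + 1 > 0"
  by (simp add: add_nonneg_pos)

lemma klein_inner:
  assumes "cmod u = 1"
  shows "1 - klein u z \<bullet> klein u w =
    2 * ((Re z - Re w)\<^sup>2 + (Im z)\<^sup>2 + (Im w)\<^sup>2) / (((cmod z)\<^sup>2 + 1) * ((cmod w)\<^sup>2 + 1))"
proof -
  have p: "(cmod z)\<^sup>2 + 1 \<noteq> 0" "(cmod w)\<^sup>2 + 1 \<noteq> 0" using cmod_sq_plus_1_pos[of z] cmod_sq_plus_1_pos[of w] by simp_all
  have gen: "1 - (x / a * (y / b) + x' / a * (y' / b)) = (a * b - (x * y + x' * y')) / (a * b)"
    if "a \<noteq> 0" "b \<noteq> 0" for a b x y x' y' :: real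
    using that by (simp add: field_simps)
  have "1 - klein u z \<bullet> klein u w = 1 - (((cmod z)\<^sup>2 - 1) / ((cmod z)\<^sup>2 + 1) * (((cmod w)\<^sup>2 - 1) / ((cmod w)\<^sup>2 + 1)) +
      2 * Re z / ((cmod z)\<^sup>2 + 1) * (2 * Re w / ((cmod w)\<^sup>2 + 1)))"
    unfolding klein_def inner_rotate[OF assms] by (simp add: inner_complex_def)
  also have "\<dots> = (((cmod z)\<^sup>2 + 1) * ((cmod w)\<^sup>2 + 1) - (((cmod z)\<^sup>2 - 1) * ((cmod w)\<^sup>2 - 1) + 2 * Re z * (2 * Re w))) /
      (((cmod z)\<^sup>2 + 1) * ((cmod w)\<^sup>2 + 1))"
    by (rule gen[OF p])
  also have "((cmod z)\<^sup>2 + 1) * ((cmod w)\<^sup>2 + 1) - (((cmod z)\<^sup>2 - 1) * ((cmod w)\<^sup>2 - 1) + 2 * Re z * (2 * Re w)) =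
      2 * ((Re z - Re w)\<^sup>2 + (Im z)\<^sup>2 + (Im w)\<^sup>2)"
    unfolding cmod_power2 by (simp add: power2_eq_square algebra_simps)
  finally show ?thesis .
qed

lemma klein_norm:
  assumes "cmod u = 1"
  shows "1 - (cmod (klein u z))\<^sup>2 = (2 * Im z / ((cmod z)\<^sup>2 + 1))\<^sup>2"
  using klein_inner[OF assms, of z z] by (simp add: power2_norm_eq_inner[symmetric] power_divide power_mult_distrib power2_eq_square)

lemma klein_sqrt:
  assumes "cmod u = 1" "Im z \<ge> 0"
  shows "sqrt (1 - (cmod (klein u z))\<^sup>2) = 2 * Im z / ((cmod z)\<^sup>2 + 1)"
  unfolding klein_norm[OF assms(1)] using assms(2) cmod_sq_plus_1_pos[of z] by simp

lemma klein_in_hplane: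
  assumes "cmod u = 1" "z \<in> uhp"
  shows "klein u z \<in> hplane"
proof -
  have "Im z > 0" using assms by (simp add: uhp_def)
  then have "2 * Im z / ((cmod z)\<^sup>2 + 1) > 0" using cmod_sq_plus_1_pos[of z] by (intro divide_pos_pos) auto
  then have "(2 * Im z / ((cmod z)\<^sup>2 + 1))\<^sup>2 > 0" by (rule zero_less_power)
  then have "(cmod (klein u z))\<^sup>2 < 1" using klein_norm[OF assms(1), of z] by linarith
  then show ?thesis by (simp add: abs_square_less_1)
qed

lemma hdist_klein:
  assumes u: "cmod u = 1" and zw: "z \<in> uhp" "w \<in> uhp"
  shows "hdist (klein u z) (klein u w) = udist z w"
proof -
  have I: "Im z > 0" "Im w > 0" using zw by (auto simp: uhp_def)
  define a b where "a = (cmod z)\<^sup>2 + 1" and "b = (cmod w)\<^sup>2 + 1"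
  have ab: "a > 0" "b > 0" using cmod_sq_plus_1_pos by (auto simp: a_def b_def)
  have "sqrt ((1 - (cmod (klein u z))\<^sup>2) * (1 - (cmod (klein u w))\<^sup>2)) = (2 * Im z / a) * (2 * Im w / b)"
    unfolding real_sqrt_mult a_def b_def using klein_sqrt[OF u] I by simp
  then have "(1 - klein u z \<bullet> klein u w) / sqrt ((1 - (cmod (klein u z))\<^sup>2) * (1 - (cmod (klein u w))\<^sup>2)) =
     (2 * ((Re z - Re w)\<^sup>2 + (Im z)\<^sup>2 + (Im w)\<^sup>2) / (a * b)) / ((2 * Im z / a) * (2 * Im w / b))"
    unfolding klein_inner[OF u] a_def b_def by simp
  also have "\<dots> = ((Re z - Re w)\<^sup>2 + (Im z)\<^sup>2 + (Im w)\<^sup>2) / (2 * Im z * Im w)"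
    using ab I by (simp add: field_simps)
  also have "\<dots> = 1 + (cmod (z - w))\<^sup>2 / (2 * Im z * Im w)"
    using I unfolding cmod_diff_sq by (simp add: field_simps power2_eq_square)
  finally show ?thesis by (simp add: hdist_def udist_def)
qed

text \<open>\<open>cmod k \<le> 1\<close> includes the ideal points other than u; they correspond to
  real numbers.\<close>

lemma klein_unklein:
  assumes u: "cmod u = 1" and k: "cmod k \<le> 1" "k \<noteq> u"
  shows "klein u (unklein u k) = k" "k \<bullet> u < 1"
proof -
  define p where "p = cnj u * k"
  have uu: "u * cnj u = 1" using u by (simp add: complex_norm_square[symmetric])
  have kp: "k = u * p" using uu by (simp add: p_def mult.assoc[symmetric])
  have ku: "k \<bullet> u = Re p" using inner_rotate[OF u, of p 1] kp by (simp add: inner_complex_def)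
  have np: "cmod k = cmod p" using u by (simp add: kp norm_mult)
  have p1: "p \<noteq> 1" using k(2) kp by auto
  have n2: "(cmod k)\<^sup>2 = (Re p)\<^sup>2 + (Im p)\<^sup>2" unfolding np by (rule cmod_power2)
  have le: "(Re p)\<^sup>2 + (Im p)\<^sup>2 \<le> 1" using k(1) n2 by (metis norm_ge_zero power_le_one)
  show r: "k \<bullet> u < 1"
  proof (rule ccontr)
    assume "\<not> ?thesis"
    then have "Re p \<ge> 1" using ku by simp
    then have "(Re p)\<^sup>2 \<ge> Re p" by (simp add: power2_eq_square)
    then have "Re p = 1 \<and> (Im p)\<^sup>2 = 0" using le \<open>Re p \<ge> 1\<close> zero_le_power2[of "Im p"] by linarith
    then show False using p1 by (simp add: complex_eq_iff)
  qed
  define d where "d = 1 - Re p"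
  have d: "d > 0" using r ku by (simp add: d_def)
  define v where "v = 1 - (cmod k)\<^sup>2"
  have v: "v \<ge> 0" using le n2 by (simp add: v_def)
  have z: "unklein u k = Complex (Im p / d) (sqrt v / d)"
    by (simp add: unklein_def ku d_def p_def v_def)
  have "(cmod (unklein u k))\<^sup>2 = ((Im p)\<^sup>2 + v) / d\<^sup>2"
    unfolding z cmod_power2 using v by (simp add: power_divide add_divide_distrib)
  also have "(Im p)\<^sup>2 + v = d * (1 + Re p)" unfolding v_def n2 by (simp add: d_def power2_eq_square algebra_simps)
  also have "d * (1 + Re p) / d\<^sup>2 = (1 + Re p) / d" using d by (simp add: power2_eq_square)
  finally have c: "(cmod (unklein u k))\<^sup>2 = (1 + Re p) / d" .
  have c1: "(cmod (unklein u k))\<^sup>2 + 1 = 2 / d" and c2: "(cmod (unklein u k))\<^sup>2 - 1 = 2 * Re p / d"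
    unfolding c using d by (simp_all add: field_simps d_def)
  have "Complex (((cmod (unklein u k))\<^sup>2 - 1) / ((cmod (unklein u k))\<^sup>2 + 1)) (2 * Re (unklein u k) / ((cmod (unklein u k))\<^sup>2 + 1)) = p"
    unfolding c1 c2 using d by (simp add: z complex_eq_iff)
  then show "klein u (unklein u k) = k" unfolding klein_def using kp by simp
qed

lemma unklein_in_uhp: "cmod u = 1 \<Longrightarrow> k \<in> hplane \<Longrightarrow> unklein u k \<in> uhp"
proof -
  assume u: "cmod u = 1" and k: "k \<in> hplane"
  have "(cmod k)\<^sup>2 < 1" using k by (simp add: power_less_one_iff abs_square_less_1)
  moreover have "k \<bullet> u < 1" by (rule klein_unklein(2)[OF u]) (use k u in auto)
  ultimately show ?thesis by (simp add: unklein_def uhp_def)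
qed

lemma klein_unklein_hplane: "cmod u = 1 \<Longrightarrow> k \<in> hplane \<Longrightarrow> klein u (unklein u k) = k"
  using klein_unklein(1)[of u k] by fastforce

lemma klein_inj:
  assumes u: "cmod u = 1" and zw: "z \<in> uhp" "w \<in> uhp" "klein u z = klein u w"
  shows "z = w"
proof -
  have zz: "z \<in> uhp \<Longrightarrow> udist z z = 0" for z using udist_eq_0_iff by blast
  have "udist z w = hdist (klein u z) (klein u w)" using hdist_klein[OF u zw(1,2)] by simp
  also have "\<dots> = udist w w" unfolding zw(3) by (rule hdist_klein[OF u zw(2,2)])
  finally show ?thesis using udist_eq_0_iff zw zz by metis
qed

lemma unklein_klein: "cmod u = 1 \<Longrightarrow> z \<in> uhp \<Longrightarrow> unklein u (klein u z) = z"
  by (meson klein_in_hplane klein_inj klein_unklein_hplane unklein_in_uhp)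

lemma klein_ideal:
  assumes u: "cmod u = 1" and a: "cmod a = 1" "a \<noteq> u"
  shows "\<exists>A. klein u (of_real A) = a"
proof -
  have "Im (unklein u a) = 0" using a by (simp add: unklein_def)
  then have "unklein u a = of_real (Re (unklein u a))" by (simp add: complex_eq_iff)
  then show ?thesis using klein_unklein(1)[OF u _ a(2)] a(1) by (metis order_refl)
qed

lemma continuous_on_unklein:
  assumes u: "cmod u = 1"
  shows "continuous_on hplane (unklein u)"
proof -
  have "k \<bullet> u \<noteq> 1" if "k \<in> hplane" for k using klein_unklein(2)[OF u, of k] that u by fastforce
  then show ?thesis unfolding unklein_def Complex_eq
    by (intro continuous_intros) (auto simp: )
qed

lemma continuous_on_klein: "continuous_on S (klein u)"
  unfolding klein_def Complex_eq using cmod_sq_plus_1_pos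
  by (intro continuous_intros) (metis less_numeral_extra(3))+

lemma klein_horoball:
  assumes u: "cmod u = 1" and z: "z \<in> uhp" and s: "s > 0"
  shows "klein u z \<in> horoball u s \<longleftrightarrow> 1 / s < Im z"
proof -
  have I: "Im z > 0" using z by (simp add: uhp_def)
  define a where "a = (cmod z)\<^sup>2 + 1"
  have a: "a > 0" using cmod_sq_plus_1_pos by (simp add: a_def)
  have "klein u z \<bullet> u = ((cmod z)\<^sup>2 - 1) / a"
    using inner_rotate[OF u, of "Complex (((cmod z)\<^sup>2 - 1) / a) (2 * Re z / a)" 1]
    unfolding klein_def a_def by (simp add: inner_complex_def)
  then have "1 - klein u z \<bullet> u = 2 / a" using a by (simp add: field_simps a_def)
  then have "klein u z \<in> horoball u s \<longleftrightarrow> 2 / a < s * (2 * Im z / a)"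
    unfolding horoball_def using klein_sqrt[OF u, of z] klein_in_hplane[OF u z] I by (simp add: a_def)
  also have "\<dots> \<longleftrightarrow> 1 / s < Im z" using a s by (simp add: field_simps)
  finally show ?thesis .
qed

text \<open>In the half-plane this horoball is the disc tangent to the real line at A with diameter
  s (A^2 + 1); the factor is at least 1. Points straight above A are enough, since they form the ray
  running into the vertex.\<close>

lemma klein_horoball_real:
  assumes u: "cmod u = 1" and Y: "Y > 0" "Y < s"
  shows "klein u (Complex A Y) \<in> horoball (klein u (of_real A)) s"
proof -
  have z: "Complex A Y \<in> uhp" using Y by (simp add: uhp_def)
  define a b where "a = (cmod (Complex A Y))\<^sup>2 + 1" and "b = (cmod (of_real A))\<^sup>2 + (1::real)"
  have a: "a > 0" and b: "b \<ge> 1" using cmod_sq_plus_1_pos by (auto simp: a_def b_def)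
  have "Y * 1 < s * b" using Y b by (intro mult_less_le_imp_less) auto
  then have "2 * Y * Y / (a * b) < s * (2 * Y / a)"
    using a b Y by (simp add: divide_simps mult_ac)
  moreover have "1 - klein u (Complex A Y) \<bullet> klein u (of_real A) = 2 * Y * Y / (a * b)"
    unfolding klein_inner[OF u] a_def b_def by (simp add: power2_eq_square)
  moreover have "sqrt (1 - (cmod (klein u (Complex A Y)))\<^sup>2) = 2 * Y / a"
    using klein_sqrt[OF u, of "Complex A Y"] Y by (simp add: a_def)
  ultimately show ?thesis unfolding horoball_def using klein_in_hplane[OF u z] by simp
qed

section \<open>Surfaces, parabolic isometries and cusps in half-plane coordinates\<close>

lemma local_isometry_liso:
  assumes u: "cmod u = 1" and f: "local_isometry A F f" and U: "U \<subseteq> uhp" "klein u ` U \<subseteq> A"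
  shows "liso F U (\<lambda>z. f (klein u z))"
  unfolding liso_def
proof (intro conjI ballI)
  show "(\<lambda>z. f (klein u z)) ` U \<subseteq> F" using f U unfolding local_isometry_def by blast
  fix x assume x: "x \<in> U"
  then have "klein u x \<in> A" using U by blast
  then obtain e where e: "e > 0" "\<forall>y\<in>A. \<forall>z\<in>A. hdist (klein u x) y < e \<longrightarrow> hdist (klein u x) z < e \<longrightarrow> dist (f y) (f z) = hdist y z"
    using f unfolding local_isometry_def by blast
  have xu: "x \<in> uhp" using x U by blast
  obtain d where d: "d > 0" "ball x d \<subseteq> uhp" "\<And>z w. z \<in> ball x d \<Longrightarrow> w \<in> ball x d \<Longrightarrow> udist z w < e"
    using udist_small_nhd[OF xu e(1)] by blast
  have near: "hdist (klein u x) (klein u y) < e" "klein u y \<in> A" "y \<in> uhp" if "y \<in> U \<inter> ball x d" for y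
  proof -
    show "y \<in> uhp" "klein u y \<in> A" using that U by auto
    then show "hdist (klein u x) (klein u y) < e" using hdist_klein[OF u xu, of y] d(3)[of x y] d(1) that by simp
  qed
  have "dist (f (klein u y)) (f (klein u z)) = udist y z" if "y \<in> U \<inter> ball x d" "z \<in> U \<inter> ball x d" for y z
    using e(2)[rule_format, OF near(2)[OF that(1)] near(2)[OF that(2)] near(1)[OF that(1)] near(1)[OF that(2)]]
      hdist_klein[OF u near(3)[OF that(1)] near(3)[OF that(2)]] by simp
  then show "\<exists>e>0. \<forall>y\<in>U \<inter> ball x e. \<forall>z\<in>U \<inter> ball x e. dist (f (klein u y)) (f (klein u z)) = udist y z"
    by (intro exI[of _ d] conjI ballI d(1))
qed

text \<open>The map \<phi> given by the surface preserves distances, so it is injective, and its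
  image is a full hyperbolic disc; \<open>\<kappa>\<close> is its inverse read in the
  half-plane.\<close>

lemma complete_hyperbolic_surface_charts:
  assumes "complete_hyperbolic_surface F"
  shows "hyp_charts F"
proof
  show "complete F" using assms by (simp add: complete_hyperbolic_surface_def)
  fix q assume q: "q \<in> F"
  obtain r \<phi> where r: "r > 0" and \<phi>: "\<phi> q \<in> hplane" "\<phi> ` (F \<inter> ball q r) = {y \<in> hplane. hdist (\<phi> q) y < r}"
        "\<forall>y\<in>F \<inter> ball q r. \<forall>z\<in>F \<inter> ball q r. hdist (\<phi> y) (\<phi> z) = dist y z"
    using assms q unfolding complete_hyperbolic_surface_def by blast
  define w where "w = unklein 1 (\<phi> q)"
  have wu: "w \<in> uhp" and kw: "klein 1 w = \<phi> q"
    using unklein_in_uhp[of 1] klein_unklein_hplane[of 1] \<phi>(1) by (auto simp: w_def)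
  define W where "W = {z\<in>uhp. udist w z < r}"
  have Wk: "klein 1 z \<in> \<phi> ` (F \<inter> ball q r)" if "z \<in> W" for z
    unfolding \<phi>(2) using that klein_in_hplane[of 1 z] hdist_klein[of 1 w z] wu kw by (simp add: W_def)
  define \<kappa> where "\<kappa> z = inv_into (F \<inter> ball q r) \<phi> (klein 1 z)" for z
  have \<kappa>: "\<kappa> z \<in> F \<inter> ball q r" "\<phi> (\<kappa> z) = klein 1 z" if "z \<in> W" for z
    unfolding \<kappa>_def by (rule inv_into_into[OF Wk[OF that]], rule f_inv_into_f[OF Wk[OF that]])
  have \<kappa>d: "dist (\<kappa> y) (\<kappa> z) = udist y z" if "y \<in> W" "z \<in> W" for y z
  proof -
    have "dist (\<kappa> y) (\<kappa> z) = hdist (\<phi> (\<kappa> y)) (\<phi> (\<kappa> z))" using \<phi>(3) \<kappa>(1)[OF that(1)] \<kappa>(1)[OF that(2)] by simp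
    also have "\<dots> = udist y z" unfolding \<kappa>(2)[OF that(1)] \<kappa>(2)[OF that(2)] by (rule hdist_klein) (use that in \<open>auto simp: W_def\<close>)
    finally show ?thesis .
  qed
  have inj: "y = z" if "y \<in> F \<inter> ball q r" "z \<in> F \<inter> ball q r" "\<phi> y = \<phi> z" for y z
  proof -
    have "\<phi> y \<in> hplane" using \<phi>(2) that(1) by blast
    then have "hdist (\<phi> y) (\<phi> y) = 0"
      using hdist_klein[of 1 "unklein 1 (\<phi> y)" "unklein 1 (\<phi> y)"] unklein_in_uhp[of 1] klein_unklein_hplane[of 1]
        udist_eq_0_iff by (metis norm_one)
    then show ?thesis using \<phi>(3) that by (metis dist_eq_0_iff)
  qed
  have pre: "unklein 1 (\<phi> p) \<in> W \<and> \<kappa> (unklein 1 (\<phi> p)) = p" if p: "p \<in> F \<inter> ball q r" for p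
  proof -
    have "\<phi> p \<in> {y \<in> hplane. hdist (\<phi> q) y < r}" unfolding \<phi>(2)[symmetric] using p by blast
    then have h: "\<phi> p \<in> hplane" "hdist (\<phi> q) (\<phi> p) < r" by auto
    define z where "z = unklein 1 (\<phi> p)"
    have z: "z \<in> uhp" "klein 1 z = \<phi> p" using unklein_in_uhp[of 1] klein_unklein_hplane[of 1] h(1) by (auto simp: z_def)
    have "z \<in> W" using hdist_klein[of 1 w z] wu z kw h(2) by (simp add: W_def)
    moreover from this have "\<kappa> z = p" using inj[OF \<kappa>(1) p] \<kappa>(2) z(2) by simp
    ultimately show ?thesis by (simp add: z_def)
  qed
  have "\<kappa> ` W = F \<inter> ball q r" using \<kappa>(1) pre by (auto simp: image_iff) metis+
  moreover have "\<kappa> w = q" using pre[of q] q r by (simp add: w_def)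
  ultimately show "\<exists>r>0. \<exists>w\<in>uhp. \<exists>\<kappa>. \<kappa> w = q \<and> \<kappa> ` {z\<in>uhp. udist w z < r} = F \<inter> ball q r \<and>
      (\<forall>y\<in>{z\<in>uhp. udist w z < r}. \<forall>z\<in>{z\<in>uhp. udist w z < r}. dist (\<kappa> y) (\<kappa> z) = udist y z)"
    using r wu \<kappa>d unfolding W_def by blast
qed

text \<open>With u at infinity, preserving every horoball means preserving every height. Among the
  four normal forms this leaves translations and reflections in vertical lines, and the latter have
  fixed points.\<close>

lemma parabolic_translation:
  assumes u: "cmod u = 1" and g: "parabolic_at u g"
  shows "\<exists>\<tau>. \<tau> \<noteq> 0 \<and> (\<forall>z\<in>uhp. g (klein u z) = klein u (z + of_real \<tau>))"
proof -
  have bij: "bij_betw g hplane hplane" and gd: "\<And>x y. x \<in> hplane \<Longrightarrow> y \<in> hplane \<Longrightarrow> hdist (g x) (g y) = hdist x y"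
    and gh: "\<And>s. s > 0 \<Longrightarrow> g ` horoball u s = horoball u s" and gfree: "\<And>x. x \<in> hplane \<Longrightarrow> g x \<noteq> x"
    using g by (auto simp: parabolic_at_def hyp_isometry_def)
  define h where "h z = unklein u (g (klein u z))" for z
  have gk: "g (klein u z) \<in> hplane" if "z \<in> uhp" for z
    using bij_betwE[OF bij] klein_in_hplane[OF u that] by blast
  have h: "h z \<in> uhp" "klein u (h z) = g (klein u z)" if "z \<in> uhp" for z
    unfolding h_def using unklein_in_uhp[OF u gk[OF that]] klein_unklein_hplane[OF u gk[OF that]] by auto
  have hd: "udist (h z) (h w) = udist z w" if "z \<in> uhp" "w \<in> uhp" for z w
  proof -
    have "udist (h z) (h w) = hdist (g (klein u z)) (g (klein u w))"
      using hdist_klein[OF u h(1)[OF that(1)] h(1)[OF that(2)]] h(2) that by simp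
    also have "\<dots> = udist z w" using gd klein_in_hplane[OF u] hdist_klein[OF u] that by simp
    finally show ?thesis .
  qed
  have iu: "\<i> \<in> uhp" by (simp add: uhp_def)
  have "\<exists>m. isom m \<and> (\<forall>z\<in>uhp. h z = m z)"
    by (rule isometric_on_open_is_isom[OF open_uhp order_refl iu]) (use h hd in auto)
  then obtain m where m: "isom m" "\<forall>z\<in>uhp. h z = m z" by blast
  have up: "y < Im (m z) \<longleftrightarrow> y < Im z" if z: "z \<in> uhp" and y: "y > 0" for z y
  proof -
    have "y < Im (m z) \<longleftrightarrow> klein u (h z) \<in> horoball u (1 / y)"
      using klein_horoball[OF u h(1)[OF z], of "1 / y"] y m(2) z by simp
    also have "\<dots> \<longleftrightarrow> g (klein u z) \<in> g ` horoball u (1 / y)" using h(2)[OF z] gh[of "1 / y"] y by simp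
    also have "\<dots> \<longleftrightarrow> klein u z \<in> horoball u (1 / y)"
      by (rule inj_on_image_mem_iff[OF bij_betw_imp_inj_on[OF bij] klein_in_hplane[OF u z]]) (auto simp: horoball_def)
    also have "\<dots> \<longleftrightarrow> y < Im z" using klein_horoball[OF u z, of "1 / y"] y by simp
    finally show ?thesis .
  qed
  have Im_m: "Im (m z) = Im z" if z: "z \<in> uhp" for z
  proof -
    have "Im (m z) > 0" "Im z > 0" using isom_in_uhp[OF m(1) z] z by (auto simp: uhp_def)
    then show ?thesis using up[OF z, of "Im z"] up[OF z, of "Im (m z)"] by force
  qed
  have free: "m z \<noteq> z" if "z \<in> uhp" for z
    using gfree[OF klein_in_hplane[OF u that]] h(2)[OF that] m(2) that by metis
  have fin: ?thesis if "\<forall>z\<in>uhp. m z = z + of_real c" for c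
  proof (intro exI conjI ballI)
    show "c \<noteq> 0" using free[OF iu] that iu by auto
    show "g (klein u z) = klein u (z + of_real c)" if "z \<in> uhp" for z
      using h(2)[OF that] m(2) that \<open>\<forall>z\<in>uhp. m z = z + of_real c\<close> by simp
  qed
  show ?thesis
  proof (cases rule: isom_cases[OF m(1)])
    case (1 k c)
    then have "k = 1" using Im_m[OF iu] iu by simp
    then show ?thesis using 1(2) by (intro fin[of c]) simp
  next
    case (2 k c)
    then have "k = 1" using Im_m[OF iu] iu by simp
    moreover have c: "Complex (c / 2) 1 \<in> uhp" by (simp add: uhp_def)
    ultimately have "m (Complex (c / 2) 1) = Complex (c / 2) 1" using 2(2) by (simp add: complex_eq_iff)
    then show ?thesis using free[OF c] by simp
  next
    case (3 s s' \<rho>)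
    \<comment> \<open>Over the pole s' the heights 1 and 2 become \<rho> and \<rho> / 2, which
      cannot be 1 and 2 again.\<close>
    have "Complex s' 1 \<in> uhp" "Complex s' 2 \<in> uhp" by (auto simp: uhp_def)
    from Im_m[OF this(1)] Im_m[OF this(2)] bspec[OF 3(2) this(1)] bspec[OF 3(2) this(2)]
    have "\<rho> = 1" "\<rho> / 2 = 2" by (simp_all add: Im_divide)
    then show ?thesis by simp
  next
    case (4 s s' \<rho>)
    have "Complex s' 1 \<in> uhp" "Complex s' 2 \<in> uhp" by (auto simp: uhp_def)
    from Im_m[OF this(1)] Im_m[OF this(2)] bspec[OF 4(2) this(1)] bspec[OF 4(2) this(2)]
    have "\<rho> = 1" "\<rho> / 2 = 2" by (simp_all add: Im_divide)
    then show ?thesis by simp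
  qed
qed

text \<open>Seen from u, the horoball of size s is the half-plane above height 1 / s and the powers
  of the parabolic isometry are the translations by multiples of \<tau>.\<close>

lemma cusp_in_half_plane:
  assumes "cusp F C"
  shows "\<exists>h0 p \<tau>. h0 > 0 \<and> liso F {z. h0 < Im z} p \<and> \<tau> \<noteq> 0 \<and> C = p ` {z. h0 < Im z} \<and>
    (\<forall>x y. h0 < Im x \<longrightarrow> h0 < Im y \<longrightarrow>
      p x = p y \<longleftrightarrow> (\<exists>n::nat. y = x + of_real (of_nat n * \<tau>) \<or> x = y + of_real (of_nat n * \<tau>)))"
proof -
  obtain u s g p where u: "u \<in> ideal_boundary" and s: "s > 0" and g: "parabolic_at u g" 
    and p: "local_isometry (horoball u s) F p"
    and eq: "\<forall>x\<in>horoball u s. \<forall>y\<in>horoball u s. p x = p y \<longleftrightarrow> (\<exists>n. y = (g ^^ n) x \<or> x = (g ^^ n) y)"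
    and C: "C = p ` horoball u s"
    using assms unfolding cusp_def by blast
  have u1: "cmod u = 1" using u by simp
  obtain \<tau> where \<tau>: "\<tau> \<noteq> 0" "\<forall>z\<in>uhp. g (klein u z) = klein u (z + of_real \<tau>)"
    using parabolic_translation[OF u1 g] by blast
  define B where "B = {z. 1 / s < Im z}"
  have "0 < 1 / s" using s by simp
  then have Bu: "B \<subseteq> uhp" by (auto simp: B_def uhp_def simp del: zero_less_divide_1_iff)
  have Bh: "klein u z \<in> horoball u s \<longleftrightarrow> z \<in> B" if "z \<in> uhp" for z
    using klein_horoball[OF u1 that s] by (simp add: B_def)
  have img: "klein u ` B = horoball u s"
  proof
    show "klein u ` B \<subseteq> horoball u s" using Bh Bu by blast
    show "horoball u s \<subseteq> klein u ` B"
    proof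
      fix k assume k: "k \<in> horoball u s"
      then have "k \<in> hplane" by (simp add: horoball_def)
      then have z: "unklein u k \<in> uhp" "klein u (unklein u k) = k" 
        using unklein_in_uhp[OF u1] klein_unklein_hplane[OF u1] by blast+
      then have "unklein u k \<in> B" using Bh[OF z(1)] k by simp
      then show "k \<in> klein u ` B" using z(2) by force
    qed
  qed
  have pow: "(g ^^ n) (klein u z) = klein u (z + of_real (of_nat n * \<tau>))" if "z \<in> uhp" for n z
  proof (induction n)
    case (Suc n)
    have "(g ^^ Suc n) (klein u z) = g (klein u (z + of_real (of_nat n * \<tau>)))" using Suc by simp
    also have "\<dots> = klein u ((z + of_real (of_nat n * \<tau>)) + of_real \<tau>)"
      using \<tau>(2) uhp_add_real[OF that, of "of_nat n * \<tau>"] by blast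
    finally show ?case by (simp add: algebra_simps)
  qed simp
  show ?thesis
  proof (rule exI[of _ "1 / s"], rule exI[of _ "\<lambda>z. p (klein u z)"], rule exI[of _ \<tau>], intro conjI allI impI)
    show "0 < 1 / s" by fact
    show "liso F {z. 1 / s < Im z} (\<lambda>z. p (klein u z))"
      using local_isometry_liso[OF u1 p Bu] img by (simp add: B_def)
    show "\<tau> \<noteq> 0" by (rule \<tau>(1))
    show "C = (\<lambda>z. p (klein u z)) ` {z. 1 / s < Im z}" unfolding C img[symmetric] B_def by (simp add: image_image)
    fix x y assume "1 / s < Im x" "1 / s < Im y"
    then have xy: "x \<in> B" "y \<in> B" by (auto simp: B_def)
    then have xyu: "x \<in> uhp" "y \<in> uhp" using Bu by auto
    have k: "klein u v = klein u (w + of_real (of_nat n * \<tau>)) \<longleftrightarrow> v = w + of_real (of_nat n * \<tau>)"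
      if "v \<in> uhp" "w \<in> uhp" for v w and n :: nat
      using klein_inj[OF u1 that(1) uhp_add_real[OF that(2)]] by blast
    have "p (klein u x) = p (klein u y) \<longleftrightarrow> (\<exists>n. klein u y = (g ^^ n) (klein u x) \<or> klein u x = (g ^^ n) (klein u y))"
      using eq img xy by blast
    then show "p (klein u x) = p (klein u y) \<longleftrightarrow> (\<exists>n::nat. y = x + of_real (of_nat n * \<tau>) \<or> x = y + of_real (of_nat n * \<tau>))"
      unfolding pow[OF xyu(1)] pow[OF xyu(2)] k[OF xyu] k[OF xyu(2,1)] .
  qed
qed

text \<open>Continuity of the inverse at N w: far up the ray the values stay away from N w by
  \<open>liso_leaves_neighbourhoods\<close>, and on the compact remainder outside a ball about w
  they stay away by injectivity.\<close>

lemma (in hyp_charts) escaping_ray_embedding: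
  assumes N: "liso F uhp N" and \<tau>: "\<tau> \<noteq> 0" "\<forall>z\<in>uhp. N (z + of_real \<tau>) = N z" and y0: "y0 > 0"
    and inj: "\<And>y y'. y0 \<le> y \<Longrightarrow> y0 \<le> y' \<Longrightarrow> N (Complex x y) = N (Complex x y') \<Longrightarrow> y = y'"
  defines "R \<equiv> Complex x ` {y0..}"
  shows "\<exists>g. homeomorphism R (N ` R) N g"
proof -
  have Ru: "R \<subseteq> uhp" using y0 by (auto simp: R_def uhp_def)
  have contN: "continuous_on R N" using continuous_on_subset[OF liso_continuous[OF N order_refl] Ru] .
  have injN: "inj_on N R" by (auto simp: R_def inj_on_def dest: inj)
  define g where "g = inv_into R N"
  have gN: "g (N w) = w" if "w \<in> R" for w using inv_into_f_f[OF injN that] by (simp add: g_def)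
  have "continuous_on (N ` R) g"
    unfolding continuous_on_iff
  proof (intro ballI allI impI)
    fix q \<epsilon> assume "q \<in> N ` R" and \<epsilon>: "(\<epsilon>::real) > 0"
    then obtain w where w: "w \<in> R" "q = N w" by blast
    obtain r Y where r: "r > 0" "\<forall>v\<in>uhp. Y < Im v \<longrightarrow> r \<le> dist (N w) (N v)"
      using liso_leaves_neighbourhoods[OF N \<tau>] w(1) Ru by blast
    define K where "K = Complex x ` {y0..max y0 Y} - ball w \<epsilon>"
    have "compact (Complex x ` {y0..max y0 Y})"
      unfolding Complex_eq by (intro compact_continuous_image continuous_intros) auto
    then have K: "compact K" unfolding K_def by (intro compact_diff) auto
    have KR: "K \<subseteq> R" by (auto simp: K_def R_def)
    have "\<exists>d>0. \<forall>v\<in>K. d \<le> dist (N w) (N v)"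
    proof (cases "K = {}")
      case True then show ?thesis by (intro exI[of _ 1]) auto
    next
      case False
      have "continuous_on K (\<lambda>v. dist (N w) (N v))"
        by (intro continuous_intros continuous_on_subset[OF contN KR])
      then obtain v where v: "v \<in> K" "\<forall>v'\<in>K. dist (N w) (N v) \<le> dist (N w) (N v')"
        using continuous_attains_inf[OF K False] by blast
      have "v \<noteq> w" using v(1) \<epsilon> by (auto simp: K_def)
      then have "N w \<noteq> N v" using inj_onD[OF injN] w(1) v(1) KR by blast
      then show ?thesis using v(2) by (intro exI[of _ "dist (N w) (N v)"]) auto
    qed
    then obtain d where d: "d > 0" "\<forall>v\<in>K. d \<le> dist (N w) (N v)" by blast
    have "dist (g q') (g q) < \<epsilon>" if q': "q' \<in> N ` R" "dist q' q < min d r" for q'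
    proof (rule ccontr)
      assume far: "\<not> ?thesis"
      obtain v where v: "v \<in> R" "q' = N v" using q'(1) by blast
      have dv: "dist (N w) (N v) < min d r" using q'(2) w v by (simp add: dist_commute)
      have "\<not> Y < Im v" using r(2) dv v(1) Ru by force
      then have "v \<in> Complex x ` {y0..max y0 Y}" using v(1) by (auto simp: R_def)
      moreover have "v \<notin> ball w \<epsilon>" using far gN w v by (simp add: dist_commute)
      ultimately have "v \<in> K" by (simp add: K_def)
      then show False using d(2) dv by force
    qed
    then show "\<exists>d>0. \<forall>x'\<in>N ` R. dist x' q < d \<longrightarrow> dist (g x') (g q) < \<epsilon>"
      using d(1) r(1) by (intro exI[of _ "min d r"]) simp
  qed
  then have "homeomorphism R (N ` R) N g"
    using contN gN by (auto simp: homeomorphism_def image_image)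
  then show ?thesis by blast
qed

lemma embedding_map_through_homeomorphisms:
  assumes h: "homeomorphism R (N ` R) N g" and z: "homeomorphism G R \<zeta> \<xi>"
    and eq: "\<And>p. p \<in> G \<Longrightarrow> \<nu> p = N (\<zeta> p)" and F: "N ` R \<subseteq> F"
  shows "embedding_map (top_of_set G) (top_of_set F) \<nu>"
proof -
  have img: "\<nu> ` G = N ` R" using eq homeomorphism_image1[OF z] by force
  have "homeomorphism G (N ` R) (N \<circ> \<zeta>) (\<xi> \<circ> g)" by (rule homeomorphism_compose[OF z h])
  then have "homeomorphism G (\<nu> ` G) \<nu> (\<xi> \<circ> g)"
    unfolding img by (rule homeomorphism_cong) (use eq in auto)
  then have "homeomorphic_maps (top_of_set G) (top_of_set (\<nu> ` G)) \<nu> (\<xi> \<circ> g)"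
    by (auto simp: homeomorphism_def homeomorphic_maps_def)
  moreover have "subtopology (top_of_set F) (\<nu> ` G) = top_of_set (\<nu> ` G)"
    using F img by (simp add: subtopology_subtopology Int_absorb1)
  ultimately show ?thesis unfolding embedding_map_def homeomorphic_map_maps by auto
qed

section \<open>Convex combinations in homogeneous coordinates\<close>

text \<open>The factor clears denominators: (|z|^2 - 1, 2 Re z, |z|^2 + 1) is the hyperboloid vector
  of z up to the factor 2 Im z, and Euclidean convex combinations become polynomial identities
  between such vectors.\<close>

lemma klein_scaled:
  "of_real ((cmod z)\<^sup>2 + 1) * klein u z = u * Complex ((cmod z)\<^sup>2 - 1) (2 * Re z)"
proof -
  have p: "(cmod z)\<^sup>2 + 1 \<noteq> 0" using cmod_sq_plus_1_pos[of z] by simp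
  have "of_real ((cmod z)\<^sup>2 + 1) * Complex (((cmod z)\<^sup>2 - 1) / ((cmod z)\<^sup>2 + 1)) (2 * Re z / ((cmod z)\<^sup>2 + 1)) =
      Complex ((cmod z)\<^sup>2 - 1) (2 * Re z)"
    using p by (simp add: complex_eq_iff del: of_real_add)
  then show ?thesis unfolding klein_def by (metis mult.left_commute)
qed

text \<open>Three homogeneous coordinates are matched: \<open>w\<close> is the last one,
  \<open>X\<close> the middle one, and \<open>ab\<close> is the difference of the last and the
  first. The number \<gamma> is the weight of the ideal point u.\<close>

lemma klein_combination:
  assumes w: "(cmod w)\<^sup>2 + 1 = \<alpha> * (A\<^sup>2 + 1) + \<beta> * (B\<^sup>2 + 1) + \<gamma>" and X: "Re w = \<alpha> * A + \<beta> * B" and ab: "\<alpha> + \<beta> = 1"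
  shows "of_real ((cmod w)\<^sup>2 + 1) * klein u w =
    of_real (\<alpha> * (A\<^sup>2 + 1)) * klein u (of_real A) + of_real (\<beta> * (B\<^sup>2 + 1)) * klein u (of_real B) + of_real \<gamma> * u"
proof -
  have kr: "of_real (x * (C\<^sup>2 + 1)) * klein u (of_real C) = u * (of_real x * Complex (C\<^sup>2 - 1) (2 * C))" for x C
    using klein_scaled[of "of_real C" u] by (simp add: mult_ac)
  have "Complex ((cmod w)\<^sup>2 - 1) (2 * Re w) = of_real \<alpha> * Complex (A\<^sup>2 - 1) (2 * A) + of_real \<beta> * Complex (B\<^sup>2 - 1) (2 * B) + of_real \<gamma>"
  proof -
    have \<beta>: "\<beta> = 1 - \<alpha>" using ab by simp
    have w': "(cmod w)\<^sup>2 = \<alpha> * (A\<^sup>2 + 1) + \<beta> * (B\<^sup>2 + 1) + \<gamma> - 1" using w by simp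
    show ?thesis unfolding w' X \<beta> by (simp add: complex_eq_iff algebra_simps)
  qed
  then show ?thesis unfolding klein_scaled kr by (simp add: algebra_simps)
qed

lemma klein_vertical:
  assumes "Re w = Re v"
  shows "of_real ((cmod w)\<^sup>2 + 1) * klein u w = of_real ((cmod v)\<^sup>2 + 1) * klein u v + of_real ((Im w)\<^sup>2 - (Im v)\<^sup>2) * u"
proof -
  have "Complex ((cmod w)\<^sup>2 - 1) (2 * Re w) = Complex ((cmod v)\<^sup>2 - 1) (2 * Re v) + of_real ((Im w)\<^sup>2 - (Im v)\<^sup>2)"
    using assms by (simp add: complex_eq_iff cmod_power2)
  then show ?thesis unfolding klein_scaled by (simp only: distrib_left mult.commute)
qed

lemma convex_hull_3_mem:
  assumes "a \<ge> 0" "b \<ge> 0" "c \<ge> 0" "s > 0" "s = a + b + c" "of_real s * k = of_real a * (x::complex) + of_real b * y + of_real c * z"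
  shows "k \<in> convex hull {z, x, y}"
proof -
  have "of_real s * k = of_real s * ((c / s) *\<^sub>R z + (a / s) *\<^sub>R x + (b / s) *\<^sub>R y)"
    using assms(4) unfolding assms(6) by (simp add: scaleR_conv_of_real distrib_left)
  then have "k = (c / s) *\<^sub>R z + (a / s) *\<^sub>R x + (b / s) *\<^sub>R y" using assms(4) by simp
  moreover have "c / s + a / s + b / s = 1"
    using assms(4,5) by (simp add: add_divide_distrib[symmetric])
  ultimately show ?thesis
    unfolding convex_hull_3 using assms(1-4) by (intro CollectI exI[of _ "c / s"] exI[of _ "a / s"] exI[of _ "b / s"]) auto
qed

lemma closed_segment_mem:
  assumes "a \<ge> 0" "c \<ge> 0" "s > 0" "s = a + c" "of_real s * k = of_real a * (x::complex) + of_real c * z"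
  shows "k \<in> closed_segment x z"
proof -
  have "of_real s * k = of_real s * ((a / s) *\<^sub>R x + (c / s) *\<^sub>R z)"
    using assms(3) unfolding assms(5) by (simp add: scaleR_conv_of_real distrib_left)
  then have "k = (a / s) *\<^sub>R x + (c / s) *\<^sub>R z" using assms(3) by simp
  moreover have "a / s = 1 - c / s" using assms(3,4) by (simp add: field_simps)
  ultimately have "k = (1 - c / s) *\<^sub>R x + (c / s) *\<^sub>R z" by simp
  moreover have "0 \<le> c / s" "c / s \<le> 1" using assms by auto
  ultimately show ?thesis unfolding closed_segment_def by blast
qed

section \<open>The ideal triangle and its slits in half-plane coordinates\<close>

text \<open>The region of the half-plane cut out by the ideal triangle with vertices \<open>\<infinity>\<close>, \<open>0\<close>, \<open>1\<close>.\<close>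

definition standard_triangle :: "complex set" where
  "standard_triangle = {z. 0 \<le> Re z \<and> Re z \<le> 1 \<and> 0 < Im z \<and> Re z * (1 - Re z) \<le> (Im z)\<^sup>2}"

text \<open>A and B are the half-plane coordinates of the other two vertices when t is at infinity;
  \<open>stretch\<close> moves 0, 1 to A, B, and A < B makes its factor positive.\<close>

locale klein_triangle =
  fixes t :: complex and A B :: real
  assumes t: "cmod t = 1" and AB: "A < B"
begin

definition stretch :: "complex \<Rightarrow> complex" where
  "stretch z = of_real (B - A) * z + of_real A"

definition unstretch :: "complex \<Rightarrow> complex" where
  "unstretch w = (w - of_real A) / of_real (B - A)"

definition plane :: "complex \<Rightarrow> complex" where
  "plane z = klein t (stretch z)"

definition unplane :: "complex \<Rightarrow> complex" where
  "unplane k = unstretch (unklein t k)"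

lemma isom_stretch: "isom stretch"
  unfolding stretch_def[abs_def] using AB by (intro isom_affine) simp

lemma unstretch_stretch: "unstretch (stretch z) = z" "stretch (unstretch w) = w"
  using AB by (simp_all add: stretch_def unstretch_def)

lemma stretch_uhp: "z \<in> uhp \<Longrightarrow> stretch z \<in> uhp" "w \<in> uhp \<Longrightarrow> unstretch w \<in> uhp"
  using AB by (simp_all add: stretch_def unstretch_def uhp_def Im_divide_of_real flip: of_real_diff)

lemma stretch_Complex: "stretch (Complex x y) = Complex (A + (B - A) * x) ((B - A) * y)"
  by (simp add: stretch_def complex_eq_iff algebra_simps)

lemma plane_hplane: "z \<in> uhp \<Longrightarrow> plane z \<in> hplane"
  unfolding plane_def by (rule klein_in_hplane[OF t stretch_uhp(1)])

lemma plane_unplane: "k \<in> hplane \<Longrightarrow> plane (unplane k) = k"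
  unfolding plane_def unplane_def unstretch_stretch by (rule klein_unklein_hplane[OF t])

lemma unplane_plane: "z \<in> uhp \<Longrightarrow> unplane (plane z) = z"
  unfolding plane_def unplane_def using unklein_klein[OF t stretch_uhp(1)] unstretch_stretch by simp

lemma plane_inj: "z \<in> uhp \<Longrightarrow> w \<in> uhp \<Longrightarrow> plane z = plane w \<Longrightarrow> z = w"
  using unplane_plane by metis

lemma continuous_plane: "continuous_on S plane"
  unfolding plane_def stretch_def
  by (intro continuous_on_compose2[OF continuous_on_klein[of UNIV]] continuous_intros) auto

lemma continuous_unplane: "continuous_on hplane unplane"
  unfolding unplane_def unstretch_def using AB by (intro continuous_intros continuous_on_unklein[OF t]) auto

lemma standard_triangle_uhp: "standard_triangle \<subseteq> uhp"
  by (auto simp: standard_triangle_def uhp_def)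

text \<open>These are the barycentric weights of the point with respect to the three vertices, up to
  a common factor. The weight \<gamma> of t is nonnegative exactly on and above the half-circle from
  0 to 1.\<close>

lemma plane_combination:
  fixes x y :: real
  defines "w \<equiv> stretch (Complex x y)" and "\<gamma> \<equiv> (B - A)\<^sup>2 * (y\<^sup>2 - x * (1 - x))"
  shows "(cmod w)\<^sup>2 + 1 = (1 - x) * (A\<^sup>2 + 1) + x * (B\<^sup>2 + 1) + \<gamma>"
    "of_real ((cmod w)\<^sup>2 + 1) * plane (Complex x y) =
      of_real ((1 - x) * (A\<^sup>2 + 1)) * klein t (of_real A) + of_real (x * (B\<^sup>2 + 1)) * klein t (of_real B) + of_real \<gamma> * t"
proof -
  show 1: "(cmod w)\<^sup>2 + 1 = (1 - x) * (A\<^sup>2 + 1) + x * (B\<^sup>2 + 1) + \<gamma>"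
    unfolding w_def stretch_Complex \<gamma>_def cmod_power2 by (simp add: power2_eq_square algebra_simps)
  show "of_real ((cmod w)\<^sup>2 + 1) * plane (Complex x y) =
      of_real ((1 - x) * (A\<^sup>2 + 1)) * klein t (of_real A) + of_real (x * (B\<^sup>2 + 1)) * klein t (of_real B) + of_real \<gamma> * t"
    unfolding plane_def w_def[symmetric]
    by (rule klein_combination[OF 1]) (simp_all add: w_def stretch_Complex algebra_simps)
qed

lemma plane_in_triangle:
  assumes "z \<in> standard_triangle"
  shows "plane z \<in> ideal_triangle t (klein t (of_real A)) (klein t (of_real B))"
proof -
  obtain x y where z: "z = Complex x y" by (cases z)
  have xy: "0 \<le> x" "x \<le> 1" "0 < y" "x * (1 - x) \<le> y\<^sup>2" using assms by (auto simp: standard_triangle_def z)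
  have "plane z \<in> convex hull {t, klein t (of_real A), klein t (of_real B)}"
    unfolding z
    by (rule convex_hull_3_mem[OF _ _ _ _ plane_combination]) (use xy cmod_sq_plus_1_pos in auto)
  moreover have "z \<in> uhp" using assms standard_triangle_uhp by blast
  ultimately show ?thesis using plane_hplane by (simp add: ideal_triangle_def)
qed

lemma triangle_in_plane:
  assumes k: "k \<in> ideal_triangle t (klein t (of_real A)) (klein t (of_real B))"
    and nA: "cmod (klein t (of_real A)) = 1" and nB: "cmod (klein t (of_real B)) = 1"
  shows "\<exists>z\<in>standard_triangle. plane z = k"
proof -
  define a b where "a = klein t (of_real A)" and "b = klein t (of_real B)"
  obtain p q r where pqr: "0 \<le> p" "0 \<le> q" "0 \<le> r" "p + q + r = 1" and kp: "k = p *\<^sub>R t + q *\<^sub>R a + r *\<^sub>R b"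
    using k unfolding ideal_triangle_def convex_hull_3 a_def b_def by auto
  have k1: "cmod k < 1" using k by (simp add: ideal_triangle_def)
  \<comment> \<open>Comparison with \<open>plane_combination\<close> asks for q = (1 - x) sA c, r =
    x sB c and p = \<gamma> c; this \<open>c\<close> makes the coefficients 1 - x and x add up to
    1.\<close>
  define sA sB c where "sA = A\<^sup>2 + 1" and "sB = B\<^sup>2 + 1" and "c = q / sA + r / sB"
  have s: "sA > 0" "sB > 0" by (auto simp: sA_def sB_def add_nonneg_pos)
  have "q + r \<noteq> 0"
  proof
    assume "q + r = 0"
    then have "q = 0" "r = 0" "p = 1" using pqr by linarith+
    then have "k = t" using kp by simp
    then show False using k1 t by simp
  qed
  then have c: "c > 0" unfolding c_def using pqr s
    by (cases "q = 0") (auto intro!: add_nonneg_pos add_pos_nonneg divide_pos_pos)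
  define x where "x = r / sB / c"
  define \<gamma> where "\<gamma> = p / c"
  have "r / sB = c - q / sA" by (simp add: c_def)
  then have x1: "1 - x = q / sA / c" using c by (simp add: x_def diff_divide_distrib)
  have x: "0 \<le> x" "0 \<le> 1 - x" unfolding x1 using pqr s c by (auto simp: x_def)
  have \<gamma>: "\<gamma> \<ge> 0" using pqr c by (simp add: \<gamma>_def)
  \<comment> \<open>\<open>v\<close> is the square of the height, obtained by solving for it in the
    weight of t; it could vanish only at the ideal vertices a and b.\<close>
  define v where "v = \<gamma> / (B - A)\<^sup>2 + x * (1 - x)"
  have "v \<noteq> 0"
  proof
    assume "v = 0"
    then have "\<gamma> / (B - A)\<^sup>2 = 0" "x * (1 - x) = 0"
      using \<gamma> x unfolding v_def by (simp_all add: add_nonneg_eq_0_iff)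
    then have "p = 0" "r = 0 \<or> q = 0" using AB c s x1 by (auto simp: \<gamma>_def x_def)
    then have "k = a \<or> k = b" using pqr kp by auto
    then show False using k1 nA nB by (auto simp: a_def b_def)
  qed
  moreover have "v \<ge> 0" unfolding v_def using \<gamma> x by simp
  ultimately have v: "v > 0" by simp
  define z where "z = Complex x (sqrt v)"
  have y2: "(sqrt v)\<^sup>2 = v" using v by simp
  have \<gamma>': "(B - A)\<^sup>2 * ((sqrt v)\<^sup>2 - x * (1 - x)) = \<gamma>" unfolding y2 using AB by (simp add: v_def)
  note PC = plane_combination[of x "sqrt v", unfolded \<gamma>' sA_def[symmetric] sB_def[symmetric] a_def[symmetric] b_def[symmetric]]
  have w1: "(1 - x) * sA = q / c" "x * sB = r / c" unfolding x1 using s by (auto simp: x_def)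
  have N: "(cmod (stretch z))\<^sup>2 + 1 = 1 / c"
    using PC(1) pqr(4) unfolding z_def w1 \<gamma>_def by (simp add: add_divide_distrib[symmetric] add_ac)
  have "of_real (1 / c) * plane z = of_real (q / c) * a + of_real (r / c) * b + of_real (p / c) * t"
    using PC(2) N unfolding z_def w1 \<gamma>_def by simp
  also have "\<dots> = of_real (1 / c) * k" unfolding kp by (simp add: scaleR_conv_of_real algebra_simps)
  finally have "plane z = k" using c by simp
  moreover have "z \<in> standard_triangle"
    using x v \<gamma> by (simp add: standard_triangle_def z_def v_def)
  ultimately show ?thesis by blast
qed

text \<open>Along a vertical line only the weight of t changes, and it grows with the height, so the
  upward ray traces the chord towards t.\<close>

lemma slit_in_plane:
  assumes y0: "y0 > 0"
  shows "geodesic (plane (Complex x y0)) t = plane ` Complex x ` {y0..}"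
proof
  define v where "v = stretch (Complex x y0)"
  have vk: "plane (Complex x y0) = klein t v" by (simp add: plane_def v_def)
  define n0 where "n0 = (cmod v)\<^sup>2 + 1"
  have n0: "n0 > 0" using cmod_sq_plus_1_pos by (simp add: n0_def)
  have vI: "Im v = (B - A) * y0" by (simp add: v_def stretch_Complex)
  have V: "of_real ((cmod (stretch (Complex x y)))\<^sup>2 + 1) * plane (Complex x y) =
      of_real n0 * klein t v + of_real ((B - A)\<^sup>2 * (y\<^sup>2 - y0\<^sup>2)) * t" 
    and W: "(cmod (stretch (Complex x y)))\<^sup>2 + 1 = n0 + (B - A)\<^sup>2 * (y\<^sup>2 - y0\<^sup>2)" for y
  proof -
    have "Re (stretch (Complex x y)) = Re v" by (simp add: v_def stretch_Complex)
    from klein_vertical[OF this, of t]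
    show "of_real ((cmod (stretch (Complex x y)))\<^sup>2 + 1) * plane (Complex x y) =
      of_real n0 * klein t v + of_real ((B - A)\<^sup>2 * (y\<^sup>2 - y0\<^sup>2)) * t"
      by (simp add: plane_def n0_def vI stretch_Complex power_mult_distrib right_diff_distrib)
    show "(cmod (stretch (Complex x y)))\<^sup>2 + 1 = n0 + (B - A)\<^sup>2 * (y\<^sup>2 - y0\<^sup>2)"
      unfolding n0_def v_def stretch_Complex cmod_power2 by (simp add: power_mult_distrib right_diff_distrib)
  qed
  show "plane ` Complex x ` {y0..} \<subseteq> geodesic (plane (Complex x y0)) t"
  proof clarify
    fix y assume "y0 \<le> y"
    then have "y0\<^sup>2 \<le> y\<^sup>2" using y0 by (intro power_mono) auto
    then have "plane (Complex x y) \<in> closed_segment (klein t v) t"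
      by (intro closed_segment_mem[OF _ _ _ W V]) (use n0 cmod_sq_plus_1_pos in auto)
    moreover have "Complex x y \<in> uhp" using y0 \<open>y0 \<le> y\<close> by (simp add: uhp_def)
    ultimately show "plane (Complex x y) \<in> geodesic (plane (Complex x y0)) t"
      using plane_hplane by (simp add: geodesic_def vk)
  qed
  show "geodesic (plane (Complex x y0)) t \<subseteq> plane ` Complex x ` {y0..}"
  proof
    fix k assume "k \<in> geodesic (plane (Complex x y0)) t"
    then obtain \<mu> where \<mu>: "0 \<le> \<mu>" "\<mu> \<le> 1" "k = (1 - \<mu>) *\<^sub>R klein t v + \<mu> *\<^sub>R t" and k1: "cmod k < 1"
      unfolding geodesic_def closed_segment_def vk by auto
    have "\<mu> \<noteq> 1" using k1 \<mu>(3) t by auto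
    then have m: "1 - \<mu> > 0" using \<mu>(2) by simp
    \<comment> \<open>\<open>e\<close> is the weight of t when the starting point has weight
      \<open>n0\<close>, from e : n0 = \<mu> : (1 - \<mu>); the height is then solved from
      it.\<close>
    define e where "e = \<mu> * n0 / (1 - \<mu>)"
    have e: "e \<ge> 0" using m \<mu> n0 by (simp add: e_def)
    define y where "y = sqrt (y0\<^sup>2 + e / (B - A)\<^sup>2)"
    have y2: "y\<^sup>2 = y0\<^sup>2 + e / (B - A)\<^sup>2" unfolding y_def using e by simp
    have ye: "(B - A)\<^sup>2 * (y\<^sup>2 - y0\<^sup>2) = e" unfolding y2 using AB by simp
    have ge: "y0 \<le> y" unfolding y_def using e by (intro real_le_rsqrt) simp
    have ne: "n0 + e = n0 / (1 - \<mu>)" using m by (simp add: e_def field_simps)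
    have "of_real (n0 / (1 - \<mu>)) * plane (Complex x y) = of_real n0 * klein t v + of_real e * t"
      using V[of y] W[of y] unfolding ye ne by simp
    also have "\<dots> = of_real (n0 / (1 - \<mu>)) * k"
      unfolding \<mu>(3) e_def using m by (simp add: scaleR_conv_of_real field_simps flip: of_real_diff)
    finally have "plane (Complex x y) = k" using n0 m by simp
    then show "k \<in> plane ` Complex x ` {y0..}" using ge by auto
  qed
qed

lemma vertical_side:
  assumes y: "y > 0"
  shows "plane (Complex 0 y) \<in> geodesic t (klein t (of_real A))" "plane (Complex 1 y) \<in> geodesic t (klein t (of_real B))"
proof -
  have u: "Complex 0 y \<in> uhp" "Complex 1 y \<in> uhp" using y by (auto simp: uhp_def)
  have "plane (Complex 0 y) \<in> closed_segment (klein t (of_real A)) t"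
    by (rule closed_segment_mem[where a = "A\<^sup>2 + 1" and c = "(B - A)\<^sup>2 * y\<^sup>2" and s = "(cmod (stretch (Complex 0 y)))\<^sup>2 + 1"])
       (use plane_combination[of 0 y] cmod_sq_plus_1_pos in \<open>simp_all add: add_nonneg_pos\<close>)
  then show "plane (Complex 0 y) \<in> geodesic t (klein t (of_real A))"
    using plane_hplane[OF u(1)] by (simp add: geodesic_def closed_segment_commute)
  have "plane (Complex 1 y) \<in> closed_segment (klein t (of_real B)) t"
    by (rule closed_segment_mem[where a = "B\<^sup>2 + 1" and c = "(B - A)\<^sup>2 * y\<^sup>2" and s = "(cmod (stretch (Complex 1 y)))\<^sup>2 + 1"])
       (use plane_combination[of 1 y] cmod_sq_plus_1_pos in \<open>simp_all add: add_nonneg_pos\<close>)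
  then show "plane (Complex 1 y) \<in> geodesic t (klein t (of_real B))"
    using plane_hplane[OF u(2)] by (simp add: geodesic_def closed_segment_commute)
qed

lemma plane_horoball_infinity:
  assumes "s > 0" "1 / s < (B - A) * y" 
  shows "plane (Complex x y) \<in> horoball t s"
proof -
  have "0 < 1 / s" using assms(1) by simp
  then have "0 < (B - A) * y" using assms(2) by linarith
  then show ?thesis
    using klein_horoball[OF t, of "stretch (Complex x y)" s] assms by (simp add: plane_def stretch_Complex uhp_def)
qed

lemma plane_horoball_real:
  assumes "y > 0" "(B - A) * y < s"
  shows "plane (Complex 0 y) \<in> horoball (klein t (of_real A)) s" "plane (Complex 1 y) \<in> horoball (klein t (of_real B)) s"
  using klein_horoball_real[OF t _ assms(2)] assms(1) AB by (simp_all add: plane_def stretch_Complex)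

end

section \<open>Passage through the interior of the triangle, and the assembly\<close>

text \<open>Extension to the half-plane starts from an open connected set, whereas the triangle
  contains its sides; these are recovered afterwards by continuity.\<close>

definition triangle_interior :: "complex set" where
  "triangle_interior = {z. 0 < Re z \<and> Re z < 1 \<and> 0 < Im z \<and> Re z * (1 - Re z) < (Im z)\<^sup>2}"

lemma triangle_interior_subset: "triangle_interior \<subseteq> standard_triangle"
  by (auto simp: triangle_interior_def standard_triangle_def)

lemma open_triangle_interior: "open triangle_interior"
proof -
  have "triangle_interior = {z. 0 < Re z} \<inter> {z. Re z < 1} \<inter> {z. 0 < Im z} \<inter> {z. Re z * (1 - Re z) < (Im z)\<^sup>2}"
    by (auto simp: triangle_interior_def)
  also have "open \<dots>" by (intro open_Int open_Collect_less continuous_intros)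
  finally show ?thesis .
qed

text \<open>The region above the half-circle is not convex, but x and the excess y^2 - x(1 - x)
  parametrise it by a product of intervals.\<close>

lemma connected_triangle_interior: "connected triangle_interior"
proof -
  let ?f = "\<lambda>(x::real, v). Complex x (sqrt (x * (1 - x) + v))"
  have "triangle_interior = ?f ` ({0<..<1} \<times> {0<..})"
  proof
    show "triangle_interior \<subseteq> ?f ` ({0<..<1} \<times> {0<..})"
    proof
      fix z assume z: "z \<in> triangle_interior"
      have "z = ?f (Re z, (Im z)\<^sup>2 - Re z * (1 - Re z))"
        using z by (simp add: triangle_interior_def complex_eq_iff)
      then show "z \<in> ?f ` ({0<..<1} \<times> {0<..})"
        using z by (intro image_eqI[where x = "(Re z, (Im z)\<^sup>2 - Re z * (1 - Re z))"]) (auto simp: triangle_interior_def)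
    qed
    show "?f ` ({0<..<1} \<times> {0<..}) \<subseteq> triangle_interior"
    proof
      fix z assume "z \<in> ?f ` ({0<..<1} \<times> {0<..})"
      then obtain x v where xv: "0 < x" "x < 1" "0 < v" and z: "z = Complex x (sqrt (x * (1 - x) + v))" by auto
      have "x * (1 - x) + v > 0" using xv by (intro add_pos_pos mult_pos_pos) auto
      then show "z \<in> triangle_interior" using xv unfolding z by (simp add: triangle_interior_def)
    qed
  qed
  moreover have "connected (?f ` ({0<..<1} \<times> {0<..}))"
    by (intro connected_continuous_image convex_connected convex_Times)
       (auto simp: Complex_eq case_prod_unfold intro!: continuous_intros)
  ultimately show ?thesis by simp
qed

lemma eq_on_standard_triangle:
  fixes f g :: "complex \<Rightarrow> 'f::metric_space"
  assumes f: "continuous_on standard_triangle f" and g: "continuous_on standard_triangle g"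
    and eq: "\<And>z. z \<in> triangle_interior \<Longrightarrow> f z = g z" and z: "z \<in> standard_triangle"
  shows "f z = g z"
proof -
  define x y where "x = Re z" and "y = Im z"
  have xy: "0 \<le> x" "x \<le> 1" "0 < y" "x * (1 - x) \<le> y\<^sup>2" using z by (auto simp: standard_triangle_def x_def y_def)
  define e :: "nat \<Rightarrow> real" where "e n = inverse (real (Suc (Suc n)))" for n
  have e: "0 < e n" "e n < 1" for n by (auto simp: e_def field_simps)
  have e0: "e \<longlonglongrightarrow> 0" unfolding e_def using LIMSEQ_Suc[OF LIMSEQ_inverse_real_of_nat] by simp
  \<comment> \<open>Moving the fraction (e n)^2 of the way towards 1/2 raises x(1 - x) by less than
    (e n)^2, while raising the height by e n adds at least (e n)^2 to its square; so the points are
    interior.\<close>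
  define u where "u n = Complex (x + (e n)\<^sup>2 * (1/2 - x)) (y + e n)" for n
  have uI: "u n \<in> triangle_interior" for n
  proof -
    define d where "d = (e n)\<^sup>2"
    have d: "0 < d" "d < 1" using e[of n] by (auto simp: d_def power_less_one_iff abs_square_less_1)
    have "(1 - d) * x \<ge> 0" "(1 - d) * x \<le> (1 - d) * 1" using d xy by (auto intro!: mult_left_mono)
    then have X: "0 < x + d * (1/2 - x)" "x + d * (1/2 - x) < 1" using d by (auto simp: algebra_simps)
    have "(x + d * (1/2 - x)) * (1 - (x + d * (1/2 - x))) = (1 - d)\<^sup>2 * (x * (1 - x)) + (2 * d - d\<^sup>2) / 4"
      by (simp add: power2_eq_square algebra_simps, simp add: field_simps)
    also have "\<dots> < 1 * (x * (1 - x)) + d"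
    proof (intro add_le_less_mono mult_right_mono)
      show "(1 - d)\<^sup>2 \<le> 1" using d by (simp add: power_le_one)
      have "2 * d - d\<^sup>2 < d * 4" using d zero_le_power2[of d] by linarith
      then show "(2 * d - d\<^sup>2) / 4 < d" by (simp add: pos_divide_less_eq)
    qed (use xy in auto)
    also have "\<dots> \<le> y\<^sup>2 + (e n)\<^sup>2" using xy by (simp add: d_def)
    also have "\<dots> \<le> (y + e n)\<^sup>2" using xy e[of n] by (simp add: power2_eq_square algebra_simps)
    finally show ?thesis using X xy e[of n] by (simp add: triangle_interior_def u_def d_def)
  qed
  have uz: "u \<longlonglongrightarrow> z"
  proof -
    have "(\<lambda>n. Complex (x + (e n)\<^sup>2 * (1/2 - x)) (y + e n)) \<longlonglongrightarrow> Complex (x + 0\<^sup>2 * (1/2 - x)) (y + 0)"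
      by (intro tendsto_intros e0)
    then show ?thesis by (simp add: u_def[abs_def] x_def y_def)
  qed
  have uT: "u n \<in> standard_triangle" for n using uI triangle_interior_subset by blast
  have "(\<lambda>n. f (u n)) \<longlonglongrightarrow> f z" "(\<lambda>n. g (u n)) \<longlonglongrightarrow> g z"
    using continuous_on_tendsto_compose[OF f uz z] continuous_on_tendsto_compose[OF g uz z] uT by auto
  moreover have "f (u n) = g (u n)" for n using eq[OF uI] .
  ultimately show ?thesis using LIMSEQ_unique by simp
qed

lemma embedding_map_inj_on:
  assumes "embedding_map (top_of_set S) (top_of_set F) f" shows "inj_on f S"
  using homeomorphic_imp_injective_map assms unfolding embedding_map_def by fastforce

lemma slits_embedded:
  fixes F :: "'f::metric_space set"
  assumes F: "complete_hyperbolic_surface F" and t: "cmod t = 1" and AB: "A < B"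
    and a: "a = klein t (of_real A)" "cmod a = 1" and b: "b = klein t (of_real B)" "cmod b = 1"
    and iso: "local_isometry (ideal_triangle t a b) F \<nu>"
    and ta: "embedding_map (top_of_set (geodesic t a)) (top_of_set F) \<nu>"
    and tb: "embedding_map (top_of_set (geodesic t b)) (top_of_set F) \<nu>"
    and cusps: "\<forall>v\<in>{t, a, b}. maps_to_cusp (ideal_triangle t a b) F \<nu> v"
    and n: "n \<in> ideal_triangle t a b"
  shows "embedding_map (top_of_set (geodesic n t)) (top_of_set F) \<nu>"
proof -
  interpret hyp_charts F by (rule complete_hyperbolic_surface_charts[OF F])
  interpret klein_triangle t A B by unfold_locales (rule t AB)+
  let ?T = "ideal_triangle t a b"
  have pT: "plane z \<in> ?T" if "z \<in> standard_triangle" for z using plane_in_triangle[OF that] a b by simp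
  have "liso F (stretch ` standard_triangle) (\<lambda>z. \<nu> (klein t z))"
    by (rule local_isometry_liso[OF t iso])
       (use stretch_uhp standard_triangle_uhp pT in \<open>auto simp: plane_def\<close>)
  then have "liso F standard_triangle (\<lambda>z. \<nu> (klein t (stretch z)))"
    by (rule liso_comp[OF _ isom_stretch standard_triangle_uhp]) (use stretch_uhp standard_triangle_uhp in auto)
  then have \<nu>T: "liso F standard_triangle (\<lambda>z. \<nu> (plane z))" by (simp add: plane_def)
  have iu: "triangle_interior \<subseteq> uhp" using triangle_interior_subset standard_triangle_uhp by blast
  have "Complex (1/2) 1 \<in> triangle_interior" by (simp add: triangle_interior_def)
  then have ne: "triangle_interior \<noteq> {}" by blast
  have "\<exists>N. liso F uhp N \<and> (\<forall>z\<in>triangle_interior. N z = \<nu> (plane z))"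
    by (rule liso_extension[OF liso_subset[OF \<nu>T triangle_interior_subset] open_triangle_interior
          connected_triangle_interior iu ne]) simp
  then obtain N where N: "liso F uhp N" "\<forall>z\<in>triangle_interior. N z = \<nu> (plane z)" by blast
  have N\<nu>: "N z = \<nu> (plane z)" if "z \<in> standard_triangle" for z
    by (rule eq_on_standard_triangle[OF continuous_on_subset[OF liso_continuous[OF N(1) order_refl] standard_triangle_uhp]
         liso_continuous[OF \<nu>T standard_triangle_uhp] _ that]) (use N(2) in simp)
  have side: "Complex v y \<in> standard_triangle" "Complex v y \<in> uhp" if "v = 0 \<or> v = 1" "y > 0" for v y
    using that by (auto simp: standard_triangle_def uhp_def)
  have injv: "y = y'" if v: "v = 0 \<or> v = 1" and y: "y > 0" "y' > 0" and eq: "N (Complex v y) = N (Complex v y')" for v y y'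
  proof -
    have "\<nu> (plane (Complex v y)) = \<nu> (plane (Complex v y'))" using eq N\<nu> side(1)[OF v] y by simp
    then have "plane (Complex v y) = plane (Complex v y')"
      using v inj_onD[OF embedding_map_inj_on[OF ta]] inj_onD[OF embedding_map_inj_on[OF tb]]
        vertical_side[OF y(1)] vertical_side[OF y(2)] a b by metis
    then have "Complex v y = Complex v y'" by (rule plane_inj[OF side(2)[OF v y(1)] side(2)[OF v y(2)]])
    then show ?thesis by simp
  qed
  \<comment> \<open>J moves infinity to the vertex in question, so that the vertical ray over 0 is
    carried into the end of the triangle there and \<open>cusp_translation\<close> applies to N
    \<circ> J.\<close>
  have cuspN: "\<exists>\<tau>. \<tau> \<noteq> 0 \<and> (\<forall>z\<in>uhp. N (J (z + of_real \<tau>)) = N (J z))"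
    if J: "isom J" and v: "v \<in> {t, a, b}" 
      and ray: "\<And>s. s > 0 \<Longrightarrow> \<exists>h\<ge>0. \<forall>y>h. J (Complex 0 y) \<in> standard_triangle \<and> plane (J (Complex 0 y)) \<in> horoball v s" for J v
  proof -
    obtain C s where C: "cusp F C" and s: "s > 0" "\<nu> ` (?T \<inter> horoball v s) \<subseteq> C"
      using cusps v unfolding maps_to_cusp_def by blast
    obtain h where h: "h \<ge> 0" "\<forall>y>h. J (Complex 0 y) \<in> standard_triangle \<and> plane (J (Complex 0 y)) \<in> horoball v s"
      using ray[OF s(1)] by blast
    have NJ: "liso F uhp (\<lambda>z. N (J z))"
      by (rule liso_comp[OF N(1) J]) (use isom_in_uhp[OF J] in auto)
    have inC: "N (J (Complex 0 y)) \<in> C" if "y > h" for y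
      using h(2) that N\<nu> pT s(2) by fastforce
    obtain h0 p \<tau> where p: "h0 > 0" "liso F {z. h0 < Im z} p" "\<tau> \<noteq> 0" "C = p ` {z. h0 < Im z}"
      "\<forall>x y. h0 < Im x \<longrightarrow> h0 < Im y \<longrightarrow> p x = p y \<longleftrightarrow> (\<exists>n::nat. y = x + of_real (of_nat n * \<tau>) \<or> x = y + of_real (of_nat n * \<tau>))"
      using cusp_in_half_plane[OF C] by (elim exE conjE)
    show ?thesis
      by (rule cusp_translation[OF NJ p(1-3) p(5)[rule_format] inC[unfolded p(4)] h(1)])
  qed
  have BA: "B - A > 0" using AB by simp
  have c_inf: "\<exists>\<tau>. \<tau> \<noteq> 0 \<and> (\<forall>z\<in>uhp. N (z + of_real \<tau>) = N z)"
  proof (rule cuspN[OF isom_id, of t])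
    fix s :: real assume s: "s > 0"
    have "plane (Complex 0 y) \<in> horoball t s" if y: "y > 1 / s / (B - A)" for y
    proof (rule plane_horoball_infinity[OF s])
      show "1 / s < (B - A) * y" using y unfolding pos_divide_less_eq[OF BA] by (simp only: mult.commute)
    qed
    moreover have h: "1 / s / (B - A) \<ge> 0" using s BA by simp
    moreover have "Complex 0 y \<in> standard_triangle" if "y > 1 / s / (B - A)" for y
      by (rule side(1)) (use that h in linarith)+
    ultimately show "\<exists>h\<ge>0. \<forall>y>h. Complex 0 y \<in> standard_triangle \<and> plane (Complex 0 y) \<in> horoball t s"
      by blast
  qed simp
  \<comment> \<open>Both - 1 / z and 1 - 1 / z carry height y over 0 to height 1 / y, over 0 and
    over 1 respectively; large y therefore means deep in the horoball at that vertex.\<close>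
  have near: "\<exists>h\<ge>0. \<forall>y>h. 0 < 1 / y \<and> (B - A) * (1 / y) < s" if "s > 0" for s
  proof (intro exI[of _ "(B - A) / s"] conjI allI impI)
    show "(B - A) / s \<ge> 0" using BA that by simp
    fix y assume y: "(B - A) / s < y"
    then have "0 < y" using BA that by (smt (verit) divide_nonneg_pos)
    then show "0 < 1 / y" "(B - A) * (1 / y) < s" using y that by (auto simp: pos_divide_less_eq mult.commute)
  qed
  have c_0: "\<exists>\<tau>. \<tau> \<noteq> 0 \<and> (\<forall>z\<in>uhp. N (- 1 / (z + of_real \<tau>)) = N (- 1 / z))"
  proof (rule cuspN[OF isom_inversion, of a])
    fix s :: real assume s: "s > 0"
    have J: "- 1 / Complex 0 y = Complex 0 (1 / y)" for y by (simp add: complex_eq_iff Re_divide Im_divide power2_eq_square)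
    show "\<exists>h\<ge>0. \<forall>y>h. - 1 / Complex 0 y \<in> standard_triangle \<and> plane (- 1 / Complex 0 y) \<in> horoball a s"
      unfolding J a(1) using near[OF s] side(1)[of 0] plane_horoball_real(1)[of _ s] by meson
  qed simp
  have c_1: "\<exists>\<tau>. \<tau> \<noteq> 0 \<and> (\<forall>z\<in>uhp. N (1 - 1 / (z + of_real \<tau>)) = N (1 - 1 / z))"
  proof (rule cuspN[OF isom_to_1, of b])
    fix s :: real assume s: "s > 0"
    have J: "1 - 1 / Complex 0 y = Complex 1 (1 / y)" for y by (simp add: complex_eq_iff Re_divide Im_divide power2_eq_square)
    show "\<exists>h\<ge>0. \<forall>y>h. 1 - 1 / Complex 0 y \<in> standard_triangle \<and> plane (1 - 1 / Complex 0 y) \<in> horoball b s"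
      unfolding J b(1) using near[OF s] side(1)[of 1] plane_horoball_real(2)[of _ s] by meson
  qed simp
  have CT: "cusped_triangle N"
    unfolding cusped_triangle_def using N(1) injv[of 0] injv[of 1] c_inf c_0 c_1 by blast
  obtain z0 where z0: "z0 \<in> standard_triangle" "plane z0 = n"
    using triangle_in_plane[of n] n a b by auto
  obtain x y0 where xy0: "z0 = Complex x y0" by (cases z0)
  have xy: "0 \<le> x" "x \<le> 1" "0 < y0" "x * (1 - x) \<le> y0\<^sup>2" using z0(1) by (auto simp: standard_triangle_def xy0)
  have up: "x * (1 - x) \<le> y\<^sup>2" if "y0 \<le> y" for y
    by (rule order_trans[OF xy(4) power_mono[OF that]]) (use xy(3) in simp)
  define R where "R = Complex x ` {y0..}"
  have RT: "R \<subseteq> standard_triangle" using xy up by (auto simp: R_def standard_triangle_def)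
  have Ru: "R \<subseteq> uhp" using RT standard_triangle_uhp by blast
  \<comment> \<open>A slit over 0 or 1 lies in an embedded side; only the slits over interior n need
    the crossing argument.\<close>
  have injR: "y = y'" if "y0 \<le> y" "y0 \<le> y'" "N (Complex x y) = N (Complex x y')" for y y'
  proof (cases "x = 0 \<or> x = 1")
    case True
    then show ?thesis by (rule injv) (use that xy in auto)
  next
    case False
    then show ?thesis
      using slit_injective[OF CT, of x y y'] up[OF that(1)] up[OF that(2)] that xy by auto
  qed
  obtain \<tau> where \<tau>: "\<tau> \<noteq> 0" "\<forall>z\<in>uhp. N (z + of_real \<tau>) = N z" using c_inf by blast
  obtain g where g: "homeomorphism R (N ` R) N g"
    using escaping_ray_embedding[OF N(1) \<tau> xy(3) injR] by (auto simp: R_def)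
  have G: "geodesic n t = plane ` R"
    using slit_in_plane[OF xy(3), of x] z0 by (simp add: R_def xy0)
  have h: "homeomorphism (geodesic n t) R unplane plane"
    unfolding homeomorphism_def
  proof (intro conjI)
    show "unplane ` geodesic n t = R" unfolding G using unplane_plane Ru by (force simp: image_image)
    show "continuous_on (geodesic n t) unplane"
      by (rule continuous_on_subset[OF continuous_unplane]) (auto simp: geodesic_def)
  qed (use G continuous_plane plane_unplane unplane_plane Ru in \<open>auto simp: geodesic_def\<close>)
  show ?thesis
  proof (rule embedding_map_through_homeomorphisms[OF g h])
    fix k assume "k \<in> geodesic n t"
    then obtain z where z: "z \<in> R" "k = plane z" using G by blast
    then show "\<nu> k = N (unplane k)"
      using N\<nu>[OF subsetD[OF RT z(1)]] unplane_plane[OF subsetD[OF Ru z(1)]] by simp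
  next
    show "N ` R \<subseteq> F" using liso_in[OF N(1)] Ru by blast
  qed
qed

theorem corollary4p13:
  fixes F :: "'f::metric_space set" and \<nu> :: "complex \<Rightarrow> 'f" and t a b :: complex
  assumes "complete_hyperbolic_surface F" and "finite_type F" and "\<exists>C. cusp F C"
    and "t \<in> ideal_boundary" "a \<in> ideal_boundary" "b \<in> ideal_boundary"
    and "t \<noteq> a" "t \<noteq> b" "a \<noteq> b"
    and "local_isometry (ideal_triangle t a b) F \<nu>"
    and "embedding_map (top_of_set (geodesic t a)) (top_of_set F) \<nu>"
    and "embedding_map (top_of_set (geodesic t b)) (top_of_set F) \<nu>"
    and "\<forall>v\<in>{t, a, b}. maps_to_cusp (ideal_triangle t a b) F \<nu> v"
  shows "\<forall>n\<in>ideal_triangle t a b.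
    embedding_map (top_of_set (geodesic n t)) (top_of_set F) \<nu>"
proof
  fix n assume n: "n \<in> ideal_triangle t a b"
  have t: "cmod t = 1" and a: "cmod a = 1" and b: "cmod b = 1" using assms(4-6) by auto
  obtain A where A: "a = klein t (of_real A)" using klein_ideal[OF t a] assms(7) by metis
  obtain B where B: "b = klein t (of_real B)" using klein_ideal[OF t b] assms(8) by metis
  have sw: "ideal_triangle t b a = ideal_triangle t a b" by (simp add: ideal_triangle_def insert_commute)
  \<comment> \<open>The triangle and the hypotheses are symmetric in a and b, so the vertex with the
    smaller coordinate can be taken first.\<close>
  consider "A < B" | "B < A" using A B assms(9) by fastforce
  then show "embedding_map (top_of_set (geodesic n t)) (top_of_set F) \<nu>"
  proof cases
    case 1
    then show ?thesis
      by (rule slits_embedded[OF assms(1) t _ A a B b assms(10-13) n])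
  next
    case 2
    have "\<forall>v\<in>{t, b, a}. maps_to_cusp (ideal_triangle t b a) F \<nu> v" using assms(13) sw by simp
    from slits_embedded[OF assms(1) t 2 B b A a assms(10)[folded sw] assms(12,11) this n[folded sw]] show ?thesis .
  qed
qed

end
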